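(* Let $s<0$ and let $\omega\in\mathbb{R}$, $\omega\neq 0$. There exists a space-time distribution $u\in C^0([0,1],H^s(\mathbb{T}))$, not identically vanishing, which is a weak solution in the extended sense of the Cauchy problem $$ iu_t+u_{xx}+\omega\,\mathbf{N}(u)=0,\qquad u(0,x)=u_0(x), $$ with initial datum $u_0\equiv 0$, where $\mathbf{N}(u)=\big(|u|^2-2\mu(|u|^2)\big)u$. Moreover, the limit defining $e^{-it\Delta}\mathbf{N}(u)$ exists in the $C^{-1}([0,1],H^s)$ norm; that is, for every sequence $(\mathcal{P}_N)_{N\in\mathbb{N}}$ of Fourier cutoff operators, $e^{-it\Delta}\mathbf{N}(\mathcal{P}_N u)$ converges to $e^{-it\Delta}\mathbf{N}(u)$ in the $C^{-1}([0,1],H^s(\mathbb{T}))$ norm as $N\to\infty$.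
   Context: $\mathbb{T}=\mathbb{R}/2\pi\mathbb{Z}$; $t\in[0,1]$, $x\in\mathbb{T}$. $\mu(f)=(2\pi)^{-1}\int_{\mathbb{T}}f(x)\,dx$, applied at each fixed time $t$. The partial Fourier transform is $\widehat f(t,n)=(2\pi)^{-1}\int_{\mathbb{T}}f(t,x)e^{-inx}\,dx$, $n\in\mathbb{Z}$, extended to distributions by continuity. $H^s(\mathbb{T})$ has norm $\|f\|_{H^s}=\big(\sum_n |\widehat f(n)|^2(1+n^2)^s\big)^{1/2}$. $\Delta=\partial_x^2$, and $e^{-it\Delta}$ acts by $\widehat{(e^{-it\Delta}f)}(t,n)=e^{in^2t}\widehat f(t,n)$. Fourier cutoff operators: a sequence of Fourier cutoff operators is any sequence $(\mathcal{P}_N)_{N\in\mathbb{N}}$ of linear operators on $\mathcal{D}'(\mathbb{T})$ of the form $\widehat{\mathcal{P}_Nf}(n)=m_N(n)\widehat f(n)$, where the functions $m_N:\mathbb{Z}\to\mathbb{C}$ each have finite support, are uniformly bounded (in $N$ and $n$), and satisfy $\lim_{N\to\infty}m_N(k)=1$ for all $k\in\mathbb{Z}$. They act on functions of $(t,x)$ in the $x$ variable. Existence of the nonlinear term: for a distribution $u\in\mathcal{D}'((0,1)\times\mathbb{T})$, $\mathbf{N}(u)$ is said to exist and to equal $v\in\mathcal{D}'((0,1)\times\mathbb{T})$ if for every sequence $(\mathcal{P}_N)$ of Fourier cutoff operators, $\lim_{N\to\infty}\mathbf{N}(\mathcal{P}_Nu)=v$ in the topology of $\mathcal{D}'((0,1)\times\mathbb{T})$.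 Weak solution in the extended sense: $u\in C^0([0,1],H^s(\mathbb{T}))$ is a weak solution of the Cauchy problem in the extended sense if $u(0,\cdot)=u_0$, $\mathbf{N}(u)$ exists in the sense that there is $v\in\mathcal{D}'((0,1)\times\mathbb{T})$ with $\lim_{N\to\infty}\mathbf{N}(\mathcal{P}_Nu)=v$ in the topology of $\mathcal{D}'((0,1)\times\mathbb{T})$ for every sequence $(\mathcal{P}_N)$ of Fourier cutoff operators, and $iu_t+u_{xx}+\omega\mathbf{N}(u)=0$ holds in the sense of distributions on $(0,1)\times\mathbb{T}$ with $\mathbf{N}(u)$ interpreted as this limit $v$. For a function space $\mathcal{H}=\mathcal{H}(\mathbb{T})$, $C^{-1}([0,1],\mathcal{H})$ is the space of space-time distributions $F$ such that $\tilde F(t,x)=\int_0^tF(s,x)\,ds$ belongs to $C^0([0,1],\mathcal{H})$ (i.e. $F=\partial_t\tilde F$ with $\tilde F\in C^0([0,1],\mathcal{H})$, $\tilde F(0)=0$), with norm $\|F\|_{C^{-1}([0,1],\mathcal{H})}=\max_{t\in[0,1]}\|\tilde F(t,\cdot)\|_{\mathcal{H}}$. *)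

theory Defs
  imports "HOL-Analysis.Analysis"
begin

section \<open>Smooth functions and test functions\<close>

definition dirderiv :: "'a \<Rightarrow> ('a::real_normed_vector \<Rightarrow> complex) \<Rightarrow> 'a \<Rightarrow> complex" where
  "dirderiv v f = (\<lambda>p. frechet_derivative f (at p) v)"

primrec Ck :: "nat \<Rightarrow> ('a::real_normed_vector \<Rightarrow> complex) \<Rightarrow> bool" where
  "Ck 0 f \<longleftrightarrow> continuous_on UNIV f"
| "Ck (Suc k) f \<longleftrightarrow> (\<forall>p. f differentiable at p) \<and> (\<forall>v. Ck k (dirderiv v f))"

definition smooth :: "('a::real_normed_vector \<Rightarrow> complex) \<Rightarrow> bool" where
  "smooth f \<longleftrightarrow> (\<forall>k. Ck k f)"

text \<open>Functions on the torus are $2\pi$-periodic functions on the line.  Functions on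
  $(0,1) \times \mathbb{T}$ are functions of $(t,x)$ that are $2\pi$-periodic in $x$; those with
  compact support are extended by zero to all real $t$.\<close>

definition test_T :: "(real \<Rightarrow> complex) set" where
  "test_T = {\<phi>. smooth \<phi> \<and> (\<forall>x. \<phi> (x + 2 * pi) = \<phi> x)}"

definition supp_in :: "real \<Rightarrow> real \<Rightarrow> (real \<times> real \<Rightarrow> complex) \<Rightarrow> bool" where
  "supp_in a b \<phi> \<longleftrightarrow> (\<forall>t x. \<phi> (t, x) \<noteq> 0 \<longrightarrow> a \<le> t \<and> t \<le> b)"

definition test_ST :: "(real \<times> real \<Rightarrow> complex) set" where
  "test_ST = {\<phi>. smooth \<phi> \<and> (\<forall>t x. \<phi> (t, x + 2 * pi) = \<phi> (t, x)) \<and>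
                 (\<exists>a b. 0 < a \<and> b < 1 \<and> supp_in a b \<phi>)}"

definition dt :: "(real \<times> real \<Rightarrow> complex) \<Rightarrow> real \<times> real \<Rightarrow> complex" where
  "dt = dirderiv (1, 0)"

definition dx :: "(real \<times> real \<Rightarrow> complex) \<Rightarrow> real \<times> real \<Rightarrow> complex" where
  "dx = dirderiv (0, 1)"


section \<open>Distributions\<close>

text \<open>A distribution is a functional on the test functions.  Since HOL functions are total, its
  values off the test functions are junk, and distributions are only ever compared on test
  functions.  Sequential continuity is continuity here, because the space of test functions is
  a Frechet space on the torus and a strict inductive limit of Frechet spaces on
  $(0,1) \times \mathbb{T}$.\<close>

type_synonym dist_T = "(real \<Rightarrow> complex) \<Rightarrow> complex"
type_synonym dist_ST = "(real \<times> real \<Rightarrow> complex) \<Rightarrow> complex"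

definition test_T_tendsto :: "(nat \<Rightarrow> real \<Rightarrow> complex) \<Rightarrow> (real \<Rightarrow> complex) \<Rightarrow> bool" where
  "test_T_tendsto \<Phi> \<phi> \<longleftrightarrow>
     (\<forall>k. uniform_limit UNIV (\<lambda>i. (dirderiv 1 ^^ k) (\<Phi> i)) ((dirderiv 1 ^^ k) \<phi>) sequentially)"

definition distribution_T :: "dist_T \<Rightarrow> bool" where
  "distribution_T f \<longleftrightarrow>
     (\<forall>\<phi>\<in>test_T. \<forall>\<psi>\<in>test_T. \<forall>a b. f (\<lambda>x. a * \<phi> x + b * \<psi> x) = a * f \<phi> + b * f \<psi>) \<and>
     (\<forall>\<Phi> \<phi>. (\<forall>i. \<Phi> i \<in> test_T) \<and> \<phi> \<in> test_T \<and> test_T_tendsto \<Phi> \<phi> \<longrightarrow>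
        (\<lambda>i. f (\<Phi> i)) \<longlonglongrightarrow> f \<phi>)"

definition test_ST_tendsto ::
  "(nat \<Rightarrow> real \<times> real \<Rightarrow> complex) \<Rightarrow> (real \<times> real \<Rightarrow> complex) \<Rightarrow> bool" where
  "test_ST_tendsto \<Phi> \<phi> \<longleftrightarrow>
     (\<exists>a b. 0 < a \<and> b < 1 \<and> (\<forall>i. supp_in a b (\<Phi> i))) \<and>
     (\<forall>j k. uniform_limit UNIV (\<lambda>i. (dt ^^ j) ((dx ^^ k) (\<Phi> i)))
              ((dt ^^ j) ((dx ^^ k) \<phi>)) sequentially)"

definition distribution_ST :: "dist_ST \<Rightarrow> bool" where
  "distribution_ST F \<longleftrightarrow>
     (\<forall>\<phi>\<in>test_ST. \<forall>\<psi>\<in>test_ST. \<forall>a b. F (\<lambda>p. a * \<phi> p + b * \<psi> p) = a * F \<phi> + b * F \<psi>) \<and>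
     (\<forall>\<Phi> \<phi>. (\<forall>i. \<Phi> i \<in> test_ST) \<and> \<phi> \<in> test_ST \<and> test_ST_tendsto \<Phi> \<phi> \<longrightarrow>
        (\<lambda>i. F (\<Phi> i)) \<longlonglongrightarrow> F \<phi>)"

definition dist_ST_tendsto :: "(nat \<Rightarrow> dist_ST) \<Rightarrow> dist_ST \<Rightarrow> bool" where
  "dist_ST_tendsto F G \<longleftrightarrow> (\<forall>\<phi>\<in>test_ST. (\<lambda>N. F N \<phi>) \<longlonglongrightarrow> G \<phi>)"

definition dist_dt :: "dist_ST \<Rightarrow> dist_ST" where
  "dist_dt F \<phi> = - F (dt \<phi>)"

definition dist_dx :: "dist_ST \<Rightarrow> dist_ST" where
  "dist_dx F \<phi> = - F (dx \<phi>)"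

definition fun_dist :: "(real \<Rightarrow> complex) \<Rightarrow> dist_T" where
  "fun_dist g \<phi> = integral {0..2 * pi} (\<lambda>x. g x * \<phi> x)"

text \<open>The space-time distribution given by a time-dependent distribution on the torus.\<close>

definition st_dist :: "(real \<Rightarrow> dist_T) \<Rightarrow> dist_ST" where
  "st_dist U \<phi> = integral {0..1} (\<lambda>t. U t (\<lambda>x. \<phi> (t, x)))"


section \<open>Fourier coefficients and Sobolev spaces\<close>

text \<open>For a function \<open>g\<close>, the coefficient $(2\pi)^{-1}\int g(x)e^{-inx}\,dx$ is
  \<open>fourier_coeff (fun_dist g) n\<close>.\<close>

definition fourier_coeff :: "dist_T \<Rightarrow> int \<Rightarrow> complex" where
  "fourier_coeff f n = f (\<lambda>x. cis (- (of_int n * x))) / (2 * pi)"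

definition sobolev_term :: "real \<Rightarrow> dist_T \<Rightarrow> int \<Rightarrow> real" where
  "sobolev_term s f n = (cmod (fourier_coeff f n))\<^sup>2 * (1 + (real_of_int n)\<^sup>2) powr s"

definition sobolev :: "real \<Rightarrow> dist_T set" where
  "sobolev s = {f. distribution_T f \<and> sobolev_term s f summable_on UNIV}"

definition sobolev_norm :: "real \<Rightarrow> dist_T \<Rightarrow> real" where
  "sobolev_norm s f = sqrt (\<Sum>\<^sub>\<infinity>n. sobolev_term s f n)"

definition C0_sobolev :: "real \<Rightarrow> (real \<Rightarrow> dist_T) set" where
  "C0_sobolev s = {u. (\<forall>t\<in>{0..1}. u t \<in> sobolev s) \<and>
     (\<forall>t\<in>{0..1}. ((\<lambda>\<tau>. sobolev_norm s (\<lambda>\<phi>. u \<tau> \<phi> - u t \<phi>)) \<longlongrightarrow> 0) (at t within {0..1}))}"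


section \<open>Space-time distributions that are time derivatives of continuous curves\<close>

definition primitive_Cm1 :: "real \<Rightarrow> dist_ST \<Rightarrow> (real \<Rightarrow> dist_T) \<Rightarrow> bool" where
  "primitive_Cm1 s F G \<longleftrightarrow> G \<in> C0_sobolev s \<and> (\<forall>\<psi>\<in>test_T. G 0 \<psi> = 0) \<and>
     (\<forall>\<phi>\<in>test_ST. F \<phi> = dist_dt (st_dist G) \<phi>)"

definition Cm1_sobolev :: "real \<Rightarrow> dist_ST set" where
  "Cm1_sobolev s = {F. distribution_ST F \<and> (\<exists>G. primitive_Cm1 s F G)}"

text \<open>The primitive is unique on \<open>[0,1]\<close> as a curve of distributions, so the choice is
  immaterial.\<close>

definition Cm1_norm :: "real \<Rightarrow> dist_ST \<Rightarrow> real" where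
  "Cm1_norm s F = (SUP t\<in>{0..1}. sobolev_norm s ((SOME G. primitive_Cm1 s F G) t))"

definition Cm1_tendsto :: "real \<Rightarrow> (nat \<Rightarrow> dist_ST) \<Rightarrow> dist_ST \<Rightarrow> bool" where
  "Cm1_tendsto s F G \<longleftrightarrow> (\<forall>N. F N \<in> Cm1_sobolev s) \<and> G \<in> Cm1_sobolev s \<and>
     (\<lambda>N. Cm1_norm s (\<lambda>\<phi>. F N \<phi> - G \<phi>)) \<longlonglongrightarrow> 0"


section \<open>The free Schroedinger group on space-time distributions\<close>

definition free_test :: "(real \<times> real \<Rightarrow> complex) \<Rightarrow> real \<times> real \<Rightarrow> complex" where
  "free_test \<phi> = (\<lambda>(t, x). \<Sum>\<^sub>\<infinity>n::int.
     cis ((of_int n)\<^sup>2 * t) * fourier_coeff (fun_dist (\<lambda>y. \<phi> (t, y))) n * cis (of_int n * x))"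

text \<open>The operator $e^{-it\Delta}$ is its own transpose for the bilinear pairing, because its
  symbol $e^{in^2t}$ is even in $n$; so it acts on distributions as follows.\<close>

definition free_evol :: "dist_ST \<Rightarrow> dist_ST" where
  "free_evol F \<phi> = F (free_test \<phi>)"

text \<open>The partial Fourier transform of a space-time distribution: for each \<open>n\<close> a distribution
  in time.  The lemma \<open>partial_fourier_free_evol\<close> says that \<open>free_evol\<close>
  multiplies it by $e^{in^2t}$.\<close>

definition partial_fourier :: "dist_ST \<Rightarrow> int \<Rightarrow> (real \<Rightarrow> complex) \<Rightarrow> complex" where
  "partial_fourier F n \<psi> = F (\<lambda>(t, x). \<psi> t * cis (- (of_int n * x))) / (2 * pi)"

lemma integral_cis:
  "integral {0..2 * pi} (\<lambda>x. cis (of_int k * x)) = (if k = 0 then 2 * pi else 0)"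
proof (cases "k = 0")
  case False
  have "((\<lambda>x. cis (of_int k * x) / (\<i> * of_int k)) has_vector_derivative cis (of_int k * x))
          (at x within {0..2 * pi})" for x
  proof -
    have "((\<lambda>z. exp (\<i> * of_int k * z) / (\<i> * of_int k)) has_field_derivative
            exp (\<i> * of_int k * of_real x)) (at (of_real x))"
      using False by (auto intro!: derivative_eq_intros simp: field_simps)
    from has_vector_derivative_real_field[OF this, of "{0..2 * pi}"] show ?thesis
      by (simp add: cis_conv_exp mult.assoc o_def)
  qed
  hence "((\<lambda>x. cis (of_int k * x)) has_integral
      cis (of_int k * (2 * pi)) / (\<i> * of_int k) - cis (of_int k * 0) / (\<i> * of_int k)) {0..2 * pi}"
    by (intro fundamental_theorem_of_calculus) auto
  moreover have "cis (of_int k * (2 * pi)) = 1"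
    using cis_multiple_2pi[of "of_int k"] by (simp add: mult.commute mult.left_commute)
  ultimately show ?thesis using False by (simp add: integral_unique)
qed (simp add: scaleR_conv_of_real)

lemma fourier_coeff_cis:
  "fourier_coeff (fun_dist (\<lambda>x. c * cis (of_int k * x))) n = (if k = n then c else 0)"
proof -
  have "(\<lambda>x. c * cis (of_int k * x) * cis (- (of_int n * x)))
        = (\<lambda>x. c * cis (of_int (k - n) * x))"
    by (auto simp: mult.assoc cis_mult algebra_simps)
  thus ?thesis
    using integral_cis[of "k - n"]
    by (simp add: fourier_coeff_def fun_dist_def del: of_int_diff)
qed

lemma partial_fourier_free_evol:
  "partial_fourier (free_evol F) n \<psi> = partial_fourier F n (\<lambda>t. cis ((of_int n)\<^sup>2 * t) * \<psi> t)"
proof -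
  have coeff: "fourier_coeff (fun_dist (\<lambda>y. \<psi> t * cis (- (of_int n * y)))) k
      = (if k = - n then \<psi> t else 0)" for t k
    using fourier_coeff_cis[of "\<psi> t" "- n" k] by auto
  have "free_test (\<lambda>(t, x). \<psi> t * cis (- (of_int n * x)))
      = (\<lambda>(t, x). cis ((of_int n)\<^sup>2 * t) * \<psi> t * cis (- (of_int n * x)))"
  proof (rule ext, clarify)
    fix t x :: real
    have "free_test (\<lambda>(t, x). \<psi> t * cis (- (of_int n * x))) (t, x)
       = (\<Sum>\<^sub>\<infinity>k::int. cis ((of_int k)\<^sup>2 * t) * (if k = - n then \<psi> t else 0) * cis (of_int k * x))"
      by (simp add: free_test_def coeff)
    also have "\<dots> = (\<Sum>\<^sub>\<infinity>k\<in>{- n}. cis ((of_int k)\<^sup>2 * t) * (if k = - n then \<psi> t else 0) * cis (of_int k * x))"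
      by (rule infsum_cong_neutral) auto
    finally show "free_test (\<lambda>(t, x). \<psi> t * cis (- (of_int n * x))) (t, x)
       = cis ((of_int n)\<^sup>2 * t) * \<psi> t * cis (- (of_int n * x))"
      by simp
  qed
  thus ?thesis by (simp add: partial_fourier_def free_evol_def)
qed


section \<open>Fourier cutoff operators\<close>

text \<open>For finitely supported \<open>m\<close> the image of a distribution is a trigonometric polynomial,
  and it is given here as a function; \<open>fourier_coeff_multiplier\<close> is the defining
  property.\<close>

definition fourier_multiplier :: "(int \<Rightarrow> complex) \<Rightarrow> dist_T \<Rightarrow> real \<Rightarrow> complex" where
  "fourier_multiplier m f x = (\<Sum>n | m n \<noteq> 0. m n * fourier_coeff f n * cis (of_int n * x))"

definition fourier_cutoffs :: "(nat \<Rightarrow> dist_T \<Rightarrow> real \<Rightarrow> complex) \<Rightarrow> bool" where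
  "fourier_cutoffs P \<longleftrightarrow> (\<exists>m :: nat \<Rightarrow> int \<Rightarrow> complex.
     (\<forall>N. finite {n. m N n \<noteq> 0}) \<and>
     (\<exists>C. \<forall>N n. cmod (m N n) \<le> C) \<and>
     (\<forall>k. (\<lambda>N. m N k) \<longlonglongrightarrow> 1) \<and>
     (\<forall>N. P N = fourier_multiplier (m N)))"

lemma fourier_coeff_multiplier:
  assumes "finite {k. m k \<noteq> 0}"
  shows "fourier_coeff (fun_dist (fourier_multiplier m f)) n = m n * fourier_coeff f n"
proof -
  let ?c = "\<lambda>k. m k * fourier_coeff f k"
  have "fourier_coeff (fun_dist (fourier_multiplier m f)) n
      = integral {0..2 * pi} (\<lambda>x. \<Sum>k | m k \<noteq> 0. ?c k * cis (of_int k * x) * cis (- (of_int n * x)))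
        / (2 * pi)"
    by (simp add: fourier_coeff_def fun_dist_def fourier_multiplier_def sum_distrib_right)
  also have "\<dots> = (\<Sum>k | m k \<noteq> 0. integral {0..2 * pi}
        (\<lambda>x. ?c k * cis (of_int k * x) * cis (- (of_int n * x)))) / (2 * pi)"
    using assms
    by (subst integral_sum) (auto intro!: integrable_continuous_real continuous_intros)
  also have "\<dots> = (\<Sum>k | m k \<noteq> 0. fourier_coeff (fun_dist (\<lambda>x. ?c k * cis (of_int k * x))) n)"
    by (simp add: fourier_coeff_def fun_dist_def sum_divide_distrib)
  also have "\<dots> = m n * fourier_coeff f n"
    using assms by (simp add: fourier_coeff_cis)
  finally show ?thesis .
qed


section \<open>The nonlinearity and weak solutions in the extended sense\<close>

definition mean :: "(real \<Rightarrow> real) \<Rightarrow> real" where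
  "mean f = integral {0..2 * pi} f / (2 * pi)"

definition nonlin :: "(real \<Rightarrow> complex) \<Rightarrow> real \<Rightarrow> complex" where
  "nonlin f x = of_real ((cmod (f x))\<^sup>2 - 2 * mean (\<lambda>y. (cmod (f y))\<^sup>2)) * f x"

text \<open>\<open>P\<close> is a single cutoff operator, acting in \<open>x\<close> at each time.\<close>

definition nonlin_cutoff :: "(dist_T \<Rightarrow> real \<Rightarrow> complex) \<Rightarrow> (real \<Rightarrow> dist_T) \<Rightarrow> dist_ST" where
  "nonlin_cutoff P u = st_dist (\<lambda>t. fun_dist (nonlin (P (u t))))"

definition nonlin_exists_eq :: "(real \<Rightarrow> dist_T) \<Rightarrow> dist_ST \<Rightarrow> bool" where
  "nonlin_exists_eq u v \<longleftrightarrow> distribution_ST v \<and>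
     (\<forall>P. fourier_cutoffs P \<longrightarrow> dist_ST_tendsto (\<lambda>N. nonlin_cutoff (P N) u) v)"

definition weak_solution_ext :: "real \<Rightarrow> real \<Rightarrow> dist_T \<Rightarrow> (real \<Rightarrow> dist_T) \<Rightarrow> bool" where
  "weak_solution_ext s \<omega> u0 u \<longleftrightarrow>
     u \<in> C0_sobolev s \<and> (\<forall>\<psi>\<in>test_T. u 0 \<psi> = u0 \<psi>) \<and>
     (\<exists>v. nonlin_exists_eq u v \<and>
        (\<forall>\<phi>\<in>test_ST. \<i> * dist_dt (st_dist u) \<phi> + dist_dx (dist_dx (st_dist u)) \<phi>
                       + of_real \<omega> * v \<phi> = 0))"

end

theory Submission
  imports Defs
begin

text \<open>
  Write $u(t,x) = \sum_n e^{-in^2t} a_n(t) e^{inx}$. In the profile variables $a_n$ the equation reads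
  $$ a_n' = i\omega \sum_{p-q+r=n} \sigma_{pqr}\, a_p \overline{a_q} a_r\, e^{i(n^2-p^2+q^2-r^2)t}, $$
  where subtracting $2\mu(|u|^2)$ removes exactly the interactions with $p=q$ or $q=r$, except for
  the self-interaction $p=q=r$, which keeps the coefficient $-1$.

  Nonuniqueness comes from a cascade towards high frequencies, which the norm of $H^s$ with $s<0$
  hardly sees. Let finitely many modes be given, and let $r(t)$ be the residual of the equation at
  one frequency $n$. Factor $r = g^2h$ with $g$ real and add modes at $M$, $4M$, $3M+n$ with amplitudes
  $g$, $g$ and $h$ times a phase and a constant. Since $M-4M+(3M+n)=n$, the interaction of these three
  modes repairs the equation at $n$. Every other new interaction has an output of size at least
  $M/2$ (lemma \<open>triads_new\<close>); this is where the gauge term is needed, because interactions with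
  $p=q$ would return to low frequencies. The sizes of the new amplitudes do not depend on $M$, so for large
  $M$ all that is new at high frequency is as small in $H^s$ as desired. The new interactions at $n$ are
  not small pointwise, but only their time integral matters, and that is a multiple of
  $\int_0^t r$, which is bounded by quantities of the preceding stage. The phase makes time
  derivatives large, of order $M^2$; this is harmless, because they
  enter only the residuals at high frequency, which are repaired at later stages whose $M$ is
  chosen afterwards (lemma \<open>stage_step\<close>). Treating all integers $n$ one after the other, starting
  from the single mode $e^{-1/t}$ at frequency $0$, solves the equation at every frequency
  (lemma \<open>cascade_exists\<close>). All amplitudes lie in the span of the functions $t^{-j}e^{-c/t}e^{ilt}$,
  which is closed under every operation used and consists of functions vanishing at $t=0$.

  In the limit every frequency $n$ is the output of finitely many interactions, and the suprema of their
  time integrals add up to at most $D_n$, where $\sum_n (1+n^2)^{s/2} D_n < \infty$. A Fourier cutoff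
  with symbol $m$ multiplies the interaction $(p,q,r)$ by $m(p)\overline{m(q)}m(r)$,
  which is bounded and tends to $1$. Therefore the convergence of $\mathbf{N}(\mathcal{P}_Nu)$, both in the
  sense of distributions and, after applying $e^{-it\Delta}$, in $C^{-1}H^s$, is dominated convergence
  for sums over $n$ (lemmas \<open>nonlin_cutoff_tendsto\<close> and \<open>free_evol_Cm1_tendsto\<close>). The limit is
  computed from the equation itself: the primitive of $e^{-it\Delta}\mathbf{N}(u)$ has the Fourier
  coefficients $a_n(t)/(i\omega)$.

  The norm of $C^{-1}H^s$ is defined through some choice of primitive, so its evaluation requires
  that primitives are unique (lemma \<open>primitive_Cm1_unique\<close>). This is the lemma of du Bois-Reymond,
  proved with bump functions that are again built from $e^{-c/t}$.
\<close>

section \<open>Flat amplitudes\<close>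

definition flat_fun :: "real \<Rightarrow> nat \<Rightarrow> real \<Rightarrow> real \<Rightarrow> complex" where
  "flat_fun c j l t = (if t \<le> 0 then 0 else of_real (exp (- c / t) / t ^ j) * cis (l * t))"

text \<open>The amplitude added at one stage contains the time derivative of an amplitude of an earlier
  stage, so the class of amplitudes must be closed under differentiation, besides products and
  multiplication by phases. Vanishing on $t\le 0$ yields the zero initial datum.\<close>

inductive_set flat :: "(real \<Rightarrow> complex) set" where
  base: "c > 0 \<Longrightarrow> (\<lambda>t. z * flat_fun c j l t) \<in> flat"
| add: "f \<in> flat \<Longrightarrow> g \<in> flat \<Longrightarrow> (\<lambda>t. f t + g t) \<in> flat"

lemma flat_fun_nonpos [simp]: "t \<le> 0 \<Longrightarrow> flat_fun c j l t = 0"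
  by (simp add: flat_fun_def)

lemma flat_nonpos: "f \<in> flat \<Longrightarrow> t \<le> 0 \<Longrightarrow> f t = 0"
  by (induction rule: flat.induct) auto

lemma flat_fun_mult:
  "flat_fun c j l t * flat_fun c' j' l' t = flat_fun (c + c') (j + j') (l + l') t"
proof -
  have "exp (- (c + c') / t) = exp (- c / t) * exp (- c' / t)"
    by (simp add: exp_add [symmetric] diff_divide_distrib)
  moreover have "cis ((l + l') * t) = cis (l * t) * cis (l' * t)"
    by (simp add: cis_mult ring_distribs)
  ultimately show ?thesis
    by (simp add: flat_fun_def power_add)
qed

lemma cnj_flat_fun: "cnj (flat_fun c j l t) = flat_fun c j (- l) t"
  by (simp add: flat_fun_def cis_cnj)

lemma cis_flat_fun: "cis (m * t) * flat_fun c j l t = flat_fun c j (m + l) t"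
  by (simp add: flat_fun_def cis_mult ring_distribs)

text \<open>Used for the difference quotient at $t=0$, which is of the same form with $j$ increased by one.\<close>

lemma flat_fun_tendsto_0:
  fixes c :: real
  assumes "c > 0"
  shows "((\<lambda>t. exp (- c / t) / t ^ j) \<longlongrightarrow> 0) (at_right 0)"
proof -
  have "filterlim (\<lambda>t. c * inverse t) at_top (at_right 0)"
    using assms filterlim_inverse_at_top_right
    by (intro filterlim_tendsto_pos_mult_at_top[where f = "\<lambda>_. c" and c = c]) auto
  from filterlim_compose[OF tendsto_power_div_exp_0 this]
  have "((\<lambda>t. (c * inverse t) ^ j / exp (c * inverse t) / c ^ j) \<longlongrightarrow> 0 / c ^ j) (at_right 0)"
    using assms by (intro tendsto_divide tendsto_const) auto
  moreover have "(c * inverse t) ^ j / exp (c * inverse t) / c ^ j = exp (- c / t) / t ^ j" for t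
    using assms by (simp add: exp_minus field_simps)
  ultimately show ?thesis by simp
qed

lemma has_vector_derivative_cis:
  "((\<lambda>t. cis (l * t)) has_vector_derivative \<i> * of_real l * cis (l * t)) (at t within S)"
proof -
  have "((\<lambda>z. exp (\<i> * of_real l * z)) has_field_derivative
            \<i> * of_real l * exp (\<i> * of_real l * of_real t)) (at (of_real t))"
    by (auto intro!: derivative_eq_intros)
  from has_vector_derivative_real_field[OF this, of S] show ?thesis
    by (simp add: cis_conv_exp mult.assoc o_def)
qed

lemma flat_fun_derivative:
  assumes "c > 0"
  shows "(flat_fun c j l has_vector_derivative
     of_real c * flat_fun c (j + 2) l t - of_nat j * flat_fun c (j + 1) l t
       + \<i> * of_real l * flat_fun c j l t) (at t)"
proof -
  consider "t > 0" | "t < 0" | "t = 0" by linarith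
  thus ?thesis
  proof cases
    case 1
    have *: "((\<lambda>t. exp (- c / t) / t ^ j) has_real_derivative
        exp (- c / t) * (c / t ^ 2) / t ^ j - real j * exp (- c / t) / t ^ (j + 1)) (at t)"
    proof (cases j)
      case 0
      thus ?thesis using 1
        by (auto intro!: derivative_eq_intros simp: power2_eq_square)
    next
      case (Suc i)
      have "((\<lambda>t. exp (- c / t) / t ^ Suc i) has_real_derivative
        (exp (- c / t) * (c / t ^ 2) * t ^ Suc i - exp (- c / t) * (real (Suc i) * t ^ i))
          / (t ^ Suc i * t ^ Suc i)) (at t)"
        using 1 DERIV_pow[of "Suc i" t]
        by (intro DERIV_divide) (auto intro!: derivative_eq_intros simp: power2_eq_square)
      moreover have "(exp (- c / t) * (c / t ^ 2) * t ^ Suc i - exp (- c / t) * (real (Suc i) * t ^ i))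
          / (t ^ Suc i * t ^ Suc i)
          = exp (- c / t) * (c / t ^ 2) / t ^ Suc i - real (Suc i) * exp (- c / t) / t ^ (Suc i + 1)"
        using 1 by (simp add: diff_divide_distrib power2_eq_square mult_ac)
      ultimately show ?thesis using Suc by simp
    qed
    have "((\<lambda>t. of_real (exp (- c / t) / t ^ j) * cis (l * t)) has_vector_derivative
       of_real (exp (- c / t) / t ^ j) * (\<i> * of_real l * cis (l * t)) +
       of_real (exp (- c / t) * (c / t ^ 2) / t ^ j - real j * exp (- c / t) / t ^ (j + 1)) * cis (l * t))
       (at t)"
      by (rule has_vector_derivative_mult[OF _ has_vector_derivative_cis])
         (rule has_vector_derivative_of_real, use * in \<open>simp add: has_real_derivative_iff_has_vector_derivative\<close>)
    hence "((\<lambda>t. of_real (exp (- c / t) / t ^ j) * cis (l * t)) has_vector_derivative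
        (of_real c * flat_fun c (j + 2) l t - of_nat j * flat_fun c (j + 1) l t
       + \<i> * of_real l * flat_fun c j l t)) (at t)"
      by (rule has_vector_derivative_eq_rhs)
         (use 1 in \<open>simp add: flat_fun_def field_simps power2_eq_square\<close>)
    thus ?thesis
      by (rule has_vector_derivative_transform_within_open[of _ _ _ "{0<..}"])
         (use 1 in \<open>auto simp: flat_fun_def\<close>)
  next
    case 2
    have "((\<lambda>_. 0) has_vector_derivative (0::complex)) (at t)" by simp
    hence "(flat_fun c j l has_vector_derivative 0) (at t)"
      by (rule has_vector_derivative_transform_within_open[of _ _ _ "{..<0}"])
         (use 2 in \<open>auto simp: flat_fun_def\<close>)
    thus ?thesis using 2 by simp
  next
    case 3
    have r: "((\<lambda>t. flat_fun c j l t / of_real t) \<longlongrightarrow> 0) (at_right 0)"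
    proof (rule tendsto_norm_zero_cancel)
      have "eventually (\<lambda>t. exp (- c / t) / t ^ Suc j = norm (flat_fun c j l t / of_real t)) (at_right 0)"
        using eventually_at_right_less
        by eventually_elim (auto simp: flat_fun_def norm_mult norm_divide norm_power)
      with flat_fun_tendsto_0[OF assms, of "Suc j"]
      show "((\<lambda>t. norm (flat_fun c j l t / of_real t)) \<longlongrightarrow> 0) (at_right 0)"
        using tendsto_cong by fastforce
    qed
    have l: "((\<lambda>t. flat_fun c j l t / of_real t) \<longlongrightarrow> 0) (at_left 0)"
    proof -
      have "eventually (\<lambda>t. flat_fun c j l t / of_real t = 0) (at_left 0)"
        by (auto simp: eventually_at_filter)
      thus ?thesis by (simp add: tendsto_eventually)
    qed
    from l r have "((\<lambda>t. flat_fun c j l t / of_real t) \<longlongrightarrow> 0) (at 0)"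
      by (simp add: filterlim_split_at)
    from tendsto_norm_zero[OF this] have "(flat_fun c j l has_vector_derivative 0) (at 0)"
      by (simp add: has_vector_derivative_def has_derivative_iff_norm norm_divide)
    thus ?thesis using 3 by simp
  qed
qed

lemma flat_has_derivative:
  assumes "f \<in> flat"
  shows "\<exists>f'\<in>flat. \<forall>t. (f has_vector_derivative f' t) (at t)"
  using assms
proof (induction rule: flat.induct)
  case (base c z j l)
  have "(\<lambda>t. (z * of_real c) * flat_fun c (j + 2) l t + (- z * of_nat j) * flat_fun c (j + 1) l t
      + (z * \<i> * of_real l) * flat_fun c j l t) \<in> flat"
    by (intro flat.intros base)
  moreover have "((\<lambda>t. z * flat_fun c j l t) has_vector_derivative
      (z * of_real c) * flat_fun c (j + 2) l t + (- z * of_nat j) * flat_fun c (j + 1) l t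
      + (z * \<i> * of_real l) * flat_fun c j l t) (at t)" for t
    by (rule has_vector_derivative_eq_rhs
          [OF has_vector_derivative_mult_right[OF flat_fun_derivative[OF base]]])
       (simp add: algebra_simps)
  ultimately show ?case by - (erule bexI[rotated], rule allI)
next
  case (add f g)
  then obtain f' g' where fg: "f' \<in> flat" "g' \<in> flat"
    "\<And>t. (f has_vector_derivative f' t) (at t)" "\<And>t. (g has_vector_derivative g' t) (at t)"
    by blast
  show ?case
    using fg by (intro bexI[of _ "\<lambda>t. f' t + g' t"] allI has_vector_derivative_add flat.add)
qed

lemma flat_cmult: "f \<in> flat \<Longrightarrow> (\<lambda>t. z * f t) \<in> flat"
proof (induction rule: flat.induct)
  case (base c w j l)
  thus ?case using flat.base[of c "z * w" j l] by (simp add: mult.assoc)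
qed (auto simp: ring_distribs intro: flat.add)

lemma flat_zero: "(\<lambda>t. 0) \<in> flat"
  using flat.base[of 1 0] by simp

lemma flat_sum: "(\<And>x. x \<in> X \<Longrightarrow> f x \<in> flat) \<Longrightarrow> (\<lambda>t. \<Sum>x\<in>X. f x t) \<in> flat"
  by (induction X rule: infinite_finite_induct) (auto intro: flat.add flat_zero)

lemma flat_mult:
  assumes "f \<in> flat" "g \<in> flat"
  shows "(\<lambda>t. f t * g t) \<in> flat"
  using assms
proof (induction rule: flat.induct)
  case (base c z j l)
  from \<open>g \<in> flat\<close> show ?case
  proof (induction rule: flat.induct)
    case (base c' z' j' l')
    have "z * flat_fun c j l t * (z' * flat_fun c' j' l' t)
        = z * z' * flat_fun (c + c') (j + j') (l + l') t" for t
      by (simp flip: flat_fun_mult)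
    moreover have "(\<lambda>t. z * z' * flat_fun (c + c') (j + j') (l + l') t) \<in> flat"
      using \<open>c > 0\<close> \<open>c' > 0\<close> by (intro flat.base) auto
    ultimately show ?case by (simp only:)
  qed (auto simp: ring_distribs intro: flat.add)
qed (auto simp: ring_distribs intro: flat.add)

lemma flat_cnj: "f \<in> flat \<Longrightarrow> (\<lambda>t. cnj (f t)) \<in> flat"
  by (induction rule: flat.induct) (simp_all add: cnj_flat_fun flat.intros)

lemma flat_cis: "f \<in> flat \<Longrightarrow> (\<lambda>t. cis (m * t) * f t) \<in> flat"
proof (induction rule: flat.induct)
  case (base c z j l)
  have "cis (m * t) * (z * flat_fun c j l t) = z * flat_fun c j (m + l) t" for t
    by (simp add: mult.left_commute flip: cis_flat_fun)
  moreover have "(\<lambda>t. z * flat_fun c j (m + l) t) \<in> flat"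
    using base by (rule flat.base)
  ultimately show ?case by (simp only:)
qed (auto simp: ring_distribs intro: flat.add)

lemma flat_continuous: "f \<in> flat \<Longrightarrow> continuous_on S f"
  using flat_has_derivative
  by (metis UNIV_I continuous_on_subset continuous_on_vector_derivative
      has_vector_derivative_at_within subset_UNIV)

text \<open>A finite linear combination has a smallest exponent $c>0$, and any smaller exponent can be split off.\<close>

lemma flat_divide_by_exp:
  assumes "f \<in> flat"
  shows "\<exists>c0>0. \<forall>c. c < c0 \<longrightarrow> (\<exists>h\<in>flat. \<forall>t. f t = flat_fun c 0 0 t * h t)"
  using assms
proof (induction rule: flat.induct)
  case (base c0 z j l)
  have "\<exists>h\<in>flat. \<forall>t. z * flat_fun c0 j l t = flat_fun c 0 0 t * h t" if "c < c0" for c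
    using that
    by (intro bexI[of _ "\<lambda>t. z * flat_fun (c0 - c) j l t"])
       (auto intro: flat.base simp: mult.left_commute flat_fun_mult)
  thus ?case using base by blast
next
  case (add f g)
  then obtain c1 c2 where c: "c1 > 0" "c2 > 0"
    and f: "\<And>c. c < c1 \<Longrightarrow> \<exists>h\<in>flat. \<forall>t. f t = flat_fun c 0 0 t * h t"
    and g: "\<And>c. c < c2 \<Longrightarrow> \<exists>h\<in>flat. \<forall>t. g t = flat_fun c 0 0 t * h t"
    by blast
  have "\<exists>h\<in>flat. \<forall>t. f t + g t = flat_fun c 0 0 t * h t" if "c < min c1 c2" for c
  proof -
    from that f g obtain h1 h2 where "h1 \<in> flat" "h2 \<in> flat"
      "\<And>t. f t = flat_fun c 0 0 t * h1 t" "\<And>t. g t = flat_fun c 0 0 t * h2 t"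
      by (metis min_less_iff_conj)
    thus ?thesis
      by (intro bexI[of _ "\<lambda>t. h1 t + h2 t"]) (auto intro: flat.add simp: ring_distribs)
  qed
  thus ?case using c by (intro exI[of _ "min c1 c2"]) auto
qed

text \<open>The factors become the amplitudes of three interacting modes. Exponential flatness is essential:
  a zero of finite order at $t=0$ would be used up after finitely many such factorizations,
  whereas a positive exponent can be divided indefinitely.\<close>

lemma flat_factorization:
  assumes "f \<in> flat"
  shows "\<exists>g\<in>flat. \<exists>h\<in>flat. (\<forall>t. cnj (g t) = g t) \<and> (\<forall>t. f t = g t * g t * h t)"
proof -
  from flat_divide_by_exp[OF assms] obtain c0 where "c0 > 0"
    and c0: "\<And>c. c < c0 \<Longrightarrow> \<exists>h\<in>flat. \<forall>t. f t = flat_fun c 0 0 t * h t"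
    by blast
  from c0[of "c0 / 2"] \<open>c0 > 0\<close> obtain h
    where "h \<in> flat" and h: "\<And>t. f t = flat_fun (c0 / 2) 0 0 t * h t" by auto
  show ?thesis
  proof (intro bexI conjI allI)
    show "h \<in> flat" by fact
    show "flat_fun (c0 / 4) 0 0 \<in> flat"
      using flat.base[of "c0 / 4" 1 0 0] \<open>c0 > 0\<close> by simp
  qed (simp_all add: h cnj_flat_fun flat_fun_mult)
qed

section \<open>Interactions of modes\<close>

text \<open>The coefficient of $a_p \overline{a_q} a_r$ in $(|u|^2-2\mu(|u|^2))u$. It equals
  $1-\delta_{pq}-\delta_{qr}$, see \<open>nonlin_trig\<close>.\<close>

definition res_sign :: "int \<Rightarrow> int \<Rightarrow> int \<Rightarrow> complex" where
  "res_sign p q r = (if p = q \<and> q = r then -1 else if p = q \<or> q = r then 0 else 1)"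

text \<open>One interaction in the profile variables. With $n=p-q+r$ the phase is $2(n-p)(n-r)t$.\<close>

definition cubic :: "(int \<Rightarrow> real \<Rightarrow> complex) \<Rightarrow> int \<times> int \<times> int \<Rightarrow> real \<Rightarrow> complex" where
  "cubic a = (\<lambda>(p, q, r) t. res_sign p q r * a p t * cnj (a q t) * a r t
     * cis (of_int ((p - q + r)\<^sup>2 - p\<^sup>2 + q\<^sup>2 - r\<^sup>2) * t))"

definition duhamel :: "(int \<Rightarrow> real \<Rightarrow> complex) \<Rightarrow> int \<times> int \<times> int \<Rightarrow> real \<Rightarrow> complex" where
  "duhamel a \<tau> t = integral {0..t} (cubic a \<tau>)"

definition triads :: "int set \<Rightarrow> int \<Rightarrow> (int \<times> int \<times> int) set" where
  "triads A n = {(p, q, r). p \<in> A \<and> q \<in> A \<and> r \<in> A \<and> res_sign p q r \<noteq> 0 \<and> p - q + r = n}"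

definition supnorm :: "(real \<Rightarrow> complex) \<Rightarrow> real" where
  "supnorm f = (SUP t\<in>{0..1}. cmod (f t))"

text \<open>The norm of $H^s$ is the $\ell^2$ norm with this weight.\<close>

definition weight :: "real \<Rightarrow> int \<Rightarrow> real" where
  "weight s n = (1 + (real_of_int n)\<^sup>2) powr (s / 2)"

lemma finite_triads: "finite A \<Longrightarrow> finite (triads A n)"
  by (rule finite_subset[of _ "A \<times> A \<times> A"]) (auto simp: triads_def)

lemma norm_res_sign_le: "cmod (res_sign p q r) \<le> 1"
  by (simp add: res_sign_def)

lemma supnorm_upper:
  "continuous_on {0..1} f \<Longrightarrow> t \<in> {0..1} \<Longrightarrow> cmod (f t) \<le> supnorm f"
  unfolding supnorm_def
  by (rule cSUP_upper, assumption)
     (intro bounded_imp_bdd_above compact_imp_bounded compact_continuous_image continuous_intros, auto)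

lemma supnorm_least: "(\<And>t. t \<in> {0..1} \<Longrightarrow> cmod (f t) \<le> b) \<Longrightarrow> supnorm f \<le> b"
  unfolding supnorm_def by (intro cSUP_least) auto

lemma supnorm_nonneg: "continuous_on {0..1} f \<Longrightarrow> 0 \<le> supnorm f"
  using supnorm_upper[of f 0] norm_ge_zero[of "f 0"] by (simp del: norm_ge_zero)

lemma supnorm_zero [simp]: "supnorm (\<lambda>_. 0) = 0"
  by (simp add: supnorm_def)

lemma weight_pos: "0 < weight s n"
  using add_pos_nonneg[of 1 "(real_of_int n)\<^sup>2"] by (simp add: weight_def)

lemma cubic_flat:
  assumes "\<And>n. a n \<in> flat"
  shows "cubic a \<tau> \<in> flat"
proof -
  obtain p q r where \<tau>: "\<tau> = (p, q, r)" by (cases \<tau>)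
  have "(\<lambda>t. cis (of_int ((p - q + r)\<^sup>2 - p\<^sup>2 + q\<^sup>2 - r\<^sup>2) * t) *
      (res_sign p q r * ((a p t * cnj (a q t)) * a r t))) \<in> flat"
    by (intro flat_cis flat_cmult flat_mult flat_cnj assms)
  thus ?thesis by (simp add: \<tau> cubic_def mult_ac)
qed

lemma cubic_cong: "a p = b p \<Longrightarrow> a q = b q \<Longrightarrow> a r = b r \<Longrightarrow> cubic a (p, q, r) = cubic b (p, q, r)"
  by (simp add: cubic_def)

lemma duhamel_cong:
  "a p = b p \<Longrightarrow> a q = b q \<Longrightarrow> a r = b r \<Longrightarrow> duhamel a (p, q, r) = duhamel b (p, q, r)"
  using cubic_cong[of a p b q r] unfolding duhamel_def by (intro ext) simp

lemma duhamel_has_derivative: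
  assumes "\<And>n. a n \<in> flat" "t \<in> {0..1}"
  shows "(duhamel a \<tau> has_vector_derivative cubic a \<tau> t) (at t within {0..1})"
  unfolding duhamel_def
  by (rule integral_has_vector_derivative[OF flat_continuous[OF cubic_flat[OF assms(1)]] assms(2)])

lemma duhamel_continuous:
  assumes "\<And>n. a n \<in> flat"
  shows "continuous_on {0..1} (duhamel a \<tau>)"
  by (rule continuous_on_vector_derivative[OF duhamel_has_derivative[OF assms]])

text \<open>The bound ignores the phase, so it does not depend on the positions of the modes.\<close>

lemma norm_cubic_le:
  assumes "\<And>n. a n \<in> flat" "t \<in> {0..1}"
  shows "cmod (cubic a (p, q, r) t) \<le> supnorm (a p) * supnorm (a q) * supnorm (a r)"
proof -
  have *: "cmod (a n t) \<le> supnorm (a n)" for n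
    using assms by (intro supnorm_upper flat_continuous) auto
  have "cmod (cubic a (p, q, r) t)
      = cmod (res_sign p q r) * (cmod (a p t) * cmod (a q t) * cmod (a r t))"
    by (simp add: cubic_def norm_mult)
  also have "\<dots> \<le> 1 * (supnorm (a p) * supnorm (a q) * supnorm (a r))"
    using supnorm_nonneg[OF flat_continuous[OF assms(1)]]
    by (intro mult_mono norm_res_sign_le * mult_nonneg_nonneg) auto
  finally show ?thesis by simp
qed

lemma supnorm_duhamel_le:
  assumes "\<And>n. a n \<in> flat"
  shows "supnorm (duhamel a (p, q, r)) \<le> supnorm (a p) * supnorm (a q) * supnorm (a r)"
proof (rule supnorm_least)
  fix t :: real assume t: "t \<in> {0..1}"
  let ?B = "supnorm (a p) * supnorm (a q) * supnorm (a r)"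
  have B: "0 \<le> ?B"
    using supnorm_nonneg[OF flat_continuous[OF assms]] by (intro mult_nonneg_nonneg) auto
  have "cmod (duhamel a (p, q, r) t) \<le> ?B * (t - 0)"
    unfolding duhamel_def
    by (rule integral_bound[OF _ flat_continuous[OF cubic_flat[OF assms]]])
       (use t in \<open>auto intro: norm_cubic_le[OF assms]\<close>)
  also have "\<dots> \<le> ?B * 1"
    using t B by (intro mult_left_mono) auto
  finally show "cmod (duhamel a (p, q, r) t) \<le> ?B" by simp
qed

text \<open>Up to an error of at most $L$, every mode is $kM$ with $k\in\{0,1,3,4\}$, and $k=0$ for the old ones.
  Hence the output is close to $(k_p-k_q+k_r)M$. The solutions of $k_p+k_r=k_q$ are $0+0=0$ (three
  old modes), the intended $1+3=4$, and $0+k=k$ with $k\neq 0$; in the last case $p=q$ or $q=r$ but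
  not both, and there is no interaction.\<close>

lemma triads_new:
  fixes L M n :: int
  assumes A: "A \<subseteq> {-L..L}" and n: "\<bar>n\<bar> \<le> L" and M: "20 * L < M" "1 \<le> L"
    and t: "(p, q, r) \<in> triads (A \<union> {M, 4 * M, 3 * M + n}) m"
  shows "(p, q, r) \<in> triads A m \<or> M \<le> 2 * \<bar>m\<bar> \<or>
         m = n \<and> (p, q, r) \<in> {(M, 4 * M, 3 * M + n), (3 * M + n, 4 * M, M)}"
proof -
  \<comment> \<open>The multiple of \<open>M\<close> closest to \<open>x\<close> is \<open>k x * M\<close>.\<close>
  define k where "k = (\<lambda>x. if x = M then 1 else if x = 4 * M then 4 else if x = 3 * M + n then 3 else (0::int))"
  have L: "\<bar>x\<bar> \<le> L" if "x \<in> A" for x using subsetD[OF A that] by auto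
  have m: "m = p - q + r" and res: "p \<noteq> q \<and> q \<noteq> r \<or> p = q \<and> q = r"
    using t by (auto simp: triads_def res_sign_def split: if_splits)
  have mem: "x \<in> A \<union> {M, 4 * M, 3 * M + n}" if "x \<in> {p, q, r}" for x
    using t that by (auto simp: triads_def)
  have k: "\<bar>x - k x * M\<bar> \<le> L \<and> (k x = 0 \<and> x \<in> A \<or> k x = 1 \<and> x = M \<or> k x = 4 \<and> x = 4 * M \<or> k x = 3 \<and> x = 3 * M + n)"
    if "x \<in> {p, q, r}" for x
    using mem[OF that] L[of x] M n by (auto simp: k_def)
  show ?thesis
  proof (cases "k p - k q + k r = 0")
    case False
    have "m = (k p - k q + k r) * M + ((p - k p * M) - (q - k q * M) + (r - k r * M))"
      unfolding m by (simp add: algebra_simps)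
    moreover have "M \<le> \<bar>(k p - k q + k r) * M\<bar>"
      using False M mult_right_mono[of 1 "\<bar>k p - k q + k r\<bar>" M] by (simp add: abs_mult)
    moreover have "M \<le> 2 * \<bar>c + (x - y + z)\<bar>"
      if "M \<le> \<bar>c\<bar>" "\<bar>x\<bar> \<le> L" "\<bar>y\<bar> \<le> L" "\<bar>z\<bar> \<le> L" for c x y z
    proof -
      have w: "-(3 * L) \<le> x - y + z" "x - y + z \<le> 3 * L"
        using that by (auto simp: abs_le_iff)
      show ?thesis
      proof (cases "0 \<le> c")
        case True
        hence "M \<le> c" using that(1) by simp
        hence "M \<le> 2 * (c + (x - y + z))" using w M by presburger
        thus ?thesis by presburger
      next
        case False
        hence "M \<le> - c" using that(1) by simp
        hence "M \<le> - (2 * (c + (x - y + z)))" using w M by presburger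
        thus ?thesis by presburger
      qed
    qed
    ultimately have "M \<le> 2 * \<bar>m\<bar>"
      using k[of p] k[of q] k[of r] by auto
    thus ?thesis by blast
  next
    case True
    have "k x \<in> {0, 1, 3, 4}" if "x \<in> {p, q, r}" for x
      using k[OF that] by auto
    from this[of p] this[of q] this[of r] True
    consider "k p = 0" "k q = 0" "k r = 0" | "k p = 1" "k q = 4" "k r = 3"
      | "k p = 3" "k q = 4" "k r = 1" | "k p = k q" "k p \<noteq> 0" "k r = 0" | "k r = k q" "k r \<noteq> 0" "k p = 0"
      by auto
    thus ?thesis
    proof cases
      case 1
      hence "p \<in> A" "q \<in> A" "r \<in> A" using k[of p] k[of q] k[of r] by auto
      thus ?thesis using t by (auto simp: triads_def)
    next
      case 4
      hence "p = q" using k[of p] k[of q] by auto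
      with res have "k r = k q" by simp
      with 4 show ?thesis by simp
    next
      case 5
      hence "r = q" using k[of r] k[of q] by auto
      with res have "k p = k q" by simp
      with 5 show ?thesis by simp
    next
      case 2
      have "p = M" "q = 4 * M" "r = 3 * M + n" using 2 k[of p] k[of q] k[of r] by auto
      moreover have "m = n" unfolding m calculation by simp
      ultimately show ?thesis by blast
    next
      case 3
      have "p = 3 * M + n" "q = 4 * M" "r = M" using 3 k[of p] k[of q] k[of r] by auto
      moreover have "m = n" unfolding m calculation by simp
      ultimately show ?thesis by blast
    qed
  qed
qed

lemma triads_extend:
  fixes L M n :: int
  assumes A: "A \<subseteq> {-L..L}" and n: "\<bar>n\<bar> \<le> L" and M: "20 * L < M" "1 \<le> L"
  defines "A' \<equiv> A \<union> {M, 4 * M, 3 * M + n}"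
  shows triads_extend_other: "\<bar>m\<bar> \<le> L \<Longrightarrow> m \<noteq> n \<Longrightarrow> triads A' m = triads A m"
    and triads_extend_target:
      "triads A' n = triads A n \<union> {(M, 4 * M, 3 * M + n), (3 * M + n, 4 * M, M)}"
    and triads_extend_high: "L < \<bar>m\<bar> \<Longrightarrow> triads A m = {} \<Longrightarrow> triads A' m \<noteq> {} \<Longrightarrow> M \<le> 2 * \<bar>m\<bar>"
    and triads_extend_bound: "triads A' m \<noteq> {} \<Longrightarrow> \<bar>m\<bar> \<le> 20 * M"
proof -
  note new = triads_new[OF A n M, folded A'_def]
  have mono: "triads A m \<subseteq> triads A' m" for m
    by (auto simp: triads_def A'_def)
  show "triads A' m = triads A m" if "\<bar>m\<bar> \<le> L" "m \<noteq> n"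
    using new[of _ _ _ m] mono[of m] that M by force
  have "(M, 4 * M, 3 * M + n) \<in> triads A' n" "(3 * M + n, 4 * M, M) \<in> triads A' n"
    using M n by (auto simp: triads_def A'_def res_sign_def)
  thus "triads A' n = triads A n \<union> {(M, 4 * M, 3 * M + n), (3 * M + n, 4 * M, M)}"
    using new[of _ _ _ n] mono[of n] n M by fastforce
  show "M \<le> 2 * \<bar>m\<bar>" if "L < \<bar>m\<bar>" "triads A m = {}" "triads A' m \<noteq> {}"
    using new[of _ _ _ m] that n by fastforce
  show "\<bar>m\<bar> \<le> 20 * M" if "triads A' m \<noteq> {}"
  proof -
    have "\<bar>x\<bar> \<le> 4 * M" if "x \<in> A'" for x
      using that subsetD[OF A, of x] M n by (auto simp: A'_def)
    moreover from that obtain p q r where "p \<in> A'" "q \<in> A'" "r \<in> A'" "m = p - q + r"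
      by (auto simp: triads_def)
    ultimately have "\<bar>p\<bar> \<le> 4 * M" "\<bar>q\<bar> \<le> 4 * M" "\<bar>r\<bar> \<le> 4 * M" by auto
    thus ?thesis using \<open>m = p - q + r\<close> by linarith
  qed
qed

section \<open>One step of the cascade\<close>

text \<open>The active modes, their amplitudes, the bounds on amplitudes and interactions, and a radius.\<close>

type_synonym stage = "int set \<times> (int \<Rightarrow> real \<Rightarrow> complex) \<times> (int \<Rightarrow> real) \<times> int"

text \<open>The radius $L$ contains all active modes and all outputs of their interactions. The bound on the
  interactions with output $n$ deteriorates by a constant factor when $n$ is treated, which
  happens only at the stage $k$ with \<open>int_decode k = n\<close>.\<close>

definition valid_stage :: "real \<Rightarrow> nat \<Rightarrow> stage \<Rightarrow> bool" where
  "valid_stage \<omega> k = (\<lambda>(A, a, D, L).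
     A \<subseteq> {-L..L} \<and> int k \<le> L \<and> 1 \<le> L \<and>
     (\<forall>n. a n \<in> flat) \<and> (\<forall>n. n \<notin> A \<longrightarrow> a n = (\<lambda>_. 0)) \<and>
     (\<forall>n. L < \<bar>n\<bar> \<longrightarrow> triads A n = {}) \<and>
     (\<forall>n. 0 \<le> D n \<and> supnorm (a n) \<le> D n \<and>
        (\<Sum>\<tau>\<in>triads A n. supnorm (duhamel a \<tau>))
          \<le> (if n \<in> int_decode ` {..<k} then 2 + 1 / \<bar>\<omega>\<bar> else 1) * D n))"

text \<open>Below the radius $L$ nothing changes but the interactions with output \<open>int_decode k\<close>, and these
  now satisfy the equation. What is new beyond $L$ is small in the weighted norm.\<close>

definition next_stage :: "real \<Rightarrow> real \<Rightarrow> nat \<Rightarrow> stage \<Rightarrow> stage \<Rightarrow> bool" where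
  "next_stage s \<omega> k = (\<lambda>(A, a, D, L) (A', a', D', L').
     L < L' \<and> A' \<inter> {-L..L} = A \<and> (\<forall>n. \<bar>n\<bar> \<le> L \<longrightarrow> a' n = a n \<and> D' n = D n) \<and>
     (\<forall>n. \<bar>n\<bar> \<le> L \<longrightarrow> n \<noteq> int_decode k \<longrightarrow> triads A' n = triads A n) \<and>
     (\<forall>t. (a' (int_decode k) has_vector_derivative
        \<i> * of_real \<omega> * (\<Sum>\<tau>\<in>triads A' (int_decode k). cubic a' \<tau> t)) (at t)) \<and>
     (\<Sum>n\<in>{-L'..L'} - {-L..L}. weight s n * D' n) \<le> (1 / 2) ^ k)"

lemma abs_int_decode_le: "\<bar>int_decode k\<bar> \<le> int k"
  by (auto simp: int_decode_def sum_decode_def elim!: oddE)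

lemma weight_antimono:
  assumes "s < 0" "\<bar>m\<bar> \<le> \<bar>n\<bar>"
  shows "weight s n \<le> weight s m"
proof -
  have "(real_of_int m)\<^sup>2 \<le> (real_of_int n)\<^sup>2"
    using assms by (simp add: abs_le_square_iff[symmetric])
  thus ?thesis
    unfolding weight_def using assms by (intro powr_mono2') (auto intro: add_pos_nonneg)
qed

lemma weight_tendsto_0:
  assumes "s < 0"
  shows "(\<lambda>k. weight s (int k)) \<longlonglongrightarrow> 0"
proof -
  have "filterlim (\<lambda>k. 1 + (real k)\<^sup>2) at_top sequentially"
    by (intro filterlim_tendsto_add_at_top[OF tendsto_const] filterlim_pow_at_top filterlim_real_sequentially) auto
  hence "(\<lambda>k. (1 + (real k)\<^sup>2) powr (s / 2)) \<longlonglongrightarrow> 0"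
    using assms by (intro tendsto_neg_powr) auto
  thus ?thesis by (simp add: weight_def)
qed

lemma exists_small_weight:
  assumes "s < 0" "0 < e"
  obtains M :: int where "M \<ge> K" "\<And>n. M \<le> 2 * \<bar>n\<bar> \<Longrightarrow> weight s n * X \<le> e"
proof -
  have "(\<lambda>k. weight s (int k) * \<bar>X\<bar>) \<longlonglongrightarrow> 0 * \<bar>X\<bar>"
    by (intro tendsto_intros weight_tendsto_0 assms)
  hence "eventually (\<lambda>k. weight s (int k) * \<bar>X\<bar> < e) sequentially"
    using assms by (intro order_tendstoD) auto
  then obtain k where k: "weight s (int k) * \<bar>X\<bar> < e"
    by (auto simp: eventually_sequentially)
  show thesis
  proof (rule that)
    show "max K (2 * int k) \<ge> K" by simp
    fix n :: int assume "max K (2 * int k) \<le> 2 * \<bar>n\<bar>"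
    hence "weight s n \<le> weight s (int k)"
      using assms by (intro weight_antimono) auto
    hence "weight s n * \<bar>X\<bar> \<le> weight s (int k) * \<bar>X\<bar>"
      by (intro mult_right_mono) auto
    moreover have "weight s n * X \<le> weight s n * \<bar>X\<bar>"
      using weight_pos[of s n] by (intro mult_left_mono) auto
    ultimately show "weight s n * X \<le> e" using k by linarith
  qed
qed

text \<open>Interactions with different outputs are different triples, so the number of outputs does not
  enter. This allows bounds that are independent of where the new modes are placed.\<close>

lemma sum_triads_le:
  fixes f :: "int \<Rightarrow> real"
  assumes "finite A" "finite B" "\<And>n. 0 \<le> f n"
  shows "(\<Sum>n\<in>B. \<Sum>(p, q, r)\<in>triads A n. f p * f q * f r) \<le> (\<Sum>n\<in>A. f n) ^ 3"
proof -
  let ?h = "\<lambda>(p, q, r). f p * f q * f r"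
  let ?S = "{(p, q, r) \<in> A \<times> A \<times> A. res_sign p q r \<noteq> 0 \<and> p - q + r \<in> B}"
  have fin: "finite (A \<times> A \<times> A)" using assms by auto
  have "(\<Sum>n\<in>B. \<Sum>(p, q, r)\<in>triads A n. f p * f q * f r)
      = (\<Sum>n\<in>B. sum ?h {x \<in> ?S. (\<lambda>(p, q, r). p - q + r) x = n})"
    by (intro sum.cong) (auto simp: triads_def)
  also have "\<dots> = sum ?h ?S"
    by (rule sum.group) (auto intro: finite_subset[OF _ fin] assms)
  also have "\<dots> \<le> sum ?h (A \<times> A \<times> A)"
    by (rule sum_mono2[OF fin]) (auto intro!: mult_nonneg_nonneg assms)
  also have "\<dots> = (\<Sum>p\<in>A. \<Sum>q\<in>A. \<Sum>r\<in>A. f p * f q * f r)"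
    by (simp add: sum.cartesian_product)
  also have "\<dots> = (\<Sum>n\<in>A. f n) ^ 3"
    by (simp add: power3_eq_cube mult.assoc sum_distrib_left[symmetric] sum_distrib_right[symmetric])
  finally show ?thesis .
qed

text \<open>The three new modes have amplitudes $g$, $g$ and $b$. Their interaction occurs in two orders, whence
  the factor $2$ in $b$. The frequency $M$ is chosen last, when the sizes of all amplitudes
  are known.\<close>

lemma stage_step:
  assumes s: "s < 0" and \<omega>: "\<omega> \<noteq> 0" and "valid_stage \<omega> k S"
  shows "\<exists>S'. valid_stage \<omega> (Suc k) S' \<and> next_stage s \<omega> k S S'"
proof -
  obtain A a D L where S: "S = (A, a, D, L)" by (cases S) auto
  define n where "n = int_decode k"
  define C where "C = (\<lambda>k m. if m \<in> int_decode ` {..<k} then 2 + 1 / \<bar>\<omega>\<bar> else (1::real))"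
  from assms(3) have A: "A \<subseteq> {-L..L}" and L: "int k \<le> L" "1 \<le> L"
    and flat: "\<And>n. a n \<in> flat" and zero: "\<And>n. n \<notin> A \<Longrightarrow> a n = (\<lambda>_. 0)"
    and out: "\<And>n. L < \<bar>n\<bar> \<Longrightarrow> triads A n = {}"
    and D0: "\<And>n. 0 \<le> D n" and Da: "\<And>n. supnorm (a n) \<le> D n"
    and DJ: "\<And>n. (\<Sum>\<tau>\<in>triads A n. supnorm (duhamel a \<tau>)) \<le> C k n * D n"
    unfolding S valid_stage_def C_def by auto
  have n: "\<bar>n\<bar> \<le> L" using abs_int_decode_le[of k] L unfolding n_def by linarith
  have finA: "finite A" by (rule finite_subset[OF A]) simp
  note cont = flat_continuous
  obtain an' where an': "an' \<in> flat" "\<And>t. (a n has_vector_derivative an' t) (at t)"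
    using flat_has_derivative[OF flat[of n]] by blast
  \<comment> \<open>The residual of the equation at the frequency to be treated.\<close>
  define r where "r = (\<lambda>t. an' t + (- \<i> * of_real \<omega>) * (\<Sum>\<tau>\<in>triads A n. cubic a \<tau> t))"
  have "r \<in> flat"
    unfolding r_def by (intro flat.add an' flat_cmult flat_sum cubic_flat flat)
  from flat_factorization[OF this] obtain g h
    where gh: "g \<in> flat" "h \<in> flat" "\<And>t. cnj (g t) = g t" "\<And>t. r t = g t * g t * h t"
    by blast
  \<comment> \<open>The sum of the sizes of all modes, old and new; it does not involve \<open>M\<close>.\<close>
  define X where "X = (\<Sum>m\<in>A. supnorm (a m)) + 2 * supnorm g + supnorm h / (2 * \<bar>\<omega>\<bar>)"
  obtain M where M: "M \<ge> 20 * L + 1" and small: "\<And>m. M \<le> 2 * \<bar>m\<bar> \<Longrightarrow> weight s m * (X + X ^ 3) \<le> (1 / 2) ^ k"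
    by (rule exists_small_weight[OF s, of "(1 / 2) ^ k" "20 * L + 1" "X + X ^ 3"]) auto
  define l where "l = 3 * M + n"
  define \<sigma> where "\<sigma> = n\<^sup>2 - M\<^sup>2 + (4 * M)\<^sup>2 - l\<^sup>2"
  define b where "b = (\<lambda>t. (1 / (2 * \<i> * of_real \<omega>)) * (cis (- of_int \<sigma> * t) * h t))"
  define A' where "A' = A \<union> {M, 4 * M, 3 * M + n}"
  define a' where "a' = a(M := g, 4 * M := g, l := b)"
  define cubes where "cubes = (\<lambda>m. \<Sum>(p, q, r)\<in>triads A' m. supnorm (a' p) * supnorm (a' q) * supnorm (a' r))"
  define D' where "D' = (\<lambda>m. if \<bar>m\<bar> \<le> L then D m else supnorm (a' m) +
      cubes m)"
  have M': "20 * L < M" using M by simp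
  have new: "M \<notin> A" "4 * M \<notin> A" "l \<notin> A" "M \<noteq> 4 * M" "M \<noteq> l" "4 * M \<noteq> l"
      "L < M" "L < 4 * M" "L < l" "M > 0"
    using n L M' subsetD[OF A, of M] subsetD[OF A, of "4 * M"] subsetD[OF A, of l]
    by (auto simp: l_def)
  have a'_old: "a' m = a m" if "\<bar>m\<bar> \<le> L" for m
    using that new by (auto simp: a'_def)
  have a'_new: "a' M = g" "a' (4 * M) = g" "a' l = b"
    using new by (auto simp: a'_def)
  have bflat: "b \<in> flat" unfolding b_def by (intro flat_cmult flat_cis gh)
  have flat': "a' m \<in> flat" for m
    using flat gh bflat by (auto simp: a'_def)
  have finA': "finite A'" using finA by (simp add: A'_def)
  have A'_eq: "A' = A \<union> {M, 4 * M, l}" by (simp add: A'_def l_def)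
  have zero': "a' m = (\<lambda>_. 0)" if "m \<notin> A'" for m
    using that zero by (auto simp: A'_eq a'_def)
  note te = triads_extend_other[OF A n M' L(2), folded A'_def]
    triads_extend_target[OF A n M' L(2), folded A'_def l_def]
    triads_extend_high[OF A n M' L(2), folded A'_def]
    triads_extend_bound[OF A n M' L(2), folded A'_def]
  have cubic_old: "cubic a' \<tau> = cubic a \<tau>" "duhamel a' \<tau> = duhamel a \<tau>" if "\<tau> \<in> triads A m" for \<tau> m
  proof -
    obtain x y z where \<tau>: "\<tau> = (x, y, z)" by (cases \<tau>)
    have "x \<in> A" "y \<in> A" "z \<in> A" using that by (auto simp: triads_def \<tau>)
    hence "\<bar>x\<bar> \<le> L" "\<bar>y\<bar> \<le> L" "\<bar>z\<bar> \<le> L"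
      using subsetD[OF A, of x] subsetD[OF A, of y] subsetD[OF A, of z] by auto
    hence "a' x = a x" "a' y = a y" "a' z = a z" by (auto intro: a'_old)
    thus "cubic a' \<tau> = cubic a \<tau>" "duhamel a' \<tau> = duhamel a \<tau>"
      unfolding \<tau> by (rule cubic_cong, rule duhamel_cong)
  qed
  let ?T1 = "(M, 4 * M, l)" and ?T2 = "(l, 4 * M, M)"
  have T12: "?T1 \<noteq> ?T2" "?T1 \<notin> triads A n" "?T2 \<notin> triads A n"
    using new by (auto simp: triads_def)
  have cancel: "cubic a' ?T1 t = r t / (2 * \<i> * of_real \<omega>)" "cubic a' ?T2 t = r t / (2 * \<i> * of_real \<omega>)" for t
  proof -
    have "of_int ((M - 4 * M + l)\<^sup>2 - M\<^sup>2 + (4 * M)\<^sup>2 - l\<^sup>2) = (of_int \<sigma> :: real)"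
      by (simp add: \<sigma>_def l_def)
    moreover have "of_int ((l - 4 * M + M)\<^sup>2 - l\<^sup>2 + (4 * M)\<^sup>2 - M\<^sup>2) = (of_int \<sigma> :: real)"
      by (simp add: \<sigma>_def l_def)
    moreover have "cis (of_int \<sigma> * t) * cis (- of_int \<sigma> * t) = 1"
      by (simp add: cis_mult)
    ultimately show "cubic a' ?T1 t = r t / (2 * \<i> * of_real \<omega>)" "cubic a' ?T2 t = r t / (2 * \<i> * of_real \<omega>)"
      using new unfolding cubic_def prod.case
      by (simp_all only: a'_new) (simp_all add: res_sign_def b_def gh mult_ac)
  qed
  have sum_target: "(\<Sum>\<tau>\<in>triads A' n. f \<tau>) = (\<Sum>\<tau>\<in>triads A n. f \<tau>) + f ?T1 + f ?T2"
    for f :: "_ \<Rightarrow> 'b::comm_monoid_add"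
    unfolding te(2) using T12 finite_triads[OF finA, of n]
    by (simp add: add_ac)
  have eq: "\<i> * of_real \<omega> * (\<Sum>\<tau>\<in>triads A' n. cubic a' \<tau> t) = an' t" for t
  proof -
    have "(\<Sum>\<tau>\<in>triads A' n. cubic a' \<tau> t) = (\<Sum>\<tau>\<in>triads A n. cubic a \<tau> t) + r t / (\<i> * of_real \<omega>)"
      unfolding sum_target cancel using \<omega> by (simp add: cubic_old cong: sum.cong)
    thus ?thesis using \<omega> by (simp add: r_def field_simps)
  qed
  \<comment> \<open>The time integral of the residual is bounded by data of the preceding stage.\<close>
  have cancelJ: "supnorm (duhamel a' \<tau>) \<le> D n * (1 + \<bar>\<omega>\<bar>) / (2 * \<bar>\<omega>\<bar>)" if "\<tau> \<in> {?T1, ?T2}" for \<tau>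
  proof (rule supnorm_least)
    fix t :: real assume t: "t \<in> {0..1}"
    have "cubic a' \<tau> = (\<lambda>t. r t / (2 * \<i> * of_real \<omega>))"
      using cancel that by auto
    hence "duhamel a' \<tau> t = integral {0..t} (\<lambda>t. r t / (2 * \<i> * of_real \<omega>))"
      by (simp add: duhamel_def)
    also have "\<dots> = integral {0..t} r / (2 * \<i> * of_real \<omega>)"
      by simp
    also have "integral {0..t} r = a n t - \<i> * of_real \<omega> * (\<Sum>\<tau>\<in>triads A n. duhamel a \<tau> t)"
    proof (rule integral_unique)
      have "(an' has_integral a n t - a n 0) {0..t}"
        using t an'(2) by (intro fundamental_theorem_of_calculus) (auto intro: has_vector_derivative_at_within)
      moreover have "((\<lambda>t. \<Sum>\<tau>\<in>triads A n. cubic a \<tau> t) has_integral (\<Sum>\<tau>\<in>triads A n. duhamel a \<tau> t)) {0..t}"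
        unfolding duhamel_def
        by (intro has_integral_sum finite_triads finA integrable_integral integrable_continuous_real
             cont cubic_flat flat)
      ultimately have "(r has_integral (a n t - a n 0)
          + (- \<i> * of_real \<omega>) * (\<Sum>\<tau>\<in>triads A n. duhamel a \<tau> t)) {0..t}"
        unfolding r_def by (intro has_integral_add has_integral_mult_right)
      thus "(r has_integral a n t - \<i> * of_real \<omega> * (\<Sum>\<tau>\<in>triads A n. duhamel a \<tau> t)) {0..t}"
        using flat_nonpos[OF flat, of 0 n] by simp
    qed
    finally have 1: "duhamel a' \<tau> t =
        (a n t - \<i> * of_real \<omega> * (\<Sum>\<tau>\<in>triads A n. duhamel a \<tau> t)) / (2 * \<i> * of_real \<omega>)" .
    have 2: "cmod (a n t - \<i> * of_real \<omega> * (\<Sum>\<tau>\<in>triads A n. duhamel a \<tau> t)) \<le> D n * (1 + \<bar>\<omega>\<bar>)"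
    proof -
      have "cmod (a n t) \<le> D n"
        using supnorm_upper[OF cont[OF flat] t] Da order_trans by blast
      moreover have "cmod (\<Sum>\<tau>\<in>triads A n. duhamel a \<tau> t) \<le> (\<Sum>\<tau>\<in>triads A n. supnorm (duhamel a \<tau>))"
        by (intro sum_norm_le supnorm_upper duhamel_continuous flat t)
      moreover have "C k n = 1"
        unfolding C_def n_def using inj_int_decode by (auto simp: inj_on_def)
      ultimately show ?thesis
        using DJ[of n] norm_triangle_ineq4[of "a n t" "\<i> * of_real \<omega> * (\<Sum>\<tau>\<in>triads A n. duhamel a \<tau> t)"]
          mult_left_mono[of "cmod (\<Sum>\<tau>\<in>triads A n. duhamel a \<tau> t)" "D n" "\<bar>\<omega>\<bar>"]
        by (simp add: norm_mult algebra_simps)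
    qed
    show "cmod (duhamel a' \<tau> t) \<le> D n * (1 + \<bar>\<omega>\<bar>) / (2 * \<bar>\<omega>\<bar>)"
      unfolding 1 norm_divide using divide_right_mono[OF 2, of "2 * \<bar>\<omega>\<bar>"] by (simp add: norm_mult)
  qed
  have old_mem: "\<bar>x\<bar> \<le> L" if "x \<in> A" for x using subsetD[OF A that] by auto
  have z: "supnorm (a' m) = 0" if "m \<notin> A'" for m
    using zero'[OF that] by simp
  have sn: "0 \<le> supnorm (a' m)" for m
    by (intro supnorm_nonneg cont flat')
  have prod0: "0 \<le> cubes m" for m
    unfolding cubes_def using sn by (intro sum_nonneg) (auto intro!: mult_nonneg_nonneg)
  have C_Suc: "C (Suc k) m = (if m = n then 2 + 1 / \<bar>\<omega>\<bar> else C k m)" for m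
    by (auto simp: C_def n_def lessThan_Suc)
  have C1: "1 \<le> C j m" for j m by (simp add: C_def)
  have D'0: "0 \<le> D' m" for m
    using D0 sn prod0 by (auto simp: D'_def intro!: add_nonneg_nonneg)
  have DJ': "(\<Sum>\<tau>\<in>triads A' m. supnorm (duhamel a' \<tau>)) \<le> C (Suc k) m * D' m" for m
  proof -
    consider "m = n" | "m \<noteq> n" "\<bar>m\<bar> \<le> L" | "L < \<bar>m\<bar>" by linarith
    thus ?thesis
    proof cases
      case 1
      have "(\<Sum>\<tau>\<in>triads A' n. supnorm (duhamel a' \<tau>))
          = (\<Sum>\<tau>\<in>triads A n. supnorm (duhamel a \<tau>)) + supnorm (duhamel a' ?T1) + supnorm (duhamel a' ?T2)"
        unfolding sum_target by (simp add: cubic_old cong: sum.cong)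
      moreover have "C k n = 1"
        unfolding C_def n_def using inj_int_decode by (auto simp: inj_on_def)
      moreover have "D n + D n * (1 + \<bar>\<omega>\<bar>) / (2 * \<bar>\<omega>\<bar>) + D n * (1 + \<bar>\<omega>\<bar>) / (2 * \<bar>\<omega>\<bar>) = (2 + 1 / \<bar>\<omega>\<bar>) * D n"
        using \<omega> by (simp add: field_simps)
      ultimately show ?thesis
        using DJ[of n] cancelJ[of ?T1] cancelJ[of ?T2] n 1 by (simp add: C_Suc D'_def)
    next
      case 2
      thus ?thesis
        using DJ[of m] te(1)[of m] by (simp add: C_Suc D'_def cubic_old cong: sum.cong)
    next
      case 3
      have "(\<Sum>\<tau>\<in>triads A' m. supnorm (duhamel a' \<tau>))
          \<le> cubes m"
        unfolding cubes_def by (intro sum_mono) (auto intro: supnorm_duhamel_le flat')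
      also have "\<dots> \<le> D' m" using 3 sn by (simp add: D'_def)
      also have "\<dots> \<le> C (Suc k) m * D' m"
        using C1 mult_right_mono[OF _ D'0] by (metis mult_1)
      finally show ?thesis .
    qed
  qed
  have A'L: "A' \<subseteq> {-(20 * M)..20 * M}"
    using old_mem n M' L unfolding A'_def by force
  have valid: "valid_stage \<omega> (Suc k) (A', a', D', 20 * M)"
    unfolding valid_stage_def prod.case
  proof (intro conjI allI impI)
    show "int (Suc k) \<le> 20 * M" "1 \<le> 20 * M" using L M' by auto
    show "triads A' m = {}" if "20 * M < \<bar>m\<bar>" for m
      using te(4)[of m] that by force
    show "supnorm (a' m) \<le> D' m" for m
      using Da[of m] prod0[of m] by (auto simp: D'_def a'_old)
    show "(\<Sum>\<tau>\<in>triads A' m. supnorm (duhamel a' \<tau>))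
        \<le> (if m \<in> int_decode ` {..<Suc k} then 2 + 1 / \<bar>\<omega>\<bar> else 1) * D' m" for m
      using DJ'[of m] by (simp only: C_def)
  qed (use A'L flat' zero' D'0 in auto)
  let ?B = "{-(20 * M)..20 * M} - {-L..L}"
  \<comment> \<open>The new modes and the new outputs beyond \<open>L\<close> are at least this large in absolute value.\<close>
  define m0 where "m0 = (M + 1) div 2"
  have m0: "M \<le> 2 * m0" "M \<le> 2 * \<bar>m\<bar> \<Longrightarrow> m0 \<le> \<bar>m\<bar>" "0 \<le> m0" for m
    using new unfolding m0_def by auto
  have X: "(\<Sum>m\<in>A'. supnorm (a' m)) \<le> X"
  proof -
    have "supnorm b \<le> supnorm h / (2 * \<bar>\<omega>\<bar>)"
    proof (rule supnorm_least)
      fix t :: real assume "t \<in> {0..1}"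
      from supnorm_upper[OF cont[OF gh(2)] this] show "cmod (b t) \<le> supnorm h / (2 * \<bar>\<omega>\<bar>)"
        by (simp add: b_def norm_mult norm_divide divide_right_mono)
    qed
    moreover have "(\<Sum>m\<in>A. supnorm (a' m)) = (\<Sum>m\<in>A. supnorm (a m))"
      using old_mem by (intro sum.cong) (auto simp: a'_old)
    ultimately show ?thesis
      using new finA by (simp add: A'_eq X_def a'_new)
  qed
  have X0: "0 \<le> (\<Sum>m\<in>A'. supnorm (a' m))" by (intro sum_nonneg sn)
  have "(\<Sum>m\<in>?B. weight s m * D' m) \<le> (\<Sum>m\<in>?B. weight s m0 * D' m)"
  proof (rule sum_mono)
    fix m assume "m \<in> ?B"
    hence m: "L < \<bar>m\<bar>" by auto
    show "weight s m * D' m \<le> weight s m0 * D' m"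
    proof (cases "M \<le> 2 * \<bar>m\<bar>")
      case True
      thus ?thesis using m0(1,3) m0(2)[of m] s by (intro mult_right_mono D'0 weight_antimono) auto
    next
      case False
      hence "triads A' m = {}" using te(3)[OF m out[OF m]] by blast
      moreover have "m \<notin> A'"
        using False m old_mem[of m] n M' L by (auto simp: A'_def)
      ultimately have "D' m = 0" using m by (simp add: D'_def cubes_def zero')
      thus ?thesis by simp
    qed
  qed
  also have "\<dots> = weight s m0 * ((\<Sum>m\<in>?B. supnorm (a' m)) +
      (\<Sum>m\<in>?B. cubes m))"
    unfolding sum.distrib[symmetric] sum_distrib_left[symmetric]
    by (intro arg_cong2[of _ _ _ _ "(*)"] refl sum.cong) (auto simp: D'_def)
  also have "\<dots> \<le> weight s m0 * (X + X ^ 3)"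
  proof (intro mult_left_mono add_mono)
    have "(\<Sum>m\<in>?B. supnorm (a' m)) = (\<Sum>m\<in>?B \<inter> A'. supnorm (a' m))"
      by (rule sum.mono_neutral_right) (simp, blast, use z in blast)
    also have "\<dots> \<le> (\<Sum>m\<in>A'. supnorm (a' m))"
      by (intro sum_mono2 finA') (auto simp: sn)
    finally show "(\<Sum>m\<in>?B. supnorm (a' m)) \<le> X" using X by linarith
    have "(\<Sum>m\<in>?B. cubes m)
        \<le> (\<Sum>m\<in>A'. supnorm (a' m)) ^ 3"
      unfolding cubes_def by (rule sum_triads_le[OF finA']) (auto simp: sn)
    also have "\<dots> \<le> X ^ 3" using X X0 by (intro power_mono)
    finally show "(\<Sum>m\<in>?B. cubes m) \<le> X ^ 3" .
  qed (use weight_pos[of s m0] in simp)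
  also have "\<dots> \<le> (1 / 2) ^ k" using m0 by (intro small) auto
  finally have weights: "(\<Sum>m\<in>?B. weight s m * D' m) \<le> (1 / 2) ^ k" .
  have "next_stage s \<omega> k (A, a, D, L) (A', a', D', 20 * M)"
    unfolding next_stage_def prod.case n_def[symmetric]
  proof (intro conjI allI impI)
    show "L < 20 * M" using M' L by simp
    show "A' \<inter> {-L..L} = A"
      using new A by (auto simp: A'_eq)
    show "(a' n has_vector_derivative \<i> * of_real \<omega> * (\<Sum>\<tau>\<in>triads A' n. cubic a' \<tau> t)) (at t)" for t
      unfolding eq a'_old[OF n] by (rule an'(2))
  qed (use a'_old te(1) weights in \<open>auto simp: D'_def\<close>)
  with valid show ?thesis unfolding S by blast
qed

section \<open>The infinite cascade\<close>

definition initial_stage :: stage where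
  "initial_stage = (let a = (\<lambda>n. if n = 0 then flat_fun 1 0 0 else (\<lambda>_. 0)) in
     ({0}, a, \<lambda>n. if n = 0 then supnorm (a 0) + (\<Sum>\<tau>\<in>triads {0} 0. supnorm (duhamel a \<tau>)) else 0, 1))"

lemma initial_stage_valid: "valid_stage \<omega> 0 initial_stage"
proof -
  define a :: "int \<Rightarrow> real \<Rightarrow> complex" where "a = (\<lambda>n. if n = 0 then flat_fun 1 0 0 else (\<lambda>_. 0))"
  have flat: "a n \<in> flat" for n
    using flat.base[of 1 1 0 0] flat_zero by (auto simp: a_def)
  have 0: "0 \<le> supnorm (a n)" for n
    by (intro supnorm_nonneg flat_continuous flat)
  have J: "0 \<le> (\<Sum>\<tau>\<in>triads {0} n. supnorm (duhamel a \<tau>))" for n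
    by (intro sum_nonneg supnorm_nonneg duhamel_continuous flat)
  have t: "triads {0} n = {}" if "n \<noteq> 0" for n
    using that by (auto simp: triads_def)
  have z: "supnorm (a n) = 0" if "n \<noteq> 0" for n
    using that by (simp add: a_def)
  have an: "a n = (\<lambda>_. 0)" if "n \<noteq> 0" for n
    using that by (simp add: a_def)
  have "valid_stage \<omega> 0 ({0}, a, \<lambda>n. if n = 0 then supnorm (a 0) + (\<Sum>\<tau>\<in>triads {0} 0. supnorm (duhamel a \<tau>)) else 0, 1)"
    unfolding valid_stage_def prod.case
    using flat 0[of 0] J[of 0] t z an by auto
  thus ?thesis by (simp only: initial_stage_def Let_def a_def)
qed

text \<open>An exact solution in the profile variables for which nothing is left to convergence at a
  fixed frequency: every sum over interactions is finite. The sequence $D$ dominates the sum of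
  the absolute values of the time integrals of the interactions, so the bounds survive multiplication of the interactions by bounded
  factors, which is what a Fourier cutoff does.\<close>

locale cascade =
  fixes s \<omega> :: real and A :: "int set" and a :: "int \<Rightarrow> real \<Rightarrow> complex" and D :: "int \<Rightarrow> real"
  assumes omega_nonzero: "\<omega> \<noteq> 0"
    and flat_modes: "a n \<in> flat"
    and modes_zero: "n \<notin> A \<Longrightarrow> a n = (\<lambda>_. 0)"
    and finite_interactions: "finite (triads A n)"
    and mode_equation:
      "(a n has_vector_derivative \<i> * of_real \<omega> * (\<Sum>\<tau>\<in>triads A n. cubic a \<tau> t)) (at t)"
    and supnorm_mode_le: "supnorm (a n) \<le> D n"
    and sum_supnorm_duhamel_le: "(\<Sum>\<tau>\<in>triads A n. supnorm (duhamel a \<tau>)) \<le> D n"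
    and summable_bound: "(\<lambda>n. weight s n * D n) summable_on UNIV"

lemma stages_exist:
  assumes "s < 0" "\<omega> \<noteq> 0"
  shows "\<exists>S. S 0 = initial_stage \<and> (\<forall>k. valid_stage \<omega> k (S k) \<and> next_stage s \<omega> k (S k) (S (Suc k)))"
proof -
  have "\<exists>S. \<forall>k. (valid_stage \<omega> k (S k) \<and> (k = 0 \<longrightarrow> S k = initial_stage)) \<and> next_stage s \<omega> k (S k) (S (Suc k))"
  proof (rule dependent_nat_choice)
    show "\<exists>S. valid_stage \<omega> 0 S \<and> (0 = 0 \<longrightarrow> S = initial_stage)"
      using initial_stage_valid by blast
  qed (use stage_step[OF assms] in blast)
  thus ?thesis by blast
qed

text \<open>Once a frequency has been treated, no later stage affects it, so all limits are attained at a
  finite stage. The weighted bounds are summable by comparison with the geometric series.\<close>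

lemma cascade_exists:
  assumes "s < 0" "\<omega> \<noteq> 0"
  shows "\<exists>A a D. cascade s \<omega> A a D \<and> a 0 1 \<noteq> 0"
proof -
  obtain S where S0: "S 0 = initial_stage" and "\<And>k. valid_stage \<omega> k (S k)"
      "\<And>k. next_stage s \<omega> k (S k) (S (Suc k))"
    using stages_exist[OF assms] by blast
  note S = this
  define A where "A = (\<lambda>k. fst (S k))"
  define a where "a = (\<lambda>k. fst (snd (S k)))"
  define D where "D = (\<lambda>k. fst (snd (snd (S k))))"
  define L where "L = (\<lambda>k. snd (snd (snd (S k))))"
  define C where "C = 2 + 1 / \<bar>\<omega>\<bar>"
  have Sk: "S k = (A k, a k, D k, L k)" for k
    by (simp add: A_def a_def D_def L_def)
  note valid = S(2)[unfolded Sk valid_stage_def prod.case]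
  note S_step = S(3)[unfolded Sk next_stage_def prod.case]
  have AL: "A k \<subseteq> {-L k..L k}" and kL: "int k \<le> L k" and flat: "a k n \<in> flat"
    and zero: "n \<notin> A k \<Longrightarrow> a k n = (\<lambda>_. 0)" and D0: "0 \<le> D k n" and Da: "supnorm (a k n) \<le> D k n" for k n
    using valid[of k] by blast+
  have L_Suc: "L k < L (Suc k)" and A_Suc: "A (Suc k) \<inter> {-L k..L k} = A k" for k
    using S_step[of k] by blast+
  have C: "1 \<le> C" by (simp add: C_def)
  have DJ: "(\<Sum>\<tau>\<in>triads (A k) n. supnorm (duhamel (a k) \<tau>)) \<le> C * D k n" for k n
  proof -
    have "(\<Sum>\<tau>\<in>triads (A k) n. supnorm (duhamel (a k) \<tau>))
        \<le> (if n \<in> int_decode ` {..<k} then C else 1) * D k n"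
      unfolding C_def using valid[of k] by blast
    also have "\<dots> \<le> C * D k n"
      by (intro mult_right_mono D0) (use C in auto)
    finally show ?thesis .
  qed
  have L_mono: "L j \<le> L k" if "j \<le> k" for j k
    using that by (rule lift_Suc_mono_le[rotated]) (use L_Suc in \<open>simp add: less_imp_le\<close>)
  have old: "a k n = a j n \<and> D k n = D j n \<and> (n \<in> A k \<longleftrightarrow> n \<in> A j)" if "j \<le> k" "\<bar>n\<bar> \<le> L j" for j k n
    using that
  proof (induction k rule: dec_induct)
    case (step k)
    hence n: "\<bar>n\<bar> \<le> L k" using L_mono[of j k] by linarith
    hence "a (Suc k) n = a k n" "D (Suc k) n = D k n"
      using S_step[of k] by simp_all
    moreover have "n \<in> A (Suc k) \<longleftrightarrow> n \<in> A k"
    proof -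
      have "n \<in> {-L k..L k}" using n by auto
      thus ?thesis using A_Suc[of k] by blast
    qed
    ultimately show ?case using step.IH step.prems by simp
  qed auto
  define A' where "A' = (\<Union>k. A k)"
  define a' where "a' = (\<lambda>n. a (nat \<bar>n\<bar>) n)"
  define D' where "D' = (\<lambda>n. D (nat \<bar>n\<bar>) n)"
  have nL: "\<bar>n\<bar> \<le> L (nat \<bar>n\<bar>)" for n using kL[of "nat \<bar>n\<bar>"] by simp
  have "a' n = a k n \<and> D' n = D k n" if "\<bar>n\<bar> \<le> L k" for n k
  proof (cases "k \<le> nat \<bar>n\<bar>")
    case True
    from old[OF this that] show ?thesis unfolding a'_def D'_def by blast
  next
    case False
    hence "nat \<bar>n\<bar> \<le> k" by simp
    from old[OF this nL] show ?thesis unfolding a'_def D'_def by presburger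
  qed
  hence lim: "a' n = a k n" "D' n = D k n" if "\<bar>n\<bar> \<le> L k" for n k
    using that by blast+
  have A_mono: "A j \<subseteq> A k" if "j \<le> k" for j k
    using that by (rule lift_Suc_mono_le[rotated]) (use A_Suc in blast)
  have inA: "\<bar>n\<bar> \<le> L k" if "n \<in> A k" for n k
    using subsetD[OF AL that] by auto
  \<comment> \<open>No stage after the one that treats \<open>n\<close> creates interactions with output \<open>n\<close>.\<close>
  have triads': "triads A' n = triads (A (Suc (int_encode n))) n" for n
  proof -
    let ?j = "int_encode n"
    have stable: "triads (A k) n = triads (A (Suc ?j)) n" if "Suc ?j \<le> k" for k
      using that
    proof (induction k rule: dec_induct)
      case (step k)
      have "\<bar>n\<bar> \<le> L k"
        using abs_int_decode_le[of ?j] kL[of k] step.hyps by simp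
      moreover have "n \<noteq> int_decode k"
        using step.hyps by (metis int_encode_inverse int_decode_inverse Suc_n_not_le_n)
      ultimately show ?case
        using S_step[of k] step.IH by simp
    qed simp
    show ?thesis
    proof (intro equalityI subsetI)
      fix \<tau> assume \<tau>: "\<tau> \<in> triads A' n"
      obtain p q r where pqr: "\<tau> = (p, q, r)" by (cases \<tau>)
      with \<tau> obtain i j k where "p \<in> A i" "q \<in> A j" "r \<in> A k" by (auto simp: triads_def A'_def)
      define m where "m = max (Suc ?j) (max i (max j k))"
      have "i \<le> m" "j \<le> m" "k \<le> m" by (auto simp: m_def)
      hence "p \<in> A m" "q \<in> A m" "r \<in> A m"
        using A_mono \<open>p \<in> A i\<close> \<open>q \<in> A j\<close> \<open>r \<in> A k\<close> by blast+
      hence "\<tau> \<in> triads (A m) n" using \<tau> by (auto simp: pqr triads_def)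
      thus "\<tau> \<in> triads (A (Suc ?j)) n" using stable[of m] by (simp add: m_def)
    qed (auto simp: triads_def A'_def)
  qed
  have lim_cubic: "cubic a' \<tau> = cubic (a k) \<tau>" "duhamel a' \<tau> = duhamel (a k) \<tau>"
    if "\<tau> \<in> triads (A k) n" for \<tau> k n
  proof -
    obtain p q r where pqr: "\<tau> = (p, q, r)" by (cases \<tau>)
    hence "p \<in> A k" "q \<in> A k" "r \<in> A k" using that by (auto simp: triads_def)
    hence "a' p = a k p" "a' q = a k q" "a' r = a k r" by (auto intro!: lim inA)
    thus "cubic a' \<tau> = cubic (a k) \<tau>" "duhamel a' \<tau> = duhamel (a k) \<tau>"
      unfolding pqr by (rule cubic_cong, rule duhamel_cong)
  qed
  have nL': "\<bar>n\<bar> \<le> L (Suc (int_encode n))" for n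
    using abs_int_decode_le[of "int_encode n"] kL[of "int_encode n"] L_Suc[of "int_encode n"] by auto
  have D'0: "0 \<le> D' n" for n by (simp add: D'_def D0)
  have box: "(\<Sum>n\<in>{-L k..L k}. weight s n * D k n) \<le> (\<Sum>n\<in>{-L 0..L 0}. weight s n * D 0 n) + (\<Sum>i<k. (1 / 2) ^ i)" for k
  proof (induction k)
    case (Suc k)
    have sub: "{-L k..L k} \<subseteq> {-L (Suc k)..L (Suc k)}" using L_Suc[of k] by auto
    have "(\<Sum>n\<in>{-L (Suc k)..L (Suc k)}. weight s n * D (Suc k) n)
        = (\<Sum>n\<in>{-L (Suc k)..L (Suc k)} - {-L k..L k}. weight s n * D (Suc k) n)
          + (\<Sum>n\<in>{-L k..L k}. weight s n * D (Suc k) n)"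
      by (rule sum.subset_diff[OF sub]) simp
    also have "(\<Sum>n\<in>{-L k..L k}. weight s n * D (Suc k) n) = (\<Sum>n\<in>{-L k..L k}. weight s n * D k n)"
      by (intro sum.cong) (use old[of k "Suc k"] in \<open>auto simp: abs_le_iff\<close>)
    also have "(\<Sum>n\<in>{-L (Suc k)..L (Suc k)} - {-L k..L k}. weight s n * D (Suc k) n) \<le> (1 / 2) ^ k"
      using S_step[of k] by blast
    finally show ?case using Suc by simp
  qed simp
  have summable: "(\<lambda>n. weight s n * D' n) summable_on UNIV"
  proof (rule nonneg_bdd_above_summable_on)
    show "0 \<le> weight s n * D' n" for n
      using weight_pos[of s n] D'0[of n] by simp
    let ?K = "(\<Sum>n\<in>{-L 0..L 0}. weight s n * D 0 n) + 2"
    have "sum (\<lambda>n. weight s n * D' n) F \<le> ?K" if "finite F" for F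
    proof -
      define k where "k = nat (Max (insert 0 (abs ` F)))"
      have "\<bar>n\<bar> \<le> L k" if "n \<in> F" for n
      proof -
        have "\<bar>n\<bar> \<le> Max (insert 0 (abs ` F))" using that \<open>finite F\<close> by (intro Max_ge) auto
        also have "\<dots> \<le> int k" by (simp add: k_def)
        also have "\<dots> \<le> L k" by (rule kL)
        finally show ?thesis .
      qed
      hence "F \<subseteq> {-L k..L k}" by (force simp: abs_le_iff)
      hence "sum (\<lambda>n. weight s n * D' n) F \<le> (\<Sum>n\<in>{-L k..L k}. weight s n * D' n)"
        by (intro sum_mono2) (auto intro!: mult_nonneg_nonneg D'0 simp: weight_pos less_imp_le)
      also have "\<dots> = (\<Sum>n\<in>{-L k..L k}. weight s n * D k n)"
        by (intro sum.cong) (auto simp: lim(2)[of _ k])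
      also have "\<dots> \<le> (\<Sum>n\<in>{-L 0..L 0}. weight s n * D 0 n) + (\<Sum>i<k. (1 / 2) ^ i)"
        by (rule box)
      also have "(\<Sum>i<k. (1 / 2 :: real) ^ i) \<le> 2"
        by (simp add: sum_gp_strict)
      finally show ?thesis by simp
    qed
    thus "bdd_above (sum (\<lambda>n. weight s n * D' n) ` {F. F \<subseteq> UNIV \<and> finite F})"
      by (intro bdd_aboveI[of _ ?K]) auto
  qed
  have "cascade s \<omega> A' a' (\<lambda>n. C * D' n)"
  proof
    show "\<omega> \<noteq> 0" by fact
    show "a' n \<in> flat" for n by (simp add: a'_def flat)
    show "a' n = (\<lambda>_. 0)" if "n \<notin> A'" for n
      using that by (simp add: a'_def A'_def zero)
    show "finite (triads A' n)" for n
      unfolding triads' by (intro finite_triads finite_subset[OF AL]) simp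
    show "(a' n has_vector_derivative \<i> * of_real \<omega> * (\<Sum>\<tau>\<in>triads A' n. cubic a' \<tau> t)) (at t)" for n t
    proof -
      have "(a (Suc (int_encode n)) n has_vector_derivative
          \<i> * of_real \<omega> * (\<Sum>\<tau>\<in>triads (A (Suc (int_encode n))) n. cubic (a (Suc (int_encode n))) \<tau> t)) (at t)"
        using S_step[of "int_encode n"] by simp
      thus ?thesis
        unfolding triads' lim(1)[OF nL'[of n]] by (simp add: lim_cubic cong: sum.cong)
    qed
    show "supnorm (a' n) \<le> C * D' n" for n
      using Da[of "nat \<bar>n\<bar>" n] mult_right_mono[OF C D'0[of n]] by (simp add: a'_def D'_def)
    show "(\<Sum>\<tau>\<in>triads A' n. supnorm (duhamel a' \<tau>)) \<le> C * D' n" for n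
      using DJ[of "Suc (int_encode n)" n]
      unfolding triads' lim(2)[OF nL'[of n]] by (simp add: lim_cubic cong: sum.cong)
    show "(\<lambda>n. weight s n * (C * D' n)) summable_on UNIV"
      using summable_on_cmult_right[OF summable, of C] by (simp add: mult_ac)
  qed
  moreover have "a' 0 1 \<noteq> 0"
    using S0 by (simp add: a'_def a_def initial_stage_def Let_def flat_fun_def)
  ultimately show ?thesis by blast
qed

section \<open>Smooth functions and test functions\<close>

lemma smooth_imp_continuous: "smooth f \<Longrightarrow> continuous_on S f"
  unfolding smooth_def by (metis Ck.simps(1) continuous_on_subset subset_UNIV)

lemma smooth_imp_differentiable: "smooth f \<Longrightarrow> f differentiable at p"
  unfolding smooth_def by (metis Ck.simps(2))

lemma smooth_dirderiv: "smooth f \<Longrightarrow> smooth (dirderiv v f)"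
  unfolding smooth_def by (metis Ck.simps(2))

text \<open>Coinduction spares formulas for iterated derivatives.\<close>

lemma smooth_coinduct:
  assumes "f \<in> S"
    and "\<And>g p. g \<in> S \<Longrightarrow> g differentiable at p"
    and "\<And>g v. g \<in> S \<Longrightarrow> dirderiv v g \<in> S"
  shows "smooth f"
proof -
  have "g \<in> S \<Longrightarrow> Ck k g" for k g
  proof (induction k arbitrary: g)
    case 0
    thus ?case
      using assms(2) differentiable_imp_continuous_within
      by (simp add: continuous_on_eq_continuous_within) blast
  qed (use assms in auto)
  thus ?thesis using assms(1) by (simp add: smooth_def)
qed

lemma dirderiv_eqI: "(f has_derivative f') (at p) \<Longrightarrow> dirderiv v f p = f' v"
  by (simp add: dirderiv_def frechet_derivative_at[symmetric])

lemma smooth_has_derivative: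
  "smooth f \<Longrightarrow> (f has_derivative (\<lambda>v. dirderiv v f p)) (at p)"
  using smooth_imp_differentiable[of f p]
  by (simp add: dirderiv_def frechet_derivative_works)

lemma dirderiv_real_eqI:
  "(f has_vector_derivative f') (at x) \<Longrightarrow> dirderiv v f x = of_real v * f'"
  unfolding has_vector_derivative_def by (drule dirderiv_eqI) (simp add: scaleR_conv_of_real)

lemma smooth_has_vector_derivative:
  fixes f :: "real \<Rightarrow> complex"
  assumes "smooth f"
  shows "(f has_vector_derivative dirderiv 1 f x) (at x within S)"
proof -
  have "linear (\<lambda>v. dirderiv v f x)"
    using smooth_has_derivative[OF assms] has_derivative_linear by blast
  hence "dirderiv v f x = v *\<^sub>R dirderiv 1 f x" for v
    using linear_scale[of "\<lambda>v. dirderiv v f x" v 1] by simp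
  thus ?thesis
    using smooth_has_derivative[OF assms, of x] unfolding has_vector_derivative_def
    by (metis (no_types, lifting) ext has_derivative_at_withinI)
qed

lemma smooth_partial_dx:
  assumes "smooth f"
  shows "((\<lambda>x. f (t, x)) has_vector_derivative dx f (t, x)) (at x within S)"
proof -
  have lin: "linear (\<lambda>v. dirderiv v f (t, x))"
    using smooth_has_derivative[OF assms] has_derivative_linear by blast
  have "((\<lambda>x. f (t, x)) has_derivative (\<lambda>h. dirderiv (0, h) f (t, x))) (at x)"
    by (rule has_derivative_compose[OF _ smooth_has_derivative[OF assms]])
       (auto intro!: derivative_eq_intros)
  moreover have "dirderiv (0, h) f (t, x) = h *\<^sub>R dx f (t, x)" for h
    using linear_scale[OF lin, of h "(0, 1)"] by (simp add: dx_def)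
  ultimately show ?thesis
    by (simp add: has_vector_derivative_def has_derivative_at_withinI)
qed

lemma smooth_partial_dt:
  assumes "smooth f"
  shows "((\<lambda>t. f (t, x)) has_vector_derivative dt f (t, x)) (at t within S)"
proof -
  have lin: "linear (\<lambda>v. dirderiv v f (t, x))"
    using smooth_has_derivative[OF assms] has_derivative_linear by blast
  have "((\<lambda>t. f (t, x)) has_derivative (\<lambda>h. dirderiv (h, 0) f (t, x))) (at t)"
    by (rule has_derivative_compose[OF _ smooth_has_derivative[OF assms]])
       (auto intro!: derivative_eq_intros)
  moreover have "dirderiv (h, 0) f (t, x) = h *\<^sub>R dt f (t, x)" for h
    using linear_scale[OF lin, of h "(1, 0)"] by (simp add: dt_def)
  ultimately show ?thesis
    by (simp add: has_vector_derivative_def has_derivative_at_withinI)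
qed

lemma dirderiv_translate:
  assumes "smooth f" "\<And>p. f (p + c) = f p"
  shows "dirderiv v f (p + c) = dirderiv v f p"
proof -
  have "((\<lambda>p. f (p + c)) has_derivative (\<lambda>v. dirderiv v f (p + c))) (at p)"
    by (rule has_derivative_compose[OF _ smooth_has_derivative[OF assms(1)]])
       (auto intro!: derivative_eq_intros)
  hence "(f has_derivative (\<lambda>v. dirderiv v f (p + c))) (at p)"
    by (simp add: assms(2))
  from dirderiv_eqI[OF this] show ?thesis by simp
qed

lemma dirderiv_eq_0:
  assumes "open U" "p \<in> U" "\<And>q. q \<in> U \<Longrightarrow> f q = 0"
  shows "dirderiv v f p = 0"
proof -
  have "(f has_derivative (\<lambda>_. 0)) (at p)"
    by (rule has_derivative_transform_within_open[OF has_derivative_const[of 0] assms(1,2)])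
       (simp add: assms)
  from dirderiv_eqI[OF this] show ?thesis by simp
qed

lemma test_T_dirderiv: "\<phi> \<in> test_T \<Longrightarrow> dirderiv 1 \<phi> \<in> test_T"
  unfolding test_T_def by (auto intro: smooth_dirderiv dirderiv_translate)

lemma supp_in_dirderiv:
  assumes "supp_in a b f"
  shows "supp_in a b (dirderiv v f)"
  unfolding supp_in_def
proof (intro allI impI)
  fix t x assume *: "dirderiv v f (t, x) \<noteq> 0"
  show "a \<le> t \<and> t \<le> b"
  proof (rule ccontr)
    assume "\<not> (a \<le> t \<and> t \<le> b)"
    hence "dirderiv v f (t, x) = 0"
      using assms
      by (intro dirderiv_eq_0[of "({..<a} \<union> {b<..}) \<times> UNIV"] open_Times open_Un) (auto simp: supp_in_def)
    with * show False by simp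
  qed
qed

lemma test_ST_dirderiv:
  assumes "\<phi> \<in> test_ST"
  shows "dirderiv v \<phi> \<in> test_ST"
proof -
  from assms obtain a b where "0 < a" "b < 1" "supp_in a b \<phi>" and sm: "smooth \<phi>"
    and per: "\<And>t x. \<phi> (t, x + 2 * pi) = \<phi> (t, x)"
    by (auto simp: test_ST_def)
  have "dirderiv v \<phi> (t, x + 2 * pi) = dirderiv v \<phi> (t, x)" for t x
    using dirderiv_translate[OF sm, of "(0, 2 * pi)" v "(t, x)"] per by auto
  thus ?thesis
    using \<open>0 < a\<close> \<open>b < 1\<close> supp_in_dirderiv[OF \<open>supp_in a b \<phi>\<close>, of v] smooth_dirderiv[OF sm, of v]
    unfolding test_ST_def by blast
qed

lemma test_ST_dt: "\<phi> \<in> test_ST \<Longrightarrow> dt \<phi> \<in> test_ST"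
  and test_ST_dx: "\<phi> \<in> test_ST \<Longrightarrow> dx \<phi> \<in> test_ST"
  unfolding dt_def dx_def by (rule test_ST_dirderiv, assumption)+

lemma smooth_cis: "smooth (\<lambda>x. c * cis (l * x))"
proof (rule smooth_coinduct)
  let ?S = "range (\<lambda>c. \<lambda>x. c * cis (l * x))"
  have d: "((\<lambda>x. c * cis (l * x)) has_vector_derivative c * (\<i> * of_real l * cis (l * x))) (at x)" for c x
    by (rule has_vector_derivative_mult_right[OF has_vector_derivative_cis])
  show "(\<lambda>x. c * cis (l * x)) \<in> ?S" by blast
  show "g differentiable at p" if "g \<in> ?S" for g p
    using that d unfolding has_vector_derivative_def differentiable_def by blast
  show "dirderiv v g \<in> ?S" if "g \<in> ?S" for g v
  proof -
    from that obtain c where g: "g = (\<lambda>x. c * cis (l * x))" by blast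
    have "dirderiv v g = (\<lambda>x. (of_real v * c * \<i> * of_real l) * cis (l * x))"
      unfolding g using dirderiv_real_eqI[OF d] by (simp add: fun_eq_iff mult_ac)
    thus ?thesis by blast
  qed
qed

lemma cis_in_test_T: "(\<lambda>x. cis (- (of_int n * x))) \<in> test_T"
proof -
  have "cis (- (of_int n * (x + 2 * pi))) = cis (- (of_int n * x))" for x :: real
  proof -
    have "cis (- (of_int n * (x + 2 * pi))) = cis (- (of_int n * x)) * cis (2 * pi * of_int (- n))"
      by (simp add: cis_mult algebra_simps)
    thus ?thesis using cis_multiple_2pi[of "of_int (- n)"] by simp
  qed
  thus ?thesis
    using smooth_cis[of 1 "- of_int n"] by (simp add: test_T_def)
qed

lemma smooth_tensor:
  assumes "f \<in> K"
    and "\<And>f. f \<in> K \<Longrightarrow> \<exists>f'\<in>K. \<forall>t. (f has_vector_derivative f' t) (at t)"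
    and "\<And>f g z w. f \<in> K \<Longrightarrow> g \<in> K \<Longrightarrow> (\<lambda>t. z * f t + w * g t) \<in> K"
  shows "smooth (\<lambda>(t, x). f t * cis (l * x))"
proof (rule smooth_coinduct)
  let ?S = "(\<lambda>f. \<lambda>(t, x). f t * cis (l * x)) ` K"
  have d: "((\<lambda>(t, x). f t * cis (l * x)) has_derivative
      (\<lambda>v. (of_real (fst v) * f' t + (of_real (snd v) * (\<i> * of_real l)) * f t) * cis (l * x))) (at (t, x))"
    if "(f has_vector_derivative f' t) (at t)" for f f' t x
  proof -
    have "((\<lambda>p. f (fst p)) has_derivative (\<lambda>v. fst v *\<^sub>R f' t)) (at (t, x))"
      by (rule has_derivative_compose[of fst fst])
         (use that in \<open>auto simp: has_vector_derivative_def intro!: derivative_eq_intros\<close>)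
    moreover have "((\<lambda>p. cis (l * snd p)) has_derivative (\<lambda>v. snd v *\<^sub>R (\<i> * of_real l * cis (l * x)))) (at (t, x))"
      by (rule has_derivative_compose[of snd snd])
         (use has_vector_derivative_cis[of l x UNIV] in \<open>auto simp: has_vector_derivative_def intro!: derivative_eq_intros\<close>)
    ultimately have "((\<lambda>p. f (fst p) * cis (l * snd p)) has_derivative
        (\<lambda>v. f (fst (t, x)) * (snd v *\<^sub>R (\<i> * of_real l * cis (l * x)))
          + fst v *\<^sub>R f' t * cis (l * snd (t, x)))) (at (t, x))"
      by (rule has_derivative_mult)
    thus ?thesis
      by (simp add: case_prod_unfold scaleR_conv_of_real algebra_simps)
  qed
  show "(\<lambda>(t, x). f t * cis (l * x)) \<in> ?S" using assms(1) by blast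
  show "g differentiable at p" if "g \<in> ?S" for g p
  proof -
    obtain t x where "p = (t, x)" by (cases p)
    with that assms(2) d show ?thesis unfolding differentiable_def by blast
  qed
  show "dirderiv v g \<in> ?S" if "g \<in> ?S" for g v
  proof -
    from that obtain f where f: "f \<in> K" and g: "g = (\<lambda>(t, x). f t * cis (l * x))" by blast
    with assms(2) obtain f' where f': "f' \<in> K" "\<And>t. (f has_vector_derivative f' t) (at t)" by blast
    have "dirderiv v g = (\<lambda>(t, x). (of_real (fst v) * f' t + (of_real (snd v) * (\<i> * of_real l)) * f t) * cis (l * x))"
      unfolding g by (intro ext, clarify, subst dirderiv_eqI[OF d[of f f', OF f'(2)]], rule refl)
    thus ?thesis by (rule image_eqI[OF _ assms(3)[OF f'(1) f]])
  qed
qed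

text \<open>In the generators one factor vanishes for $t\le a$ and the other for $t\ge b$, so these are smooth
  functions supported in $[a,b]$.\<close>

inductive_set bumps :: "(real \<Rightarrow> complex) set" where
  base: "g \<in> flat \<Longrightarrow> h \<in> flat \<Longrightarrow> (\<lambda>t. g (t - a) * h (b - t)) \<in> bumps"
| add: "f \<in> bumps \<Longrightarrow> g \<in> bumps \<Longrightarrow> (\<lambda>t. f t + g t) \<in> bumps"

lemma bumps_cmult: "f \<in> bumps \<Longrightarrow> (\<lambda>t. z * f t) \<in> bumps"
proof (induction rule: bumps.induct)
  case (base g h a b)
  show ?case using bumps.base[OF flat_cmult[OF base(1), of z] base(2), of a b] by (simp add: mult.assoc)
qed (auto simp: ring_distribs intro: bumps.add)

lemma bumps_has_derivative:
  assumes "f \<in> bumps"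
  shows "\<exists>f'\<in>bumps. \<forall>t. (f has_vector_derivative f' t) (at t)"
  using assms
proof (induction rule: bumps.induct)
  case (base g h a b)
  obtain g' h' where g': "g' \<in> flat" "\<And>t. (g has_vector_derivative g' t) (at t)"
    and h': "h' \<in> flat" "\<And>t. (h has_vector_derivative h' t) (at t)"
    using flat_has_derivative[OF base(1)] flat_has_derivative[OF base(2)] by blast
  have "(\<lambda>t. g' (t - a) * h (b - t) + g (t - a) * (- 1 * h' (b - t))) \<in> bumps"
    using bumps.base[OF g'(1) base(2), of a b] bumps.base[OF base(1) flat_cmult[OF h'(1), of "-1"], of a b]
    by (rule bumps.add)
  moreover have "((\<lambda>t. g (t - a) * h (b - t)) has_vector_derivative
      g' (t - a) * h (b - t) + g (t - a) * (- 1 * h' (b - t))) (at t)" for t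
  proof -
    have "((\<lambda>t. g (t - a)) has_vector_derivative g' (t - a)) (at t)"
    proof -
      have "((\<lambda>t. t - a) has_vector_derivative 1 - 0) (at t)"
        by (intro has_vector_derivative_diff has_vector_derivative_id has_vector_derivative_const)
      from vector_diff_chain_at[OF this g'(2)] show ?thesis by (simp add: o_def)
    qed
    moreover have "((\<lambda>t. h (b - t)) has_vector_derivative - 1 * h' (b - t)) (at t)"
    proof -
      have "((\<lambda>t. b - t) has_vector_derivative 0 - 1) (at t)"
        by (intro has_vector_derivative_diff has_vector_derivative_id has_vector_derivative_const)
      from vector_diff_chain_at[OF this h'(2)] show ?thesis by (simp add: o_def)
    qed
    ultimately show ?thesis
      using has_vector_derivative_mult[of "\<lambda>t. g (t - a)" "g' (t - a)" t UNIV "\<lambda>t. h (b - t)" "- 1 * h' (b - t)"]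
      by (simp add: add.commute)
  qed
  ultimately show ?case by - (erule bexI[rotated], rule allI)
next
  case (add f g)
  then obtain f' g' where fg: "f' \<in> bumps" "g' \<in> bumps"
    "\<And>t. (f has_vector_derivative f' t) (at t)" "\<And>t. (g has_vector_derivative g' t) (at t)"
    by blast
  show ?case
    using fg by (intro bexI[of _ "\<lambda>t. f' t + g' t"] allI has_vector_derivative_add bumps.add)
qed

text \<open>The test functions of the du Bois-Reymond lemma are antiderivatives of differences of bumps.\<close>

definition bump_primitives :: "(real \<Rightarrow> complex) set" where
  "bump_primitives = {f. \<exists>f'\<in>bumps. \<forall>t. (f has_vector_derivative f' t) (at t)}"

lemma bump_primitives_smooth_tensor:
  assumes "f \<in> bump_primitives"
  shows "smooth (\<lambda>(t, x). f t * cis (l * x))"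
proof (rule smooth_tensor[OF assms])
  show "\<exists>f'\<in>bump_primitives. \<forall>t. (f has_vector_derivative f' t) (at t)"
    if "f \<in> bump_primitives" for f
    using that bumps_has_derivative unfolding bump_primitives_def by blast
  show "(\<lambda>t. z * f t + w * g t) \<in> bump_primitives"
    if "f \<in> bump_primitives" "g \<in> bump_primitives" for f g z w
  proof -
    from that obtain f' g' where "f' \<in> bumps" "g' \<in> bumps"
      "\<And>t. (f has_vector_derivative f' t) (at t)" "\<And>t. (g has_vector_derivative g' t) (at t)"
      unfolding bump_primitives_def by blast
    thus ?thesis unfolding bump_primitives_def
      by (intro CollectI bexI[of _ "\<lambda>t. z * f' t + w * g' t"] allI has_vector_derivative_add
          has_vector_derivative_mult_right bumps.add bumps_cmult)
  qed
qed

section \<open>The lemma of du Bois-Reymond\<close>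

text \<open>The test function $\psi$ is the antiderivative of a narrow bump at $t_1$ minus its translate to
  $t_2$. It has compact support because the two bumps have the same mass, and the hypothesis says
  that $h$ has the same mean with respect to both bumps.\<close>

lemma weakly_constant_interior:
  fixes h :: "real \<Rightarrow> complex"
  assumes cont: "continuous_on {0..1} h"
    and weak: "\<And>\<psi> \<psi>' a b. \<psi> \<in> bump_primitives \<Longrightarrow> (\<And>t. (\<psi> has_vector_derivative \<psi>' t) (at t)) \<Longrightarrow>
       0 < a \<Longrightarrow> b < 1 \<Longrightarrow> (\<And>t. \<psi> t \<noteq> 0 \<Longrightarrow> a \<le> t \<and> t \<le> b) \<Longrightarrow>
       integral {0..1} (\<lambda>t. h t * \<psi>' t) = 0"
    and t12: "0 < t1" "t1 < t2" "t2 < 1"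
  shows "h t1 = h t2"
proof -
  have close: "cmod (h t1 - h t2) \<le> 2 * \<eta>" if \<eta>: "\<eta> > 0" for \<eta>
  proof -
    have "\<exists>d>0. \<forall>t\<in>{0..1}. \<bar>t - c\<bar> < d \<longrightarrow> cmod (h t - h c) \<le> \<eta>" if "c \<in> {0..1}" for c
    proof -
      from cont that \<eta> obtain d where "d > 0" "\<forall>t\<in>{0..1}. dist t c < d \<longrightarrow> dist (h t) (h c) < \<eta>"
        unfolding continuous_on_iff by metis
      thus ?thesis by (intro exI[of _ d]) (auto simp: dist_norm less_imp_le)
    qed
    from this[of t1] this[of t2] t12 obtain d1 d2 where d: "d1 > 0" "d2 > 0"
      "\<And>t. t \<in> {0..1} \<Longrightarrow> \<bar>t - t1\<bar> < d1 \<Longrightarrow> cmod (h t - h t1) \<le> \<eta>"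
      "\<And>t. t \<in> {0..1} \<Longrightarrow> \<bar>t - t2\<bar> < d2 \<Longrightarrow> cmod (h t - h t2) \<le> \<eta>"
      by auto
    define \<epsilon> where "\<epsilon> = min (min d1 d2) (min t1 (1 - t2)) / 2"
    have "0 < 2 * \<epsilon>" "2 * \<epsilon> \<le> d1" "2 * \<epsilon> \<le> d2" "2 * \<epsilon> \<le> t1" "2 * \<epsilon> \<le> 1 - t2"
      using d(1,2) t12 by (auto simp: \<epsilon>_def)
    hence \<epsilon>: "0 < \<epsilon>" "\<epsilon> < d1" "\<epsilon> < d2" "\<epsilon> < t1" "\<epsilon> < 1 - t2"
      by linarith+
    define e where "e = flat_fun 1 0 0"
    define R where "R = (\<lambda>u. e (u + \<epsilon>) * e (\<epsilon> - u))"
    define \<rho> where "\<rho> = (\<lambda>u. Re (R u))"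
    have eflat: "e \<in> flat" using flat.base[of 1 1 0 0] by (simp add: e_def)
    have R_real: "R u = of_real (\<rho> u)" and rho_nonneg: "0 \<le> \<rho> u" for u
      by (auto simp: \<rho>_def R_def e_def flat_fun_def)
    have R0: "R u = 0" if "\<epsilon> \<le> \<bar>u\<bar>" for u
      using that by (auto simp: R_def e_def abs_if split: if_splits)
    have rho0: "\<rho> 0 \<noteq> 0" using \<epsilon> by (simp add: \<rho>_def R_def e_def flat_fun_def)
    have R_shift: "(\<lambda>t. R (t - c)) \<in> bumps" for c
      using bumps.base[OF eflat eflat, of "c - \<epsilon>" "c + \<epsilon>"] by (simp add: R_def algebra_simps)
    have Rcont: "continuous_on S R" for S
    proof -
      have "continuous_on S (\<lambda>u. e (u + \<epsilon>))" "continuous_on S (\<lambda>u. e (\<epsilon> - u))"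
        by (intro continuous_on_compose2[OF flat_continuous[OF eflat, of UNIV]] continuous_intros; simp)+
      thus ?thesis unfolding R_def by (intro continuous_on_mult)
    qed
    \<comment> \<open>Any lower limit to the left of the support of \<open>R\<close> would do.\<close>
    define Q where "Q = (\<lambda>t. integral {-2..t} R)"
    have int0: "integral {x..y} R = 0" if "\<And>u. u \<in> {x..y} \<Longrightarrow> \<epsilon> \<le> \<bar>u\<bar>" for x y
      using that R0 by (intro integral_unique has_integral_is_0) auto
    have Q0: "Q t = 0" if "t \<le> - \<epsilon>" for t
      unfolding Q_def using that \<epsilon> by (intro int0) auto
    have Q1: "Q t = Q \<epsilon>" if "\<epsilon> \<le> t" for t
    proof -
      have "Q \<epsilon> + integral {\<epsilon>..t} R = Q t"
        unfolding Q_def using that \<epsilon>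
        by (intro Henstock_Kurzweil_Integration.integral_combine integrable_continuous_real Rcont) auto
      moreover have "integral {\<epsilon>..t} R = 0" using \<epsilon> by (intro int0) auto
      ultimately show ?thesis by simp
    qed
    have Qd: "(Q has_vector_derivative R t) (at t)" for t
    proof (cases "t < - \<epsilon>")
      case True
      have "((\<lambda>_. 0) has_vector_derivative (0::complex)) (at t)" by simp
      hence "(Q has_vector_derivative 0) (at t)"
        by (rule has_vector_derivative_transform_within_open[of _ _ _ "{..<- \<epsilon>}"])
           (use True Q0 in auto)
      thus ?thesis using R0[of t] True by simp
    next
      case False
      have "(Q has_vector_derivative R t) (at t within {-2..t + 1})"
        unfolding Q_def by (rule integral_has_vector_derivative[OF Rcont]) (use False \<epsilon> t12 in auto)
      moreover have "at t within {-2..t + 1} = at t"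
        by (rule at_within_interior) (use False \<epsilon> t12 in auto)
      ultimately show ?thesis by (simp only:)
    qed
    have Qd': "((\<lambda>t. Q (t - c)) has_vector_derivative R (t - c)) (at t)" for c t
    proof -
      have "((\<lambda>t. t - c) has_vector_derivative 1 - 0) (at t)"
        by (intro has_vector_derivative_diff has_vector_derivative_id has_vector_derivative_const)
      from vector_diff_chain_at[OF this Qd[of "t - c"]] show ?thesis by (simp add: o_def)
    qed
    define \<psi> where "\<psi> = (\<lambda>t. Q (t - t1) - Q (t - t2))"
    define \<psi>' where "\<psi>' = (\<lambda>t. R (t - t1) + (- 1) * R (t - t2))"
    have \<psi>d: "(\<psi> has_vector_derivative \<psi>' t) (at t)" for t
      unfolding \<psi>_def \<psi>'_def using has_vector_derivative_diff[OF Qd'[of t1 t] Qd'[of t2 t]] by simp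
    have "\<psi>' \<in> bumps" unfolding \<psi>'_def by (intro bumps.add bumps_cmult R_shift)
    hence "\<psi> \<in> bump_primitives" using \<psi>d unfolding bump_primitives_def by blast
    hence "integral {0..1} (\<lambda>t. h t * \<psi>' t) = 0"
    proof (rule weak[OF _ \<psi>d, of "t1 - \<epsilon>" "t2 + \<epsilon>"])
      show "t1 - \<epsilon> \<le> t \<and> t \<le> t2 + \<epsilon>" if "\<psi> t \<noteq> 0" for t
      proof (rule ccontr)
        assume "\<not> (t1 - \<epsilon> \<le> t \<and> t \<le> t2 + \<epsilon>)"
        hence "t - t1 \<le> - \<epsilon> \<and> t - t2 \<le> - \<epsilon> \<or> \<epsilon> \<le> t - t1 \<and> \<epsilon> \<le> t - t2" using t12 by linarith
        hence "\<psi> t = 0" unfolding \<psi>_def using Q0 Q1[of "t - t1"] Q1[of "t - t2"] by auto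
        with that show False by simp
      qed
    qed (use \<epsilon> in auto)
    define I where "I = (\<lambda>c. integral {0..1} (\<lambda>t. h t * R (t - c)))"
    have cR: "continuous_on {0..1} (\<lambda>t. R (t - c))" for c
      by (intro continuous_on_compose2[OF Rcont[of UNIV]] continuous_intros) auto
    have "integral {0..1} (\<lambda>t. h t * \<psi>' t) = I t1 - I t2"
      unfolding I_def \<psi>'_def
      by (subst Henstock_Kurzweil_Integration.integral_diff[symmetric])
         (auto simp: algebra_simps intro!: integrable_continuous_real continuous_intros cont cR)
    with \<open>integral {0..1} (\<lambda>t. h t * \<psi>' t) = 0\<close> have I: "I t1 = I t2" by simp
    define m where "m = integral {0..1} (\<lambda>t. \<rho> (t - t1))"
    have crho: "continuous_on {0..1} (\<lambda>t. \<rho> (t - c))" for c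
      unfolding \<rho>_def by (intro continuous_intros cR)
    have mass: "((\<lambda>t. \<rho> (t - c)) has_integral Re (Q \<epsilon>)) {0..1}" if "c \<in> {t1, t2}" for c
    proof -
      have "((\<lambda>t. R (t - c)) has_integral Q (1 - c) - Q (0 - c)) {0..1}"
        using Qd' by (intro fundamental_theorem_of_calculus) (auto intro: has_vector_derivative_at_within)
      moreover have "Q (1 - c) = Q \<epsilon>" using that \<epsilon> t12 by (intro Q1) auto
      moreover have "Q (0 - c) = 0" using that \<epsilon> t12 by (intro Q0) auto
      ultimately have "((\<lambda>t. R (t - c)) has_integral Q \<epsilon>) {0..1}" by simp
      from has_integral_linear[OF this bounded_linear_Re] show ?thesis by (simp add: \<rho>_def o_def)
    qed
    have m: "m = Re (Q \<epsilon>)" "integral {0..1} (\<lambda>t. \<rho> (t - t2)) = m"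
      using integral_unique[OF mass[of t1]] integral_unique[OF mass[of t2]] by (simp_all add: m_def)
    have "m \<ge> 0" unfolding m_def
      by (intro integral_nonneg integrable_continuous_real crho rho_nonneg)
    moreover have "m \<noteq> 0"
    proof
      assume "m = 0"
      hence "\<forall>t\<in>{0..1}. \<rho> (t - t1) = 0"
        unfolding m_def using integral_eq_0_iff[of 0 1 "\<lambda>t. \<rho> (t - t1)"] crho rho_nonneg by auto
      with t12 rho0 show False by (auto dest!: bspec[of _ _ t1])
    qed
    ultimately have "m > 0" by simp
    have near: "cmod (I c - h c * of_real m) \<le> \<eta> * m"
      if c: "c \<in> {t1, t2}" and hc: "\<And>t. t \<in> {0..1} \<Longrightarrow> \<bar>t - c\<bar> < \<epsilon> \<Longrightarrow> cmod (h t - h c) \<le> \<eta>" for c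
    proof -
      have "integral {0..1} (\<lambda>t. R (t - c)) = of_real m"
        using has_integral_of_real[OF mass[OF c], where 'b = complex] m by (simp add: R_real[abs_def] integral_unique)
      hence "h c * of_real m = integral {0..1} (\<lambda>t. h c * R (t - c))"
        by simp
      hence "I c - h c * of_real m = integral {0..1} (\<lambda>t. (h t - h c) * R (t - c))"
        unfolding I_def
        by (simp only: left_diff_distrib)
           (rule Henstock_Kurzweil_Integration.integral_diff[symmetric];
            intro integrable_continuous_real continuous_intros cont cR)
      also have "cmod \<dots> \<le> integral {0..1} (\<lambda>t. \<eta> * \<rho> (t - c))"
      proof (rule integral_norm_bound_integral)
        show "cmod ((h t - h c) * R (t - c)) \<le> \<eta> * \<rho> (t - c)" if "t \<in> {0..1}" for t
        proof (cases "\<bar>t - c\<bar> < \<epsilon>")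
          case True
          thus ?thesis
            using mult_right_mono[OF hc[OF that] rho_nonneg[of "t - c"]] rho_nonneg[of "t - c"]
            by (simp add: norm_mult R_real)
        next
          case False
          thus ?thesis using R0[of "t - c"] by (simp add: \<rho>_def)
        qed
      qed (intro integrable_continuous_real continuous_intros cont cR crho)+
      also have "\<dots> = \<eta> * m" using c m by (auto simp: m_def)
      finally show ?thesis .
    qed
    have "cmod (I t1 - h t1 * of_real m) \<le> \<eta> * m" "cmod (I t2 - h t2 * of_real m) \<le> \<eta> * m"
      using d \<epsilon> by (auto intro!: near)
    hence "cmod ((I t2 - h t2 * of_real m) - (I t1 - h t1 * of_real m)) \<le> 2 * \<eta> * m"
      using norm_triangle_ineq4[of "I t2 - h t2 * of_real m" "I t1 - h t1 * of_real m"] by linarith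
    moreover have "(I t2 - h t2 * of_real m) - (I t1 - h t1 * of_real m) = (h t1 - h t2) * of_real m"
      using I by (simp add: algebra_simps)
    ultimately show ?thesis using \<open>m > 0\<close> by (simp add: norm_mult)
  qed
  have "cmod (h t1 - h t2) \<le> 0"
  proof (rule field_le_epsilon)
    show "cmod (h t1 - h t2) \<le> 0 + e" if "e > 0" for e
      using close[of "e / 2"] that by simp
  qed
  thus ?thesis by simp
qed

lemma weakly_constant:
  fixes h :: "real \<Rightarrow> complex"
  assumes cont: "continuous_on {0..1} h"
    and weak: "\<And>\<psi> \<psi>' a b. \<psi> \<in> bump_primitives \<Longrightarrow> (\<And>t. (\<psi> has_vector_derivative \<psi>' t) (at t)) \<Longrightarrow>
       0 < a \<Longrightarrow> b < 1 \<Longrightarrow> (\<And>t. \<psi> t \<noteq> 0 \<Longrightarrow> a \<le> t \<and> t \<le> b) \<Longrightarrow>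
       integral {0..1} (\<lambda>t. h t * \<psi>' t) = 0"
    and t: "t \<in> {0..1}"
  shows "h t = h 0"
proof -
  have int: "h x = h y" if "0 < x" "x < y" "y < 1" for x y
    by (rule weakly_constant_interior[OF cont _ that]) (rule weak)
  have const: "h x = h (1 / 2)" if "x \<in> {0<..<1}" for x
  proof -
    consider "x < 1 / 2" | "x = 1 / 2" | "1 / 2 < x" by linarith
    thus ?thesis
    proof cases
      case 1
      thus ?thesis using that by (intro int) auto
    next
      case 2
      thus ?thesis by (simp only:)
    next
      case 3
      thus ?thesis using that by (intro int[symmetric]) auto
    qed
  qed
  have "h x = h (1 / 2)" if "x \<in> {0..1}" for x
  proof (rule continuous_constant_on_closure[of "{0<..<1}" h])
    show "continuous_on (closure {0<..<1}) h" using cont by simp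
    show "x \<in> closure {0<..<1}" using that by simp
  qed (rule const)
  from this[OF t] this[of 0] show ?thesis by simp
qed

section \<open>Fourier coefficients of test functions\<close>

text \<open>The square of the usual bracket $\langle n\rangle$.\<close>

definition bracket :: "int \<Rightarrow> real" where
  "bracket n = 1 + (real_of_int n)\<^sup>2"

lemma bracket_ge_1: "1 \<le> bracket n" and bracket_pos: "0 < bracket n"
  by (simp_all add: bracket_def add_pos_nonneg)

lemma summable_inverse_bracket: "(\<lambda>n. 1 / bracket n) summable_on UNIV"
proof -
  have "summable (\<lambda>n. 1 / bracket (int n))"
  proof (rule summable_comparison_test')
    show "summable (\<lambda>n. inverse (real n ^ 2))" by (rule inverse_power_summable) simp
    show "norm (1 / bracket (int n)) \<le> inverse (real n ^ 2)" if "n \<ge> 1" for n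
      using that bracket_pos[of "int n"] by (simp add: bracket_def field_simps)
  qed
  hence nat: "(\<lambda>n. 1 / bracket (int n)) summable_on UNIV"
    using bracket_pos by (intro norm_summable_imp_summable_on) (simp add: less_imp_le)
  have "(\<lambda>n. 1 / bracket n) summable_on range int"
    using nat by (subst summable_on_reindex) (auto simp: o_def)
  moreover have "(\<lambda>n. 1 / bracket n) summable_on range (\<lambda>n. - int n)"
    using nat by (subst summable_on_reindex) (auto simp: o_def bracket_def inj_on_def)
  moreover have "UNIV = range int \<union> range (\<lambda>n. - int n)"
    using int_cases2 by blast
  ultimately show ?thesis using summable_on_union by metis
qed

text \<open>Dominated convergence for sums, in the case of limit zero. All limits over cutoffs, and the
  continuity in time, are reduced to it.\<close>

lemma tendsto_infsum_dominated:
  fixes f :: "'b \<Rightarrow> 'a \<Rightarrow> real"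
  assumes lim: "\<And>n. ((\<lambda>x. f x n) \<longlongrightarrow> 0) F"
    and dom: "eventually (\<lambda>x. \<forall>n. \<bar>f x n\<bar> \<le> g n) F"
    and g: "g summable_on UNIV"
  shows "((\<lambda>x. \<Sum>\<^sub>\<infinity>n. f x n) \<longlongrightarrow> 0) F"
proof (cases "F = bot")
  case False
  have g0: "0 \<le> g n" for n
    using eventually_happens[OF dom] False by (metis abs_ge_zero order_trans)
  show ?thesis
  proof (rule tendstoI)
    fix e :: real assume e: "e > 0"
    have "(sum g \<longlongrightarrow> infsum g UNIV) (finite_subsets_at_top UNIV)"
      using g has_sum_infsum has_sum_def by blast
    from tendstoD[OF this, of "e / 2"] e obtain X where X: "finite X" "dist (sum g X) (infsum g UNIV) < e / 2"
      by (auto simp: eventually_finite_subsets_at_top)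
    have "((\<lambda>x. \<Sum>n\<in>X. \<bar>f x n\<bar>) \<longlongrightarrow> (\<Sum>n\<in>X. \<bar>0\<bar>)) F"
      by (intro tendsto_intros lim)
    hence "eventually (\<lambda>x. (\<Sum>n\<in>X. \<bar>f x n\<bar>) < e / 2) F"
      using e by (intro order_tendstoD) auto
    thus "eventually (\<lambda>x. dist (\<Sum>\<^sub>\<infinity>n. f x n) 0 < e) F"
      using dom
    proof eventually_elim
      case (elim x)
      have abs: "(\<lambda>n. \<bar>f x n\<bar>) summable_on UNIV"
        by (rule summable_on_comparison_test[OF g]) (use elim in auto)
      have tail: "g summable_on (- X)" "(\<lambda>n. \<bar>f x n\<bar>) summable_on (- X)"
        using g abs summable_on_subset_banach by blast+
      have "infsum g UNIV = sum g X + infsum g (- X)"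
        using infsum_Un_disjoint[of g X "- X"] X(1) tail by (simp add: Compl_partition)
      hence "infsum g (- X) < e / 2"
        using X(2) by (simp add: dist_real_def)
      moreover have "infsum (\<lambda>n. \<bar>f x n\<bar>) (- X) \<le> infsum g (- X)"
        by (intro infsum_mono tail) (use elim in auto)
      moreover have "infsum (\<lambda>n. \<bar>f x n\<bar>) UNIV = (\<Sum>n\<in>X. \<bar>f x n\<bar>) + infsum (\<lambda>n. \<bar>f x n\<bar>) (- X)"
        using infsum_Un_disjoint[of "\<lambda>n. \<bar>f x n\<bar>" X "- X"] X(1) tail by (simp add: Compl_partition)
      moreover have "\<bar>\<Sum>\<^sub>\<infinity>n. f x n\<bar> \<le> (\<Sum>\<^sub>\<infinity>n. \<bar>f x n\<bar>)"
        using norm_infsum_bound[of "f x" UNIV] abs by simp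
      ultimately show ?case using elim(1) by (simp add: dist_real_def)
    qed
  qed
qed simp

text \<open>This is $2\pi$ times the Fourier coefficient at $-n$. The sign is that of the bilinear pairing of a
  distribution with Fourier coefficients $g_n$ and a test function, which is $\sum_n g_n$ times this.\<close>

definition fc :: "(real \<Rightarrow> complex) \<Rightarrow> int \<Rightarrow> complex" where
  "fc \<phi> n = integral {0..2 * pi} (\<lambda>x. \<phi> x * cis (of_int n * x))"

lemma fourier_coeff_fc: "fourier_coeff (fun_dist \<phi>) n = fc \<phi> (- n) / (2 * pi)"
  by (simp add: fourier_coeff_def fun_dist_def fc_def)

lemma fc_cis:
  fixes c :: complex
  shows "fc (\<lambda>x. c * cis (- (of_int m * x))) n = (if n = m then 2 * of_real pi * c else 0)"
proof -
  have "(\<lambda>x. c * cis (of_int (- m) * x)) = (\<lambda>x. c * cis (- (of_int m * x)))" by simp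
  with fourier_coeff_fc[of "\<lambda>x. c * cis (of_int (- m) * x)" "- n"] fourier_coeff_cis[of c "- m" "- n"]
  have "fc (\<lambda>x. c * cis (- (of_int m * x))) n / (2 * pi) = (if m = n then c else 0)" by simp
  thus ?thesis by (auto simp: field_simps split: if_splits)
qed

lemma fc_add:
  "continuous_on {0..2 * pi} f \<Longrightarrow> continuous_on {0..2 * pi} g \<Longrightarrow>
    fc (\<lambda>x. z * f x + w * g x) n = z * fc f n + w * fc g n"
proof -
  assume [continuous_intros]: "continuous_on {0..2 * pi} f" "continuous_on {0..2 * pi} g"
  have "fc (\<lambda>x. z * f x + w * g x) n
      = integral {0..2 * pi} (\<lambda>x. z * (f x * cis (of_int n * x)) + w * (g x * cis (of_int n * x)))"
    by (simp add: fc_def ring_distribs mult.assoc)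
  also have "\<dots> = z * fc f n + w * fc g n"
    unfolding fc_def
    by (subst Henstock_Kurzweil_Integration.integral_add)
       (auto intro!: integrable_continuous_real continuous_intros)
  finally show ?thesis .
qed

lemma norm_fc_le:
  assumes "continuous_on {0..2 * pi} f" "\<And>x. x \<in> {0..2 * pi} \<Longrightarrow> cmod (f x) \<le> B"
  shows "cmod (fc f n) \<le> 2 * pi * B"
proof -
  have "cmod (fc f n) \<le> B * (2 * pi - 0)"
    unfolding fc_def
    by (rule integral_bound) (auto intro!: continuous_intros assms simp: norm_mult)
  thus ?thesis by (simp add: mult_ac)
qed

lemma fc_dirderiv:
  assumes "\<phi> \<in> test_T"
  shows "fc (dirderiv 1 \<phi>) n = - \<i> * of_int n * fc \<phi> n"
proof -
  have sm: "smooth \<phi>" using assms by (simp add: test_T_def)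
  have "\<phi> (x + 2 * pi) = \<phi> x" for x using assms by (simp add: test_T_def)
  from this[of 0] have per: "\<phi> (2 * pi) = \<phi> 0" by simp
  note [continuous_intros] = smooth_imp_continuous[OF sm] smooth_imp_continuous[OF smooth_dirderiv[OF sm]]
  have "((\<lambda>x. \<phi> x * cis (of_int n * x)) has_vector_derivative
      \<phi> x * (\<i> * of_real (of_int n) * cis (of_int n * x)) + dirderiv 1 \<phi> x * cis (of_int n * x))
      (at x within {0..2 * pi})" for x
    by (intro has_vector_derivative_mult smooth_has_vector_derivative[OF sm] has_vector_derivative_cis)
  from fundamental_theorem_of_calculus[OF _ this]
  have "integral {0..2 * pi} (\<lambda>x. \<phi> x * (\<i> * of_real (of_int n) * cis (of_int n * x)) + dirderiv 1 \<phi> x * cis (of_int n * x)) =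
     \<phi> (2 * pi) * cis (of_int n * (2 * pi)) - \<phi> 0 * cis (of_int n * 0)"
    by (intro integral_unique) auto
  also have "cis (of_int n * (2 * pi)) = 1"
    using cis_multiple_2pi[of "of_int n"] by (simp add: mult.commute mult.left_commute)
  finally have "integral {0..2 * pi} (\<lambda>x. \<i> * of_int n * (\<phi> x * cis (of_int n * x)) + dirderiv 1 \<phi> x * cis (of_int n * x)) = 0"
    unfolding per by (simp add: mult_ac)
  also have "integral {0..2 * pi} (\<lambda>x. \<i> * of_int n * (\<phi> x * cis (of_int n * x)) + dirderiv 1 \<phi> x * cis (of_int n * x))
      = \<i> * of_int n * fc \<phi> n + fc (dirderiv 1 \<phi>) n"
    unfolding fc_def
    by (subst Henstock_Kurzweil_Integration.integral_add)
       (auto intro!: integrable_continuous_real continuous_intros)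
  finally show ?thesis by (simp add: add_eq_0_iff)
qed

lemma test_T_dirderiv_iter: "\<phi> \<in> test_T \<Longrightarrow> (dirderiv 1 ^^ k) \<phi> \<in> test_T"
  by (induction k) (auto intro: test_T_dirderiv)

lemma fc_dirderiv_iter:
  assumes "\<phi> \<in> test_T"
  shows "fc ((dirderiv 1 ^^ k) \<phi>) n = (- \<i> * of_int n) ^ k * fc \<phi> n"
  by (induction k) (simp_all add: fc_dirderiv test_T_dirderiv_iter assms)

lemma bracket_cube_le: "bracket n ^ 3 \<le> 4 * (1 + \<bar>real_of_int n\<bar> ^ 6)"
proof -
  have "(1 + y) ^ 3 \<le> 4 * (1 + y ^ 3)" if "y \<ge> 0" for y :: real
  proof -
    have "4 * (1 + y ^ 3) - (1 + y) ^ 3 = 3 * (1 + y) * (y - 1)\<^sup>2"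
      by (simp add: power3_eq_cube power2_eq_square algebra_simps)
    thus ?thesis using that by (smt (verit) mult_nonneg_nonneg zero_le_power2)
  qed
  from this[of "(real_of_int n)\<^sup>2"] show ?thesis
    by (simp add: bracket_def power_abs flip: power_mult)
qed

text \<open>Six derivatives suffice throughout: the coefficients of the distributions below grow at most like
  $n^2$, two derivatives in $x$ cost another $n^2$, and $n^{-2}$ remains for summability.\<close>

lemma decay_from_sixth_derivative:
  assumes "cmod c \<le> 2 * pi * B" "cmod ((- \<i> * of_int n) ^ 6 * c) \<le> 2 * pi * B"
  shows "cmod c \<le> 16 * pi * B / bracket n ^ 3"
proof -
  have "cmod ((- \<i> * of_int n) ^ 6 * c) = \<bar>real_of_int n\<bar> ^ 6 * cmod c"
    by (simp add: norm_mult norm_power)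
  hence "(1 + \<bar>real_of_int n\<bar> ^ 6) * cmod c \<le> 4 * pi * B"
    using assms by (simp add: ring_distribs)
  moreover have "bracket n ^ 3 * cmod c \<le> 4 * (1 + \<bar>real_of_int n\<bar> ^ 6) * cmod c"
    by (intro mult_right_mono bracket_cube_le) auto
  ultimately have "bracket n ^ 3 * cmod c \<le> 16 * pi * B" by linarith
  thus ?thesis using bracket_pos[of n] by (simp add: field_simps)
qed

lemma norm_fc_decay:
  assumes "\<phi> \<in> test_T" "\<And>x. x \<in> {0..2 * pi} \<Longrightarrow> cmod (\<phi> x) \<le> B"
    "\<And>x. x \<in> {0..2 * pi} \<Longrightarrow> cmod ((dirderiv 1 ^^ 6) \<phi> x) \<le> B"
  shows "cmod (fc \<phi> n) \<le> 16 * pi * B / bracket n ^ 3"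
proof (rule decay_from_sixth_derivative)
  have cont: "continuous_on S ((dirderiv 1 ^^ k) \<phi>)" for k S
    using test_T_dirderiv_iter[OF assms(1), of k] by (intro smooth_imp_continuous) (simp add: test_T_def)
  show "cmod (fc \<phi> n) \<le> 2 * pi * B"
    using cont[of _ 0] by (intro norm_fc_le assms) auto
  show "cmod ((- \<i> * of_int n) ^ 6 * fc \<phi> n) \<le> 2 * pi * B"
    unfolding fc_dirderiv_iter[OF assms(1), symmetric]
    by (intro norm_fc_le assms cont)
qed

lemma test_T_bounded:
  assumes "\<phi> \<in> test_T"
  shows "\<exists>B. \<forall>x\<in>{0..2 * pi}. cmod (\<phi> x) \<le> B"
proof -
  have "bounded (\<phi> ` {0..2 * pi})"
    using assms by (intro compact_imp_bounded compact_continuous_image smooth_imp_continuous) (auto simp: test_T_def)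
  thus ?thesis by (auto simp: bounded_iff)
qed

lemma test_T_decay:
  assumes "\<phi> \<in> test_T"
  shows "\<exists>B\<ge>0. \<forall>n. cmod (fc \<phi> n) \<le> B / bracket n ^ 3"
proof -
  obtain B1 B2 where B: "\<forall>x\<in>{0..2 * pi}. cmod (\<phi> x) \<le> B1" "\<forall>x\<in>{0..2 * pi}. cmod ((dirderiv 1 ^^ 6) \<phi> x) \<le> B2"
    using test_T_bounded[OF assms] test_T_bounded[OF test_T_dirderiv_iter[OF assms, of 6]] by blast
  define B where "B = max 0 (max B1 B2)"
  have "cmod (fc \<phi> n) \<le> 16 * pi * B / bracket n ^ 3" for n
    using B by (intro norm_fc_decay assms) (fastforce simp: B_def)+
  thus ?thesis by (intro exI[of _ "16 * pi * B"]) (auto simp: B_def)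
qed

lemma smooth_slice:
  assumes "smooth f"
  shows "smooth (\<lambda>x. f (t, x))"
proof (rule smooth_coinduct)
  let ?S = "(\<lambda>f. \<lambda>x. f (t, x)) ` {f. smooth f}"
  show "(\<lambda>x. f (t, x)) \<in> ?S" using assms by blast
  have d: "((\<lambda>x. f (t, x)) has_derivative (\<lambda>h. dirderiv (0, h) f (t, x))) (at x)" if "smooth f" for f x
    by (rule has_derivative_compose[OF _ smooth_has_derivative[OF that]])
       (auto intro!: derivative_eq_intros)
  show "g differentiable at p" if "g \<in> ?S" for g p
    using that d unfolding differentiable_def by blast
  show "dirderiv v g \<in> ?S" if "g \<in> ?S" for g v
  proof -
    from that obtain f where f: "smooth f" and g: "g = (\<lambda>x. f (t, x))" by blast
    have "dirderiv v g = (\<lambda>x. dirderiv (0, v) f (t, x))"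
      unfolding g using dirderiv_eqI[OF d[OF f]] by (simp add: fun_eq_iff)
    thus ?thesis using smooth_dirderiv[OF f, of "(0, v)"] by blast
  qed
qed

lemma test_ST_slice:
  assumes "\<phi> \<in> test_ST"
  shows "(\<lambda>x. \<phi> (t, x)) \<in> test_T"
  using assms smooth_slice by (auto simp: test_ST_def test_T_def)

lemma dirderiv_slice:
  assumes "\<phi> \<in> test_ST"
  shows "dirderiv 1 (\<lambda>x. \<phi> (t, x)) = (\<lambda>x. dx \<phi> (t, x))"
proof
  fix x
  have "smooth \<phi>" using assms by (simp add: test_ST_def)
  from dirderiv_real_eqI[OF smooth_partial_dx[OF this], of 1 t x]
  show "dirderiv 1 (\<lambda>x. \<phi> (t, x)) x = dx \<phi> (t, x)" by simp
qed

lemma test_ST_dx_iter: "\<phi> \<in> test_ST \<Longrightarrow> (dx ^^ k) \<phi> \<in> test_ST"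
  by (induction k) (auto intro: test_ST_dx)

lemma dirderiv_slice_iter:
  assumes "\<phi> \<in> test_ST"
  shows "(dirderiv 1 ^^ k) (\<lambda>x. \<phi> (t, x)) = (\<lambda>x. (dx ^^ k) \<phi> (t, x))"
  by (induction k) (simp_all add: dirderiv_slice test_ST_dx_iter assms)

definition slice_fc :: "(real \<times> real \<Rightarrow> complex) \<Rightarrow> real \<Rightarrow> int \<Rightarrow> complex" where
  "slice_fc \<Phi> t n = fc (\<lambda>x. \<Phi> (t, x)) n"

lemma slice_fc_dx_iter:
  assumes "\<phi> \<in> test_ST"
  shows "slice_fc ((dx ^^ k) \<phi>) t n = (- \<i> * of_int n) ^ k * slice_fc \<phi> t n"
  using fc_dirderiv_iter[OF test_ST_slice[OF assms], of k t n]
  by (simp add: slice_fc_def dirderiv_slice_iter assms)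

lemma slice_fc_derivative:
  assumes "\<phi> \<in> test_ST"
  shows "((\<lambda>t. slice_fc \<phi> t n) has_vector_derivative slice_fc (dt \<phi>) t n) (at t)"
proof -
  have sm: "smooth \<phi>" "smooth (dt \<phi>)" using assms test_ST_dt[OF assms] by (auto simp: test_ST_def)
  note [continuous_intros] = continuous_on_compose2[OF smooth_imp_continuous[OF sm(1), of UNIV]]
     continuous_on_compose2[OF smooth_imp_continuous[OF sm(2), of UNIV]]
  have "((\<lambda>t. integral (cbox 0 (2 * pi)) (\<lambda>x. \<phi> (t, x) * cis (of_int n * x))) has_vector_derivative
      integral (cbox 0 (2 * pi)) (\<lambda>x. dt \<phi> (t, x) * cis (of_int n * x))) (at t within UNIV)"
  proof (rule leibniz_rule_vector_derivative)
    show "((\<lambda>t. \<phi> (t, x) * cis (of_int n * x)) has_vector_derivative dt \<phi> (t, x) * cis (of_int n * x))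
        (at t within UNIV)" for t x
      by (rule has_vector_derivative_mult_left[OF smooth_partial_dt[OF sm(1)]])
    show "(\<lambda>x. \<phi> (t, x) * cis (of_int n * x)) integrable_on cbox 0 (2 * pi)" for t
      by (intro integrable_continuous continuous_intros) auto
    show "continuous_on (UNIV \<times> cbox 0 (2 * pi)) (\<lambda>(t, x). dt \<phi> (t, x) * cis (of_int n * x))"
      unfolding case_prod_unfold by (intro continuous_intros) auto
  qed auto
  thus ?thesis by (simp add: slice_fc_def fc_def)
qed

text \<open>Differentiating \<open>slice_fc_dx_iter\<close> in time yields decay in terms of the derivatives
  $\partial_t\partial_x^k\varphi$, in the order in which the convergence of test functions controls them.\<close>

lemma slice_fc_dt_dx_iter:
  assumes "\<phi> \<in> test_ST"
  shows "slice_fc (dt ((dx ^^ k) \<phi>)) t n = (- \<i> * of_int n) ^ k * slice_fc (dt \<phi>) t n"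
proof -
  have "((\<lambda>t. slice_fc ((dx ^^ k) \<phi>) t n) has_vector_derivative (- \<i> * of_int n) ^ k * slice_fc (dt \<phi>) t n) (at t)"
    unfolding slice_fc_dx_iter[OF assms]
    by (rule has_vector_derivative_mult_right[OF slice_fc_derivative[OF assms]])
  from vector_derivative_unique_at[OF slice_fc_derivative[OF test_ST_dx_iter[OF assms]] this]
  show ?thesis .
qed

section \<open>Curves of distributions with given Fourier coefficients\<close>

definition trig_dist :: "(int \<Rightarrow> complex) \<Rightarrow> dist_T" where
  "trig_dist g \<phi> = (\<Sum>\<^sub>\<infinity>n. g n * fc \<phi> n)"

lemma trig_term_bound:
  assumes "cmod z \<le> K * bracket n" "cmod c \<le> B / bracket n ^ 2"
  shows "cmod (z * c) \<le> K * B * (1 / bracket n)"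
proof -
  have "cmod (z * c) \<le> (K * bracket n) * (B / bracket n ^ 2)"
    unfolding norm_mult using assms by (intro mult_mono order_trans[OF norm_ge_zero assms(1)]) auto
  also have "\<dots> = K * B * (1 / bracket n)"
    using bracket_pos[of n] by (simp add: power2_eq_square)
  finally show ?thesis .
qed

lemma trig_summable:
  assumes "\<And>n. cmod (z n) \<le> K * bracket n" "\<And>n. cmod (c n) \<le> B / bracket n ^ 2"
  shows "(\<lambda>n. cmod (z n * c n)) summable_on UNIV" "(\<lambda>n. z n * c n) summable_on UNIV"
proof -
  show *: "(\<lambda>n. cmod (z n * c n)) summable_on UNIV"
    by (rule summable_on_comparison_test[OF summable_on_cmult_right[OF summable_inverse_bracket, of "K * B"]])
       (use trig_term_bound[OF assms] in auto)
  show "(\<lambda>n. z n * c n) summable_on UNIV"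
    using * by (rule abs_summable_summable)
qed

lemma trig_infsum_bound:
  assumes "\<And>n. cmod (z n) \<le> K * bracket n" "\<And>n. cmod (c n) \<le> B / bracket n ^ 2"
  shows "cmod (\<Sum>\<^sub>\<infinity>n. z n * c n) \<le> K * B * (\<Sum>\<^sub>\<infinity>n. 1 / bracket n)"
proof -
  have "cmod (\<Sum>\<^sub>\<infinity>n. z n * c n) \<le> (\<Sum>\<^sub>\<infinity>n. cmod (z n * c n))"
    by (rule norm_infsum_bound[OF trig_summable(1)[OF assms]])
  also have "\<dots> \<le> (\<Sum>\<^sub>\<infinity>n. K * B * (1 / bracket n))"
    by (intro infsum_mono trig_summable(1)[OF assms] summable_on_cmult_right summable_inverse_bracket
        trig_term_bound assms)
  also have "\<dots> = K * B * (\<Sum>\<^sub>\<infinity>n. 1 / bracket n)"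
    by (rule infsum_cmult_right) (simp add: summable_inverse_bracket)
  finally show ?thesis .
qed

lemma bracket_cube_square: "0 \<le> B \<Longrightarrow> B / bracket n ^ 3 \<le> B / bracket n ^ 2"
  using bracket_ge_1[of n] by (intro divide_left_mono power_increasing mult_pos_pos) auto

lemma infsum_lincomb:
  fixes f g :: "int \<Rightarrow> complex"
  assumes "f summable_on UNIV" "g summable_on UNIV"
  shows "(\<Sum>\<^sub>\<infinity>n. a * f n + b * g n) = a * (\<Sum>\<^sub>\<infinity>n. f n) + b * (\<Sum>\<^sub>\<infinity>n. g n)"
  using assms by (simp add: infsum_add summable_on_cmult_right infsum_cmult_right)

lemma fc_diff_decay:
  assumes "\<phi> \<in> test_T" "\<psi> \<in> test_T"
    and "\<And>x. cmod (\<phi> x - \<psi> x) \<le> e"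
    and "\<And>x. cmod ((dirderiv 1 ^^ 6) \<phi> x - (dirderiv 1 ^^ 6) \<psi> x) \<le> e"
  shows "cmod (fc \<phi> n - fc \<psi> n) \<le> 16 * pi * e / bracket n ^ 3"
proof (rule decay_from_sixth_derivative)
  have cont: "continuous_on S ((dirderiv 1 ^^ k) f)" if "f \<in> test_T" for k S f
    using test_T_dirderiv_iter[OF that, of k] by (intro smooth_imp_continuous) (simp add: test_T_def)
  have diff: "fc f n - fc g n = fc (\<lambda>x. 1 * f x + (-1) * g x) n"
    if "continuous_on {0..2 * pi} f" "continuous_on {0..2 * pi} g" for f g
    by (simp only: fc_add[OF that]) simp
  show "cmod (fc \<phi> n - fc \<psi> n) \<le> 2 * pi * e"
    using cont[OF assms(1), of _ 0] cont[OF assms(2), of _ 0] assms(3)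
    by (subst diff) (auto intro!: norm_fc_le continuous_intros)
  have "(- \<i> * of_int n) ^ 6 * (fc \<phi> n - fc \<psi> n) = fc ((dirderiv 1 ^^ 6) \<phi>) n - fc ((dirderiv 1 ^^ 6) \<psi>) n"
    by (simp only: fc_dirderiv_iter assms right_diff_distrib)
  thus "cmod ((- \<i> * of_int n) ^ 6 * (fc \<phi> n - fc \<psi> n)) \<le> 2 * pi * e"
    using cont[OF assms(1), of _ 6] cont[OF assms(2), of _ 6] assms(4)
    by (simp only:, subst diff) (auto intro!: norm_fc_le continuous_intros)
qed

lemma test_T_decay2:
  assumes "\<phi> \<in> test_T"
  shows "\<exists>B. \<forall>n. cmod (fc \<phi> n) \<le> B / bracket n ^ 2"
  using test_T_decay[OF assms] bracket_cube_square by (meson order_trans)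

lemma distribution_T_trig_dist:
  assumes g: "\<And>n. cmod (g n) \<le> K * bracket n"
  shows "distribution_T (trig_dist g)"
  unfolding distribution_T_def
proof (intro conjI ballI allI impI)
  fix \<phi> \<psi> :: "real \<Rightarrow> complex" and a b assume \<phi>\<psi>: "\<phi> \<in> test_T" "\<psi> \<in> test_T"
  obtain B1 B2 where "\<And>n. cmod (fc \<phi> n) \<le> B1 / bracket n ^ 2" "\<And>n. cmod (fc \<psi> n) \<le> B2 / bracket n ^ 2"
    using test_T_decay2[OF \<phi>\<psi>(1)] test_T_decay2[OF \<phi>\<psi>(2)] by blast
  note s = trig_summable(2)[OF g this(1)] trig_summable(2)[OF g this(2)]
  have "fc (\<lambda>x. a * \<phi> x + b * \<psi> x) n = a * fc \<phi> n + b * fc \<psi> n" for n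
    using \<phi>\<psi> by (intro fc_add smooth_imp_continuous) (auto simp: test_T_def)
  thus "trig_dist g (\<lambda>x. a * \<phi> x + b * \<psi> x) = a * trig_dist g \<phi> + b * trig_dist g \<psi>"
    using infsum_lincomb[OF s, of a b] by (simp add: trig_dist_def algebra_simps)
next
  fix \<Phi> \<phi> assume *: "(\<forall>i. \<Phi> i \<in> test_T) \<and> \<phi> \<in> test_T \<and> test_T_tendsto \<Phi> \<phi>"
  hence T: "\<And>i. \<Phi> i \<in> test_T" "\<phi> \<in> test_T"
    and lim: "\<And>k. uniform_limit UNIV (\<lambda>i. (dirderiv 1 ^^ k) (\<Phi> i)) ((dirderiv 1 ^^ k) \<phi>) sequentially"
    by (auto simp: test_T_tendsto_def)
  have K: "0 \<le> K" using order_trans[OF norm_ge_zero g[of 0]] by (simp add: bracket_def)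
  define S where "S = (\<Sum>\<^sub>\<infinity>n. 1 / bracket n)"
  have S: "0 \<le> S" unfolding S_def by (intro infsum_nonneg) (use bracket_pos in \<open>simp add: less_imp_le\<close>)
  obtain B where B: "\<And>n. cmod (fc \<phi> n) \<le> B / bracket n ^ 2" using test_T_decay2[OF T(2)] by blast
  show "(\<lambda>i. trig_dist g (\<Phi> i)) \<longlonglongrightarrow> trig_dist g \<phi>"
  proof (rule tendstoI)
    fix e :: real assume e: "e > 0"
    define d where "d = e / (16 * pi * K * S + 1)"
    have pos: "16 * pi * K * S + 1 > 0" using K S by (simp add: add_nonneg_pos)
    hence d: "d > 0" using e by (simp add: d_def)
    from uniform_limitD[OF lim[of 0] d] uniform_limitD[OF lim[of 6] d]
    show "eventually (\<lambda>i. dist (trig_dist g (\<Phi> i)) (trig_dist g \<phi>) < e) sequentially"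
    proof eventually_elim
      case (elim i)
      obtain B' where B': "\<And>n. cmod (fc (\<Phi> i) n) \<le> B' / bracket n ^ 2"
        using test_T_decay2[OF T(1)] by blast
      have "cmod (fc (\<Phi> i) n - fc \<phi> n) \<le> 16 * pi * d / bracket n ^ 3" for n
        using elim by (intro fc_diff_decay T) (auto simp: dist_norm less_imp_le)
      hence bd: "cmod (fc (\<Phi> i) n - fc \<phi> n) \<le> 16 * pi * d / bracket n ^ 2" for n
        using bracket_cube_square[of "16 * pi * d" n] d by (meson order_trans less_imp_le mult_nonneg_nonneg pi_ge_zero zero_le_numeral)
      have "trig_dist g (\<Phi> i) - trig_dist g \<phi> = (\<Sum>\<^sub>\<infinity>n. g n * (fc (\<Phi> i) n - fc \<phi> n))"
        using infsum_lincomb[OF trig_summable(2)[OF g B'] trig_summable(2)[OF g B], of 1 "-1"]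
        by (simp add: trig_dist_def algebra_simps)
      also have "cmod \<dots> \<le> K * (16 * pi * d) * S"
        unfolding S_def by (rule trig_infsum_bound[OF g bd])
      also have "\<dots> = (16 * pi * K * S) * d" by simp
      also have "\<dots> < (16 * pi * K * S + 1) * d" using d by (simp add: ring_distribs)
      also have "\<dots> = e" using pos by (simp add: d_def)
      finally show ?case by (simp add: dist_norm)
    qed
  qed
qed

lemma fourier_coeff_trig_dist: "fourier_coeff (trig_dist g) n = g n"
proof -
  have "fc (\<lambda>x. cis (- (of_int n * x))) k = (if k = n then 2 * of_real pi else 0)" for k
    using fc_cis[of 1 n k] by (simp split: if_splits)
  hence "trig_dist g (\<lambda>x. cis (- (of_int n * x))) = (\<Sum>\<^sub>\<infinity>k. g k * (if k = n then 2 * of_real pi else 0))"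
    by (simp add: trig_dist_def)
  also have "\<dots> = (\<Sum>\<^sub>\<infinity>k\<in>{n}. g k * (if k = n then 2 * of_real pi else 0))"
    by (rule infsum_cong_neutral) auto
  finally show ?thesis by (simp add: fourier_coeff_def)
qed

lemma weight_square: "(weight s n)\<^sup>2 = (1 + (real_of_int n)\<^sup>2) powr s"
  using powr_add[of "1 + (real_of_int n)\<^sup>2" "s / 2" "s / 2"] by (simp add: weight_def power2_eq_square)

lemma sobolev_term_eq: "sobolev_term s f n = (weight s n * cmod (fourier_coeff f n))\<^sup>2"
  by (simp add: sobolev_term_def power_mult_distrib weight_square mult.commute)

lemma summable_on_square:
  fixes f :: "'a \<Rightarrow> real"
  assumes "f summable_on UNIV" "\<And>n. 0 \<le> f n"
  shows "(\<lambda>n. (f n)\<^sup>2) summable_on UNIV"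
proof (rule summable_on_comparison_test[OF summable_on_cmult_right[OF assms(1), of "infsum f UNIV"]])
  fix n
  have "f n = sum f {n}" by simp
  also have "\<dots> \<le> infsum f UNIV" by (rule finite_sum_le_infsum) (use assms in auto)
  finally show "(f n)\<^sup>2 \<le> infsum f UNIV * f n"
    using mult_right_mono[OF _ assms(2)] by (simp add: power2_eq_square)
qed (auto)

text \<open>The $\ell^1$ condition on $D$ is stronger than membership in $H^s$ uniformly in time. The
  polynomial growth makes the pairing with test functions converge absolutely.\<close>

definition controlled :: "real \<Rightarrow> (int \<Rightarrow> real) \<Rightarrow> (real \<Rightarrow> int \<Rightarrow> complex) \<Rightarrow> bool" where
  "controlled s D g \<longleftrightarrow> (\<forall>n. continuous_on {0..1} (\<lambda>t. g t n)) \<and>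
     (\<forall>t\<in>{0..1}. \<forall>n. cmod (g t n) \<le> D n) \<and>
     (\<lambda>n. weight s n * D n) summable_on UNIV \<and> (\<exists>K. \<forall>n. D n \<le> K * bracket n)"

lemma controlled_nonneg: "controlled s D g \<Longrightarrow> 0 \<le> D n"
  unfolding controlled_def by (meson atLeastAtMost_iff norm_ge_zero order_refl order_trans zero_le_one)

lemma controlled_bound: "controlled s D g \<Longrightarrow> \<exists>K. \<forall>t\<in>{0..1}. \<forall>n. cmod (g t n) \<le> K * bracket n"
  unfolding controlled_def by (meson order_trans)

text \<open>For a cutoff sequence, $e$ will be the error at each frequency; for continuity in time, the
  increment of each coefficient.\<close>

lemma sobolev_norm_le_tends:
  assumes "\<And>n. ((\<lambda>x. e x n) \<longlongrightarrow> 0) F"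
    and "eventually (\<lambda>x. \<forall>n. \<bar>e x n\<bar> \<le> D n) F"
    and "(\<lambda>n. weight s n * D n) summable_on UNIV" "\<And>n. 0 \<le> D n"
  shows "((\<lambda>x. sqrt (\<Sum>\<^sub>\<infinity>n. (weight s n * e x n)\<^sup>2)) \<longlongrightarrow> 0) F"
proof -
  have "((\<lambda>x. \<Sum>\<^sub>\<infinity>n. (weight s n * e x n)\<^sup>2) \<longlongrightarrow> 0) F"
  proof (rule tendsto_infsum_dominated)
    show "((\<lambda>x. (weight s n * e x n)\<^sup>2) \<longlongrightarrow> 0) F" for n
      using tendsto_power[OF tendsto_mult[OF tendsto_const assms(1)], of "weight s n" n 2] by simp
    show "(\<lambda>n. (weight s n * D n)\<^sup>2) summable_on UNIV"
      using assms weight_pos by (intro summable_on_square) (auto simp: less_imp_le)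
    show "eventually (\<lambda>x. \<forall>n. \<bar>(weight s n * e x n)\<^sup>2\<bar> \<le> (weight s n * D n)\<^sup>2) F"
      using assms(2)
    proof eventually_elim
      case (elim x)
      show ?case
      proof
        fix n
        have "\<bar>weight s n * e x n\<bar> \<le> weight s n * D n"
          using elim weight_pos[of s n] by (simp add: abs_mult)
        hence "\<bar>weight s n * e x n\<bar>\<^sup>2 \<le> (weight s n * D n)\<^sup>2" by (intro power_mono) auto
        thus "\<bar>(weight s n * e x n)\<^sup>2\<bar> \<le> (weight s n * D n)\<^sup>2" by simp
      qed
    qed
  qed
  from tendsto_real_sqrt[OF this] show ?thesis by simp
qed

lemma controlled_sobolev:
  assumes "controlled s D g" "t \<in> {0..1}"
  shows "trig_dist (g t) \<in> sobolev s"
proof -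
  obtain K where K: "\<And>n. cmod (g t n) \<le> K * bracket n"
    using controlled_bound[OF assms(1)] assms(2) by blast
  have D: "cmod (g t n) \<le> D n" for n using assms by (auto simp: controlled_def)
  have "(\<lambda>n. (weight s n * D n)\<^sup>2) summable_on UNIV"
    using assms(1) controlled_nonneg[OF assms(1)] weight_pos
    by (intro summable_on_square) (auto simp: controlled_def less_imp_le)
  hence "sobolev_term s (trig_dist (g t)) summable_on UNIV"
    by (rule summable_on_comparison_test)
       (use D weight_pos in \<open>auto simp: sobolev_term_eq fourier_coeff_trig_dist less_imp_le intro!: power_mono mult_left_mono\<close>)
  thus ?thesis using distribution_T_trig_dist[OF K] by (simp add: sobolev_def)
qed

lemma controlled_C0_sobolev:
  assumes "controlled s D g"
  shows "(\<lambda>t. trig_dist (g t)) \<in> C0_sobolev s"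
proof -
  have "((\<lambda>\<tau>. sobolev_norm s (\<lambda>\<phi>. trig_dist (g \<tau>) \<phi> - trig_dist (g t) \<phi>)) \<longlongrightarrow> 0) (at t within {0..1})"
    if t: "t \<in> {0..1}" for t
  proof -
    have co: "fourier_coeff (\<lambda>\<phi>. trig_dist (g \<tau>) \<phi> - trig_dist (g t) \<phi>) n = g \<tau> n - g t n" for \<tau> n
      using fourier_coeff_trig_dist[of "g \<tau>" n] fourier_coeff_trig_dist[of "g t" n]
      by (simp add: fourier_coeff_def diff_divide_distrib)
    have "((\<lambda>\<tau>. sqrt (\<Sum>\<^sub>\<infinity>n. (weight s n * cmod (g \<tau> n - g t n))\<^sup>2)) \<longlongrightarrow> 0) (at t within {0..1})"
    proof (rule sobolev_norm_le_tends[where D = "\<lambda>n. 2 * D n"])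
      show "((\<lambda>\<tau>. cmod (g \<tau> n - g t n)) \<longlongrightarrow> 0) (at t within {0..1})" for n
      proof -
        have "((\<lambda>\<tau>. g \<tau> n) \<longlongrightarrow> g t n) (at t within {0..1})"
          using assms t by (auto simp: controlled_def continuous_on_def)
        thus ?thesis by (intro tendsto_norm_zero) (simp add: LIM_zero)
      qed
      show "eventually (\<lambda>\<tau>. \<forall>n. \<bar>cmod (g \<tau> n - g t n)\<bar> \<le> 2 * D n) (at t within {0..1})"
      proof -
        have "\<bar>cmod (g \<tau> n - g t n)\<bar> \<le> 2 * D n" if "\<tau> \<in> {0..1}" for \<tau> n
        proof -
          have "cmod (g \<tau> n) \<le> D n" "cmod (g t n) \<le> D n" using assms t that by (auto simp: controlled_def)
          thus ?thesis using norm_triangle_ineq4[of "g \<tau> n" "g t n"] by simp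
        qed
        thus ?thesis by (auto simp: eventually_at_filter)
      qed
      show "(\<lambda>n. weight s n * (2 * D n)) summable_on UNIV"
        using assms summable_on_cmult_right[of "\<lambda>n. weight s n * D n" UNIV 2]
        by (simp add: controlled_def mult_ac)
    qed (use controlled_nonneg[OF assms] in simp)
    thus ?thesis by (simp add: sobolev_norm_def sobolev_term_eq co)
  qed
  thus ?thesis using controlled_sobolev[OF assms] by (simp add: C0_sobolev_def)
qed

section \<open>Space-time distributions with given Fourier coefficients\<close>

lemma dirderiv_lincomb:
  assumes "smooth \<phi>" "smooth \<psi>"
  shows "dirderiv v (\<lambda>p. a * \<phi> p + b * \<psi> p) = (\<lambda>p. a * dirderiv v \<phi> p + b * dirderiv v \<psi> p)"
proof
  fix p
  have "((\<lambda>p. a * \<phi> p + b * \<psi> p) has_derivative (\<lambda>v. a * dirderiv v \<phi> p + b * dirderiv v \<psi> p)) (at p)"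
    by (intro has_derivative_add has_derivative_mult_right smooth_has_derivative assms)
  from dirderiv_eqI[OF this]
  show "dirderiv v (\<lambda>p. a * \<phi> p + b * \<psi> p) p = a * dirderiv v \<phi> p + b * dirderiv v \<psi> p" .
qed

lemma smooth_lincomb:
  assumes "smooth \<phi>" "smooth \<psi>"
  shows "smooth (\<lambda>p. a * \<phi> p + b * \<psi> p)"
proof (rule smooth_coinduct)
  let ?S = "{\<lambda>p. a * \<phi> p + b * \<psi> p | \<phi> \<psi>. smooth \<phi> \<and> smooth \<psi>}"
  show "(\<lambda>p. a * \<phi> p + b * \<psi> p) \<in> ?S" using assms by blast
  show "g differentiable at p" if "g \<in> ?S" for g p
  proof -
    from that obtain \<phi> \<psi> where "smooth \<phi>" "smooth \<psi>" and g: "g = (\<lambda>p. a * \<phi> p + b * \<psi> p)" by blast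
    hence "(g has_derivative (\<lambda>v. a * dirderiv v \<phi> p + b * dirderiv v \<psi> p)) (at p)"
      unfolding g by (intro has_derivative_add has_derivative_mult_right smooth_has_derivative)
    thus ?thesis unfolding differentiable_def by blast
  qed
  show "dirderiv v g \<in> ?S" if "g \<in> ?S" for g v
  proof -
    from that obtain \<phi> \<psi> where *: "smooth \<phi>" "smooth \<psi>" and g: "g = (\<lambda>p. a * \<phi> p + b * \<psi> p)" by blast
    show ?thesis unfolding g dirderiv_lincomb[OF *]
      using smooth_dirderiv[OF *(1), of v] smooth_dirderiv[OF *(2), of v] by blast
  qed
qed

lemma test_ST_lincomb:
  assumes "\<phi> \<in> test_ST" "\<psi> \<in> test_ST"
  shows "(\<lambda>p. a * \<phi> p + b * \<psi> p) \<in> test_ST"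
proof -
  from assms obtain a1 b1 a2 b2 where *: "0 < a1" "b1 < 1" "supp_in a1 b1 \<phi>" "0 < a2" "b2 < 1" "supp_in a2 b2 \<psi>"
    by (auto simp: test_ST_def)
  have "supp_in (min a1 a2) (max b1 b2) (\<lambda>p. a * \<phi> p + b * \<psi> p)"
    unfolding supp_in_def
  proof (intro allI impI)
    fix t x assume "a * \<phi> (t, x) + b * \<psi> (t, x) \<noteq> 0"
    hence "\<phi> (t, x) \<noteq> 0 \<or> \<psi> (t, x) \<noteq> 0" by auto
    thus "min a1 a2 \<le> t \<and> t \<le> max b1 b2"
      using *(3,6) by (auto simp: supp_in_def min_le_iff_disj le_max_iff_disj)
  qed
  moreover have "0 < min a1 a2" "max b1 b2 < 1" using * by auto
  ultimately have "\<exists>a' b'. 0 < a' \<and> b' < 1 \<and> supp_in a' b' (\<lambda>p. a * \<phi> p + b * \<psi> p)" by blast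
  thus ?thesis using assms smooth_lincomb by (auto simp: test_ST_def)
qed

lemma distribution_ST_cong:
  assumes "distribution_ST F" "\<And>\<phi>. \<phi> \<in> test_ST \<Longrightarrow> G \<phi> = F \<phi>"
  shows "distribution_ST G"
  using assms(1) unfolding distribution_ST_def
  by (simp add: assms(2) test_ST_lincomb)

lemma test_ST_smooth: "\<phi> \<in> test_ST \<Longrightarrow> smooth \<phi>"
  by (simp add: test_ST_def)

lemma slice_continuous: "smooth f \<Longrightarrow> continuous_on S (\<lambda>x. f (t, x))"
  by (rule smooth_imp_continuous[OF smooth_slice])

lemma slice_fc_lincomb:
  assumes "smooth \<phi>" "smooth \<psi>"
  shows "slice_fc (\<lambda>p. a * \<phi> p + b * \<psi> p) t n = a * slice_fc \<phi> t n + b * slice_fc \<psi> t n"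
  unfolding slice_fc_def by (rule fc_add) (intro slice_continuous assms)+

lemma slice_fc_diff_le:
  assumes "smooth f" "smooth g" "\<And>p. cmod (f p - g p) \<le> e"
  shows "cmod (slice_fc f t n - slice_fc g t n) \<le> 2 * pi * e"
proof -
  have "slice_fc f t n - slice_fc g t n = slice_fc (\<lambda>p. 1 * f p + (-1) * g p) t n"
    by (simp only: slice_fc_lincomb[OF assms(1,2)]) simp
  also have "cmod \<dots> \<le> 2 * pi * e"
    unfolding slice_fc_def
    by (rule norm_fc_le[OF slice_continuous[OF smooth_lincomb[OF assms(1,2)]]]) (use assms(3) in simp)
  finally show ?thesis .
qed

lemma test_ST_bounded:
  assumes "\<phi> \<in> test_ST"
  shows "\<exists>B\<ge>0. \<forall>t\<in>{0..1}. \<forall>n. cmod (slice_fc \<phi> t n) \<le> 2 * pi * B"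
proof -
  have "bounded (\<phi> ` ({0..1} \<times> {0..2 * pi}))"
    using assms
    by (intro compact_imp_bounded compact_continuous_image smooth_imp_continuous compact_Times compact_Icc)
       (auto simp: test_ST_def)
  then obtain B where "\<forall>p\<in>{0..1} \<times> {0..2 * pi}. cmod (\<phi> p) \<le> B"
    unfolding bounded_iff by blast
  hence B: "cmod (\<phi> (t, x)) \<le> B" if "t \<in> {0..1}" "x \<in> {0..2 * pi}" for t x
    using that by blast
  have "0 \<le> B" using order_trans[OF norm_ge_zero B[of 0 0]] by simp
  moreover have "cmod (slice_fc \<phi> t n) \<le> 2 * pi * B" if "t \<in> {0..1}" for t n
    unfolding slice_fc_def
    by (rule norm_fc_le) (use that B test_ST_smooth[OF assms] in \<open>auto intro: slice_continuous\<close>)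
  ultimately show ?thesis by blast
qed

lemma slice_fc_decay:
  assumes "\<phi> \<in> test_ST"
  shows "\<exists>B\<ge>0. \<forall>t\<in>{0..1}. \<forall>n. cmod (slice_fc \<phi> t n) \<le> B / bracket n ^ 3"
    and "\<exists>B\<ge>0. \<forall>t\<in>{0..1}. \<forall>n. cmod (slice_fc (dt \<phi>) t n) \<le> B / bracket n ^ 3"
proof -
  have *: "\<exists>B\<ge>0. \<forall>t\<in>{0..1}. \<forall>n. cmod (slice_fc f t n) \<le> B / bracket n ^ 3"
    if f: "f \<in> test_ST" "g \<in> test_ST" and fg: "\<And>t n. slice_fc g t n = (- \<i> * of_int n) ^ 6 * slice_fc f t n" for f g
  proof -
    obtain B1 B2 where B: "B1 \<ge> 0" "\<forall>t\<in>{0..1}. \<forall>n. cmod (slice_fc f t n) \<le> 2 * pi * B1"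
       "B2 \<ge> 0" "\<forall>t\<in>{0..1}. \<forall>n. cmod (slice_fc g t n) \<le> 2 * pi * B2"
      using test_ST_bounded[OF f(1)] test_ST_bounded[OF f(2)] by blast
    have "cmod (slice_fc f t n) \<le> 16 * pi * (B1 + B2) / bracket n ^ 3" if t: "t \<in> {0..1}" for t n
    proof (rule decay_from_sixth_derivative)
      have "2 * pi * B1 \<le> 2 * pi * (B1 + B2)" "2 * pi * B2 \<le> 2 * pi * (B1 + B2)" using B by auto
      thus "cmod (slice_fc f t n) \<le> 2 * pi * (B1 + B2)" "cmod ((- \<i> * of_int n) ^ 6 * slice_fc f t n) \<le> 2 * pi * (B1 + B2)"
        using B t unfolding fg[symmetric] by (meson order_trans)+
    qed
    thus ?thesis using B by (intro exI[of _ "16 * pi * (B1 + B2)"]) auto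
  qed
  show "\<exists>B\<ge>0. \<forall>t\<in>{0..1}. \<forall>n. cmod (slice_fc \<phi> t n) \<le> B / bracket n ^ 3"
    using assms test_ST_dx_iter[OF assms, of 6] slice_fc_dx_iter[OF assms] by (rule *)
  show "\<exists>B\<ge>0. \<forall>t\<in>{0..1}. \<forall>n. cmod (slice_fc (dt \<phi>) t n) \<le> B / bracket n ^ 3"
    using test_ST_dt[OF assms] test_ST_dt[OF test_ST_dx_iter[OF assms, of 6]] slice_fc_dt_dx_iter[OF assms] by (rule *)
qed

lemma slice_fc_continuous: "\<phi> \<in> test_ST \<Longrightarrow> continuous_on S (\<lambda>t. slice_fc \<phi> t n)"
  using slice_fc_derivative
  by (intro continuous_on_vector_derivative[of S _ "\<lambda>t. slice_fc (dt \<phi>) t n"]) (auto intro: has_vector_derivative_at_within)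

text \<open>The Fourier coefficients of $\partial_t\varphi$ and of $\partial_x^2\varphi$ have these properties in
  common, and they make any pairing with coefficients of polynomial growth a distribution.\<close>

definition tame :: "((real \<times> real \<Rightarrow> complex) \<Rightarrow> real \<Rightarrow> int \<Rightarrow> complex) \<Rightarrow> bool" where
  "tame c \<longleftrightarrow>
    (\<forall>\<phi>\<in>test_ST. \<forall>\<psi>\<in>test_ST. \<forall>a b t n. c (\<lambda>p. a * \<phi> p + b * \<psi> p) t n = a * c \<phi> t n + b * c \<psi> t n) \<and>
    (\<forall>\<phi>\<in>test_ST. \<forall>n. continuous_on {0..1} (\<lambda>t. c \<phi> t n)) \<and>
    (\<forall>\<phi>\<in>test_ST. \<exists>B. \<forall>t\<in>{0..1}. \<forall>n. cmod (c \<phi> t n) \<le> B / bracket n ^ 2) \<and>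
    (\<forall>\<Phi> \<phi>. (\<forall>i. \<Phi> i \<in> test_ST) \<longrightarrow> \<phi> \<in> test_ST \<longrightarrow> test_ST_tendsto \<Phi> \<phi> \<longrightarrow>
      (\<forall>e>0. \<forall>\<^sub>F i in sequentially. \<forall>t\<in>{0..1}. \<forall>n. cmod (c (\<Phi> i) t n - c \<phi> t n) \<le> e / bracket n ^ 2))"

lemma test_ST_tendstoD:
  assumes "test_ST_tendsto \<Phi> \<phi>" "e > 0"
  shows "eventually (\<lambda>i. \<forall>p. cmod ((dt ^^ j) ((dx ^^ k) (\<Phi> i)) p - (dt ^^ j) ((dx ^^ k) \<phi>) p) \<le> e) sequentially"
proof -
  have "uniform_limit UNIV (\<lambda>i. (dt ^^ j) ((dx ^^ k) (\<Phi> i))) ((dt ^^ j) ((dx ^^ k) \<phi>)) sequentially"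
    using assms by (simp add: test_ST_tendsto_def)
  from uniform_limitD[OF this assms(2)] show ?thesis
    by eventually_elim (auto simp: dist_norm less_imp_le)
qed

text \<open>The functions $f'$ and $g'$ stand for the sixth $x$-derivatives, possibly with a time derivative in front.\<close>

lemma slice_fc_diff_decay:
  assumes "f \<in> test_ST" "f' \<in> test_ST" "g \<in> test_ST" "g' \<in> test_ST"
    and "slice_fc f' t n = (- \<i> * of_int n) ^ 6 * slice_fc f t n"
    and "slice_fc g' t n = (- \<i> * of_int n) ^ 6 * slice_fc g t n"
    and "\<forall>p. cmod (f p - g p) \<le> e" "\<forall>p. cmod (f' p - g' p) \<le> e"
  shows "cmod (slice_fc f t n - slice_fc g t n) \<le> 16 * pi * e / bracket n ^ 3"
proof (rule decay_from_sixth_derivative)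
  show "cmod (slice_fc f t n - slice_fc g t n) \<le> 2 * pi * e"
    using assms(7) by (intro slice_fc_diff_le test_ST_smooth assms) (simp del: split_paired_All)
  have "(- \<i> * of_int n) ^ 6 * (slice_fc f t n - slice_fc g t n) = slice_fc f' t n - slice_fc g' t n"
    by (simp only: assms(5,6) right_diff_distrib)
  also have "cmod \<dots> \<le> 2 * pi * e"
    using assms(8) by (intro slice_fc_diff_le test_ST_smooth assms) (simp del: split_paired_All)
  finally show "cmod ((- \<i> * of_int n) ^ 6 * (slice_fc f t n - slice_fc g t n)) \<le> 2 * pi * e" .
qed

lemma tame_dt: "tame (\<lambda>\<Phi>. slice_fc (dt \<Phi>))"
  unfolding tame_def
proof (intro conjI ballI allI impI)
  show "slice_fc (dt (\<lambda>p. a * \<phi> p + b * \<psi> p)) t n = a * slice_fc (dt \<phi>) t n + b * slice_fc (dt \<psi>) t n"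
    if "\<phi> \<in> test_ST" "\<psi> \<in> test_ST" for \<phi> \<psi> a b t n
    using that by (simp add: dt_def dirderiv_lincomb slice_fc_lincomb smooth_dirderiv test_ST_smooth)
  show "continuous_on {0..1} (\<lambda>t. slice_fc (dt \<phi>) t n)" if "\<phi> \<in> test_ST" for \<phi> n
    using that by (intro slice_fc_continuous test_ST_dt)
  show "\<exists>B. \<forall>t\<in>{0..1}. \<forall>n. cmod (slice_fc (dt \<phi>) t n) \<le> B / bracket n ^ 2" if "\<phi> \<in> test_ST" for \<phi>
    using slice_fc_decay(2)[OF that] bracket_cube_square by (meson order_trans)
  fix \<Phi> \<phi> and e :: real
  assume \<Phi>: "\<forall>i. \<Phi> i \<in> test_ST" and \<phi>: "\<phi> \<in> test_ST" and lim: "test_ST_tendsto \<Phi> \<phi>" and e: "0 < e"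
  have d: "e / (16 * pi) > 0" using e by simp
  from test_ST_tendstoD[OF lim d, of 1 0] test_ST_tendstoD[OF lim d, of 1 6]
  show "\<forall>\<^sub>F i in sequentially. \<forall>t\<in>{0..1}. \<forall>n. cmod (slice_fc (dt (\<Phi> i)) t n - slice_fc (dt \<phi>) t n) \<le> e / bracket n ^ 2"
  proof eventually_elim
    case (elim i)
    show ?case
    proof (intro ballI allI)
      fix t n
      have \<Phi>i: "\<Phi> i \<in> test_ST" using \<Phi> by blast
      have "cmod (slice_fc (dt (\<Phi> i)) t n - slice_fc (dt \<phi>) t n) \<le> 16 * pi * (e / (16 * pi)) / bracket n ^ 3"
        by (rule slice_fc_diff_decay[where f' = "dt ((dx ^^ 6) (\<Phi> i))" and g' = "dt ((dx ^^ 6) \<phi>)"])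
           (use elim in \<open>simp_all add: \<Phi>i \<phi> test_ST_dt test_ST_dx_iter slice_fc_dt_dx_iter del: split_paired_All\<close>)
      also have "\<dots> = e / bracket n ^ 3" by simp
      also have "\<dots> \<le> e / bracket n ^ 2" using e by (intro bracket_cube_square) simp
      finally show "cmod (slice_fc (dt (\<Phi> i)) t n - slice_fc (dt \<phi>) t n) \<le> e / bracket n ^ 2" .
    qed
  qed
qed

lemma slice_fc_dx_dx:
  assumes "\<phi> \<in> test_ST"
  shows "slice_fc (dx (dx \<phi>)) t n = - ((of_int n)\<^sup>2 * slice_fc \<phi> t n)"
proof -
  have "(dx ^^ 2) \<phi> = dx (dx \<phi>)" by (simp add: numeral_2_eq_2)
  moreover have "(- \<i> * of_int n) ^ 2 = - ((of_int n)\<^sup>2 :: complex)" by (simp add: power_mult_distrib)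
  ultimately show ?thesis using slice_fc_dx_iter[OF assms, of 2 t n] by simp
qed

lemma times_square_decay:
  assumes "cmod c \<le> B / bracket n ^ 3"
  shows "cmod ((of_int n)\<^sup>2 * c) \<le> B / bracket n ^ 2"
proof -
  have "cmod ((of_int n)\<^sup>2 * c) = (real_of_int n)\<^sup>2 * cmod c"
    by (simp add: norm_mult norm_power)
  also have "\<dots> \<le> bracket n * (B / bracket n ^ 3)"
    using assms bracket_pos[of n] by (intro mult_mono) (auto simp: bracket_def)
  also have "\<dots> = B / bracket n ^ 2"
    using bracket_pos[of n] by (simp add: power2_eq_square power3_eq_cube)
  finally show ?thesis .
qed

lemma tame_dx_dx: "tame (\<lambda>\<Phi>. slice_fc (dx (dx \<Phi>)))"
  unfolding tame_def
proof (intro conjI ballI allI impI)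
  show "slice_fc (dx (dx (\<lambda>p. a * \<phi> p + b * \<psi> p))) t n = a * slice_fc (dx (dx \<phi>)) t n + b * slice_fc (dx (dx \<psi>)) t n"
    if "\<phi> \<in> test_ST" "\<psi> \<in> test_ST" for \<phi> \<psi> a b t n
    using that by (simp add: dx_def dirderiv_lincomb slice_fc_lincomb smooth_dirderiv test_ST_smooth)
  show "continuous_on {0..1} (\<lambda>t. slice_fc (dx (dx \<phi>)) t n)" if "\<phi> \<in> test_ST" for \<phi> n
    using that by (intro slice_fc_continuous test_ST_dx)
  show "\<exists>B. \<forall>t\<in>{0..1}. \<forall>n. cmod (slice_fc (dx (dx \<phi>)) t n) \<le> B / bracket n ^ 2" if "\<phi> \<in> test_ST" for \<phi>
    using slice_fc_decay(1)[OF that] times_square_decay by (simp add: slice_fc_dx_dx[OF that]) blast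
  fix \<Phi> \<phi> and e :: real
  assume \<Phi>: "\<forall>i. \<Phi> i \<in> test_ST" and \<phi>: "\<phi> \<in> test_ST" and lim: "test_ST_tendsto \<Phi> \<phi>" and e: "0 < e"
  have d: "e / (16 * pi) > 0" using e by simp
  from test_ST_tendstoD[OF lim d, of 0 0] test_ST_tendstoD[OF lim d, of 0 6]
  show "\<forall>\<^sub>F i in sequentially. \<forall>t\<in>{0..1}. \<forall>n. cmod (slice_fc (dx (dx (\<Phi> i))) t n - slice_fc (dx (dx \<phi>)) t n) \<le> e / bracket n ^ 2"
  proof eventually_elim
    case (elim i)
    show ?case
    proof (intro ballI allI)
      fix t n
      have \<Phi>i: "\<Phi> i \<in> test_ST" using \<Phi> by blast
      have "cmod (slice_fc (\<Phi> i) t n - slice_fc \<phi> t n) \<le> 16 * pi * (e / (16 * pi)) / bracket n ^ 3"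
        by (rule slice_fc_diff_decay[where f' = "(dx ^^ 6) (\<Phi> i)" and g' = "(dx ^^ 6) \<phi>"])
           (use elim in \<open>simp_all add: \<Phi>i \<phi> test_ST_dx_iter slice_fc_dx_iter del: split_paired_All\<close>)
      hence "cmod ((of_int n)\<^sup>2 * (slice_fc (\<Phi> i) t n - slice_fc \<phi> t n)) \<le> e / bracket n ^ 2"
        by (intro times_square_decay) simp
      moreover have "slice_fc (dx (dx (\<Phi> i))) t n - slice_fc (dx (dx \<phi>)) t n = - ((of_int n)\<^sup>2 * (slice_fc (\<Phi> i) t n - slice_fc \<phi> t n))"
        by (simp add: slice_fc_dx_dx \<Phi>i \<phi> algebra_simps)
      ultimately show "cmod (slice_fc (dx (dx (\<Phi> i))) t n - slice_fc (dx (dx \<phi>)) t n) \<le> e / bracket n ^ 2"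
        by simp
    qed
  qed
qed

definition pairing :: "(real \<Rightarrow> int \<Rightarrow> complex) \<Rightarrow> (real \<Rightarrow> int \<Rightarrow> complex) \<Rightarrow> complex" where
  "pairing g c = integral {0..1} (\<lambda>t. \<Sum>\<^sub>\<infinity>n. g t n * c t n)"

lemma continuous_on_infsum:
  fixes f :: "'a \<Rightarrow> 'b::topological_space \<Rightarrow> complex"
  assumes "\<And>n. continuous_on S (f n)" "\<And>n t. t \<in> S \<Longrightarrow> cmod (f n t) \<le> M n" "M summable_on UNIV"
  shows "continuous_on S (\<lambda>t. \<Sum>\<^sub>\<infinity>n. f n t)"
proof (rule uniform_limit_theorem)
  show "uniform_limit S (\<lambda>X t. \<Sum>n\<in>X. f n t) (\<lambda>t. \<Sum>\<^sub>\<infinity>n. f n t) (finite_subsets_at_top UNIV)"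
    using assms by (intro Weierstrass_m_test_general[where M = M]) auto
  show "\<forall>\<^sub>F X in finite_subsets_at_top UNIV. continuous_on S (\<lambda>t. \<Sum>n\<in>X. f n t)"
    using assms by (intro always_eventually allI continuous_on_sum) auto
qed simp

lemma pairing_integrand_continuous:
  assumes "\<And>n. continuous_on {0..1} (\<lambda>t. g t n)" "\<And>t n. t \<in> {0..1} \<Longrightarrow> cmod (g t n) \<le> K * bracket n"
    "\<And>n. continuous_on {0..1} (\<lambda>t. c t n)" "\<And>t n. t \<in> {0..1} \<Longrightarrow> cmod (c t n) \<le> B / bracket n ^ 2"
  shows "continuous_on {0..1} (\<lambda>t. \<Sum>\<^sub>\<infinity>n. g t n * c t n)"
  by (rule continuous_on_infsum[where M = "\<lambda>n. K * B * (1 / bracket n)"])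
     (use assms in \<open>auto intro!: continuous_on_mult summable_on_cmult_right summable_inverse_bracket trig_term_bound simp del: times_divide_eq_right\<close>)

lemma pairing_lincomb:
  assumes "\<And>n. continuous_on {0..1} (\<lambda>t. g t n)" "\<And>t n. t \<in> {0..1} \<Longrightarrow> cmod (g t n) \<le> K * bracket n"
    "\<And>n. continuous_on {0..1} (\<lambda>t. c t n)" "\<And>t n. t \<in> {0..1} \<Longrightarrow> cmod (c t n) \<le> B / bracket n ^ 2"
    "\<And>n. continuous_on {0..1} (\<lambda>t. d t n)" "\<And>t n. t \<in> {0..1} \<Longrightarrow> cmod (d t n) \<le> B' / bracket n ^ 2"
  shows "pairing g (\<lambda>t n. a * c t n + b * d t n) = a * pairing g c + b * pairing g d"
proof -
  have "pairing g (\<lambda>t n. a * c t n + b * d t n)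
      = integral {0..1} (\<lambda>t. a * (\<Sum>\<^sub>\<infinity>n. g t n * c t n) + b * (\<Sum>\<^sub>\<infinity>n. g t n * d t n))"
    unfolding pairing_def
  proof (rule integral_cong)
    fix t :: real assume t: "t \<in> {0..1}"
    have "(\<Sum>\<^sub>\<infinity>n. g t n * (a * c t n + b * d t n)) = (\<Sum>\<^sub>\<infinity>n. a * (g t n * c t n) + b * (g t n * d t n))"
      by (simp add: algebra_simps)
    also have "\<dots> = a * (\<Sum>\<^sub>\<infinity>n. g t n * c t n) + b * (\<Sum>\<^sub>\<infinity>n. g t n * d t n)"
      using t by (intro infsum_lincomb trig_summable(2)[of _ K _ B] trig_summable(2)[of _ K _ B'] assms)
    finally show "(\<Sum>\<^sub>\<infinity>n. g t n * (a * c t n + b * d t n)) = a * (\<Sum>\<^sub>\<infinity>n. g t n * c t n) + b * (\<Sum>\<^sub>\<infinity>n. g t n * d t n)" .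
  qed
  also have "\<dots> = a * pairing g c + b * pairing g d"
    unfolding pairing_def
    using pairing_integrand_continuous[OF assms(1-4)] pairing_integrand_continuous[OF assms(1,2,5,6)]
    by (subst Henstock_Kurzweil_Integration.integral_add)
       (auto intro!: integrable_continuous_real continuous_intros)
  finally show ?thesis .
qed

lemma pairing_bound:
  assumes "\<And>n. continuous_on {0..1} (\<lambda>t. g t n)" "\<And>t n. t \<in> {0..1} \<Longrightarrow> cmod (g t n) \<le> K * bracket n"
    "\<And>n. continuous_on {0..1} (\<lambda>t. c t n)" "\<And>t n. t \<in> {0..1} \<Longrightarrow> cmod (c t n) \<le> B / bracket n ^ 2"
  shows "cmod (pairing g c) \<le> K * B * (\<Sum>\<^sub>\<infinity>n. 1 / bracket n)"
proof -
  have "cmod (pairing g c) \<le> K * B * (\<Sum>\<^sub>\<infinity>n. 1 / bracket n) * (1 - 0)"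
    unfolding pairing_def
    by (rule integral_bound) (use assms in \<open>auto intro!: pairing_integrand_continuous[OF assms] trig_infsum_bound\<close>)
  thus ?thesis by simp
qed

lemma pairing_distribution:
  assumes g: "\<And>n. continuous_on {0..1} (\<lambda>t. g t n)" "\<And>t n. t \<in> {0..1} \<Longrightarrow> cmod (g t n) \<le> K * bracket n"
    and "tame c"
  shows "distribution_ST (\<lambda>\<phi>. pairing g (c \<phi>))"
proof -
  have lin: "c (\<lambda>p. a * \<phi> p + b * \<psi> p) = (\<lambda>t n. a * c \<phi> t n + b * c \<psi> t n)"
      if "\<phi> \<in> test_ST" "\<psi> \<in> test_ST" for \<phi> \<psi> a b
    using \<open>tame c\<close> that by (simp add: tame_def fun_eq_iff)
  have cont: "continuous_on {0..1} (\<lambda>t. c \<phi> t n)" if "\<phi> \<in> test_ST" for \<phi> n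
    using \<open>tame c\<close> that by (simp add: tame_def)
  have decay: "\<exists>B. \<forall>t\<in>{0..1}. \<forall>n. cmod (c \<phi> t n) \<le> B / bracket n ^ 2" if "\<phi> \<in> test_ST" for \<phi>
    using \<open>tame c\<close> that by (simp add: tame_def)
  have lim: "\<forall>\<^sub>F i in sequentially. \<forall>t\<in>{0..1}. \<forall>n. cmod (c (\<Phi> i) t n - c \<phi> t n) \<le> e / bracket n ^ 2"
    if "\<forall>i. \<Phi> i \<in> test_ST" "\<phi> \<in> test_ST" "test_ST_tendsto \<Phi> \<phi>" "e > 0" for \<Phi> \<phi> and e :: real
    using \<open>tame c\<close> that by (simp add: tame_def)
  have pair_lin: "pairing g (\<lambda>t n. a * c \<phi> t n + b * c \<psi> t n) = a * pairing g (c \<phi>) + b * pairing g (c \<psi>)"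
    if T: "\<phi> \<in> test_ST" "\<psi> \<in> test_ST" for \<phi> \<psi> a b
  proof -
    obtain B1 B2 where "\<forall>t\<in>{0..1}. \<forall>n. cmod (c \<phi> t n) \<le> B1 / bracket n ^ 2"
        "\<forall>t\<in>{0..1}. \<forall>n. cmod (c \<psi> t n) \<le> B2 / bracket n ^ 2"
      using decay[OF T(1)] decay[OF T(2)] by blast
    thus ?thesis using cont[OF T(1)] cont[OF T(2)]
      by (intro pairing_lincomb[OF g, of _ B1 _ B2]) auto
  qed
  have K: "0 \<le> K" using order_trans[OF norm_ge_zero g(2)[of 0 0]] by (simp add: bracket_def)
  define S where "S = (\<Sum>\<^sub>\<infinity>n. 1 / bracket n)"
  have S: "0 \<le> S" unfolding S_def by (intro infsum_nonneg) (use bracket_pos in \<open>simp add: less_imp_le\<close>)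
  show ?thesis
    unfolding distribution_ST_def
  proof (intro conjI ballI allI impI)
    show "pairing g (c (\<lambda>p. a * \<phi> p + b * \<psi> p)) = a * pairing g (c \<phi>) + b * pairing g (c \<psi>)"
      if "\<phi> \<in> test_ST" "\<psi> \<in> test_ST" for \<phi> \<psi> a b
      unfolding lin[OF that] by (rule pair_lin[OF that])
    fix \<Phi> \<phi> assume *: "(\<forall>i. \<Phi> i \<in> test_ST) \<and> \<phi> \<in> test_ST \<and> test_ST_tendsto \<Phi> \<phi>"
    hence T: "\<forall>i. \<Phi> i \<in> test_ST" "\<phi> \<in> test_ST" "test_ST_tendsto \<Phi> \<phi>" by auto
    show "(\<lambda>i. pairing g (c (\<Phi> i))) \<longlonglongrightarrow> pairing g (c \<phi>)"
    proof (rule tendstoI)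
      fix e :: real assume e: "e > 0"
      define d where "d = e / (K * S + 1)"
      have pos: "K * S + 1 > 0" using K S by (simp add: add_nonneg_pos)
      hence d: "d > 0" using e by (simp add: d_def)
      from lim[OF T d] show "\<forall>\<^sub>F i in sequentially. dist (pairing g (c (\<Phi> i))) (pairing g (c \<phi>)) < e"
      proof eventually_elim
        case (elim i)
        have \<Phi>i: "\<Phi> i \<in> test_ST" using T by blast
        have "pairing g (c (\<Phi> i)) - pairing g (c \<phi>) = pairing g (\<lambda>t n. 1 * c (\<Phi> i) t n + (-1) * c \<phi> t n)"
          by (simp only: pair_lin[OF \<Phi>i T(2)]) simp
        also have "cmod \<dots> \<le> K * d * S"
          unfolding S_def
          by (rule pairing_bound[OF g]) (use elim cont[OF \<Phi>i] cont[OF T(2)] in \<open>auto intro!: continuous_intros\<close>)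
        also have "\<dots> = (K * S) * d" by simp
        also have "\<dots> < (K * S + 1) * d" using d by (simp add: ring_distribs)
        also have "\<dots> = e" using pos by (simp add: d_def)
        finally show ?case by (simp add: dist_norm)
      qed
    qed
  qed
qed

section \<open>The nonlinearity and the free group in Fourier variables\<close>

lemma has_integral_cis:
  "((\<lambda>x. cis (of_int k * x)) has_integral (if k = 0 then 2 * of_real pi else 0)) {0..2 * pi}"
proof -
  have "(\<lambda>x. cis (of_int k * x)) integrable_on {0..2 * pi}"
    by (intro integrable_continuous_real continuous_intros)
  from integrable_integral[OF this] show ?thesis
    unfolding integral_cis by (simp split: if_splits)
qed

lemma parseval:
  fixes w :: "int \<Rightarrow> complex"
  assumes "finite S"
  defines "f \<equiv> \<lambda>x. \<Sum>n\<in>S. w n * cis (of_int n * x)"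
  shows "of_real (mean (\<lambda>y. (cmod (f y))\<^sup>2)) = (\<Sum>n\<in>S. w n * cnj (w n))"
proof -
  have cont: "continuous_on {0..2 * pi} (\<lambda>y. (cmod (f y))\<^sup>2)"
    unfolding f_def by (intro continuous_intros)
  have eq: "of_real ((cmod (f y))\<^sup>2) = (\<Sum>p\<in>S. \<Sum>q\<in>S. w p * cnj (w q) * cis (of_int (p - q) * y))" for y
  proof -
    have "of_real ((cmod (f y))\<^sup>2) = f y * cnj (f y)" by (rule complex_norm_square)
    also have "\<dots> = (\<Sum>p\<in>S. \<Sum>q\<in>S. w p * cis (of_int p * y) * cnj (w q * cis (of_int q * y)))"
      unfolding f_def cnj_sum sum_product ..
    also have "\<dots> = (\<Sum>p\<in>S. \<Sum>q\<in>S. w p * cnj (w q) * cis (of_int (p - q) * y))"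
    proof (intro sum.cong refl)
      fix p q
      have "cis (of_int (p - q) * y) = cis (of_int p * y) * cis (- (of_int q * y))"
        by (simp add: cis_mult algebra_simps)
      thus "w p * cis (of_int p * y) * cnj (w q * cis (of_int q * y)) = w p * cnj (w q) * cis (of_int (p - q) * y)"
        by (simp add: cis_cnj mult_ac)
    qed
    finally show ?thesis .
  qed
  have "((\<lambda>y. (cmod (f y))\<^sup>2) has_integral integral {0..2 * pi} (\<lambda>y. (cmod (f y))\<^sup>2)) {0..2 * pi}"
    by (intro integrable_integral integrable_continuous_real cont)
  from has_integral_of_real[OF this, where 'b = complex]
  have 1: "((\<lambda>y. \<Sum>p\<in>S. \<Sum>q\<in>S. w p * cnj (w q) * cis (of_int (p - q) * y)) has_integral
      of_real (integral {0..2 * pi} (\<lambda>y. (cmod (f y))\<^sup>2))) {0..2 * pi}"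
    unfolding eq .
  have 2: "((\<lambda>y. \<Sum>p\<in>S. \<Sum>q\<in>S. w p * cnj (w q) * cis (of_int (p - q) * y)) has_integral
      (\<Sum>p\<in>S. \<Sum>q\<in>S. w p * cnj (w q) * (if p - q = 0 then 2 * of_real pi else 0))) {0..2 * pi}"
    by (intro has_integral_sum assms has_integral_mult_right has_integral_cis)
  have "of_real (integral {0..2 * pi} (\<lambda>y. (cmod (f y))\<^sup>2)) = (\<Sum>p\<in>S. \<Sum>q\<in>S. w p * cnj (w q) * (if p - q = 0 then 2 * of_real pi else 0))"
    by (rule has_integral_unique[OF 1 2])
  also have "\<dots> = (\<Sum>p\<in>S. \<Sum>q\<in>S. if p = q then 2 * of_real pi * (w p * cnj (w q)) else 0)"
    by (intro sum.cong refl) auto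
  also have "\<dots> = 2 * of_real pi * (\<Sum>p\<in>S. w p * cnj (w p))"
    using assms by (simp add: sum.delta' sum_distrib_left)
  finally show ?thesis by (simp add: mean_def)
qed

lemma res_sign_eq: "res_sign p q r = 1 - (if p = q then 1 else 0) - (if q = r then 1 else 0)"
  by (simp add: res_sign_def)

text \<open>The two Kronecker symbols in $1-\delta_{pq}-\delta_{qr}$ each contribute the mean of $|f|^2$ times $f$,
  by Parseval's identity; together they are the gauge term.\<close>

lemma nonlin_trig:
  fixes w :: "int \<Rightarrow> complex"
  assumes "finite S"
  defines "f \<equiv> \<lambda>x. \<Sum>n\<in>S. w n * cis (of_int n * x)"
  shows "nonlin f x = (\<Sum>(p, q, r)\<in>S \<times> S \<times> S. res_sign p q r * w p * cnj (w q) * w r * cis (of_int (p - q + r) * x))"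
proof -
  define c where "c = (\<lambda>p q r. w p * cnj (w q) * w r * cis (of_int (p - q + r) * x))"
  have fin: "finite S" by fact
  define E where "E = (\<Sum>n\<in>S. w n * cnj (w n))"
  have cub: "f x * cnj (f x) * f x = (\<Sum>p\<in>S. \<Sum>q\<in>S. \<Sum>r\<in>S. c p q r)"
  proof -
    have "f x * cnj (f x) * f x = (\<Sum>p\<in>S. \<Sum>q\<in>S. \<Sum>r\<in>S.
        w p * cis (of_int p * x) * cnj (w q * cis (of_int q * x)) * (w r * cis (of_int r * x)))"
      unfolding f_def cnj_sum sum_product by (simp only: sum_distrib_right sum_distrib_left) (rule sum.cong[OF refl], rule sum.swap)
    also have "\<dots> = (\<Sum>p\<in>S. \<Sum>q\<in>S. \<Sum>r\<in>S. c p q r)"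
    proof (intro sum.cong refl)
      fix p q r
      have "cis (of_int (p - q + r) * x) = cis (of_int p * x) * cis (- (of_int q * x)) * cis (of_int r * x)"
        by (simp add: cis_mult algebra_simps)
      thus "w p * cis (of_int p * x) * cnj (w q * cis (of_int q * x)) * (w r * cis (of_int r * x)) = c p q r"
        by (simp add: c_def cis_cnj mult_ac)
    qed
    finally show ?thesis .
  qed
  have d1: "(\<Sum>p\<in>S. \<Sum>q\<in>S. \<Sum>r\<in>S. (if p = q then 1 else 0) * c p q r) = E * f x"
  proof -
    have "(\<Sum>p\<in>S. \<Sum>q\<in>S. \<Sum>r\<in>S. (if p = q then 1 else 0) * c p q r)
        = (\<Sum>p\<in>S. \<Sum>q\<in>S. if p = q then (\<Sum>r\<in>S. c p q r) else 0)"
      by (intro sum.cong refl) auto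
    also have "\<dots> = (\<Sum>p\<in>S. \<Sum>r\<in>S. c p p r)"
      using fin by (simp add: sum.delta')
    also have "\<dots> = E * f x"
      unfolding E_def f_def sum_product by (intro sum.cong refl) (simp add: c_def mult_ac)
    finally show ?thesis .
  qed
  have d2: "(\<Sum>p\<in>S. \<Sum>q\<in>S. \<Sum>r\<in>S. (if q = r then 1 else 0) * c p q r) = E * f x"
  proof -
    have "(\<Sum>p\<in>S. \<Sum>q\<in>S. \<Sum>r\<in>S. (if q = r then 1 else 0) * c p q r)
        = (\<Sum>p\<in>S. \<Sum>q\<in>S. \<Sum>r\<in>S. if q = r then c p q q else 0)"
      by (intro sum.cong refl) auto
    also have "\<dots> = (\<Sum>p\<in>S. \<Sum>q\<in>S. c p q q)"
      using fin by (simp add: sum.delta)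
    also have "\<dots> = f x * E"
      unfolding E_def f_def sum_product by (intro sum.cong refl) (simp add: c_def mult_ac)
    finally show ?thesis by simp
  qed
  have "nonlin f x = f x * cnj (f x) * f x - E * f x - E * f x"
  proof -
    have "of_real (mean (\<lambda>y. (cmod (f y))\<^sup>2)) = E"
      unfolding f_def E_def by (rule parseval[OF fin])
    thus ?thesis by (simp add: nonlin_def complex_norm_square[symmetric] left_diff_distrib)
  qed
  also have "\<dots> = (\<Sum>p\<in>S. \<Sum>q\<in>S. \<Sum>r\<in>S. res_sign p q r * c p q r)"
    unfolding res_sign_eq by (simp only: left_diff_distrib sum_subtractf mult_1 d1 d2 cub)
  also have "\<dots> = (\<Sum>(p, q, r)\<in>S \<times> S \<times> S. res_sign p q r * w p * cnj (w q) * w r * cis (of_int (p - q + r) * x))"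
    by (simp add: c_def sum.cartesian_product mult.assoc)
  finally show ?thesis .
qed

lemma fun_dist_nonlin_trig:
  assumes "finite S" "continuous_on {0..2 * pi} \<Psi>"
  shows "fun_dist (nonlin (\<lambda>x. \<Sum>n\<in>S. w n * cis (of_int n * x))) \<Psi>
    = (\<Sum>(p, q, r)\<in>S \<times> S \<times> S. res_sign p q r * w p * cnj (w q) * w r * fc \<Psi> (p - q + r))"
proof -
  have "((\<lambda>x. \<Sum>(p, q, r)\<in>S \<times> S \<times> S. res_sign p q r * w p * cnj (w q) * w r * (\<Psi> x * cis (of_int (p - q + r) * x)))
     has_integral (\<Sum>(p, q, r)\<in>S \<times> S \<times> S. res_sign p q r * w p * cnj (w q) * w r * fc \<Psi> (p - q + r))) {0..2 * pi}"
    unfolding case_prod_unfold fc_def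
    by (intro has_integral_sum finite_cartesian_product assms has_integral_mult_right integrable_integral
        integrable_continuous_real continuous_intros)
  moreover have "nonlin (\<lambda>x. \<Sum>n\<in>S. w n * cis (of_int n * x)) x * \<Psi> x =
     (\<Sum>(p, q, r)\<in>S \<times> S \<times> S. res_sign p q r * w p * cnj (w q) * w r * (\<Psi> x * cis (of_int (p - q + r) * x)))" for x
    unfolding nonlin_trig[OF assms(1)] sum_distrib_right by (intro sum.cong refl) (auto simp: mult_ac)
  ultimately show ?thesis by (simp add: fun_dist_def integral_unique)
qed

lemma absolutely_convergent_trig_series:
  fixes \<alpha> :: "int \<Rightarrow> complex"
  assumes "\<And>n. cmod (\<alpha> n) \<le> B / bracket n ^ 2"
  shows "continuous_on S (\<lambda>x. \<Sum>\<^sub>\<infinity>n. \<alpha> n * cis (of_int n * x))"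
    and "fc (\<lambda>x. \<Sum>\<^sub>\<infinity>n. \<alpha> n * cis (of_int n * x)) k = 2 * pi * \<alpha> (- k)"
proof -
  have B: "0 \<le> B" using order_trans[OF norm_ge_zero assms[of 0]] by (simp add: bracket_def)
  have M: "cmod (\<alpha> n * cis y) \<le> B * (1 / bracket n)" for n y
  proof -
    have "cmod (\<alpha> n * cis y) \<le> B / bracket n ^ 2" using assms by (simp add: norm_mult)
    also have "\<dots> \<le> B / bracket n ^ 1"
      using B bracket_ge_1[of n] by (intro divide_left_mono power_increasing mult_pos_pos) auto
    finally show ?thesis by simp
  qed
  have sM: "(\<lambda>n. B * (1 / bracket n)) summable_on UNIV"
    by (intro summable_on_cmult_right summable_inverse_bracket)
  show "continuous_on S (\<lambda>x. \<Sum>\<^sub>\<infinity>n. \<alpha> n * cis (of_int n * x))" for S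
    by (rule continuous_on_infsum[OF _ M sM]) (intro continuous_intros)
  have "uniform_limit {0..2 * pi} (\<lambda>X x. \<Sum>n\<in>X. \<alpha> n * cis (of_int n * x + of_int k * x))
      (\<lambda>x. \<Sum>\<^sub>\<infinity>n. \<alpha> n * cis (of_int n * x + of_int k * x)) (finite_subsets_at_top UNIV)"
    by (rule Weierstrass_m_test_general[OF M sM])
  then obtain I J where IJ: "\<And>X. ((\<lambda>x. \<Sum>n\<in>X. \<alpha> n * cis (of_int n * x + of_int k * x)) has_integral I X) {0..2 * pi}"
      "((\<lambda>x. \<Sum>\<^sub>\<infinity>n. \<alpha> n * cis (of_int n * x + of_int k * x)) has_integral J) {0..2 * pi}"
      "(I \<longlongrightarrow> J) (finite_subsets_at_top UNIV)"
    by (rule uniform_limit_integral) (auto intro!: continuous_intros)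
  have "I X = 2 * pi * \<alpha> (- k)" if X: "finite X" "- k \<in> X" for X
  proof -
    have "((\<lambda>x. \<Sum>n\<in>X. \<alpha> n * cis (of_int (n + k) * x)) has_integral
        (\<Sum>n\<in>X. \<alpha> n * (if n + k = 0 then 2 * of_real pi else 0))) {0..2 * pi}"
      by (intro has_integral_sum X has_integral_mult_right has_integral_cis)
    hence "I X = (\<Sum>n\<in>X. \<alpha> n * (if n + k = 0 then 2 * of_real pi else 0))"
      using IJ(1)[of X] by (intro has_integral_unique) (auto simp: ring_distribs)
    also have "\<dots> = (\<Sum>n\<in>X. if - k = n then \<alpha> n * (2 * of_real pi) else 0)"
      by (intro sum.cong refl) auto
    also have "\<dots> = 2 * pi * \<alpha> (- k)" using X by simp
    finally show ?thesis .
  qed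
  hence "eventually (\<lambda>X. I X = 2 * pi * \<alpha> (- k)) (finite_subsets_at_top UNIV)"
    by (auto simp: eventually_finite_subsets_at_top intro!: exI[of _ "{- k}"])
  hence "(I \<longlongrightarrow> 2 * pi * \<alpha> (- k)) (finite_subsets_at_top UNIV)" by (rule tendsto_eventually)
  with IJ(3) have "J = 2 * pi * \<alpha> (- k)" by (intro tendsto_unique[of "finite_subsets_at_top UNIV" I]) auto
  moreover have "(\<Sum>\<^sub>\<infinity>n. \<alpha> n * cis (of_int n * x)) * cis (of_int k * x)
      = (\<Sum>\<^sub>\<infinity>n. \<alpha> n * cis (of_int n * x + of_int k * x))" for x
    by (subst infsum_cmult_left'[symmetric]) (simp add: mult.assoc cis_mult)
  ultimately show "fc (\<lambda>x. \<Sum>\<^sub>\<infinity>n. \<alpha> n * cis (of_int n * x)) k = 2 * pi * \<alpha> (- k)"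
    using IJ(2) by (simp add: fc_def integral_unique)
qed

text \<open>The coefficients of a smooth slice decay, so the series defining the free evolution of a test
  function converges uniformly and can be integrated term by term.\<close>

lemma free_test_slice:
  assumes "\<phi> \<in> test_ST"
  shows "continuous_on S (\<lambda>x. free_test \<phi> (t, x))"
    and "slice_fc (free_test \<phi>) t k = cis ((of_int k)\<^sup>2 * t) * slice_fc \<phi> t k"
proof -
  define \<alpha> where "\<alpha> = (\<lambda>n. cis ((of_int n)\<^sup>2 * t) * (slice_fc \<phi> t (- n) / (2 * pi)))"
  obtain B where B: "\<And>n. cmod (slice_fc \<phi> t n) \<le> B / bracket n ^ 2"
    using test_T_decay2[OF test_ST_slice[OF assms]] unfolding slice_fc_def by blast
  have ft: "(\<lambda>x. free_test \<phi> (t, x)) = (\<lambda>x. \<Sum>\<^sub>\<infinity>n. \<alpha> n * cis (of_int n * x))"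
    by (simp add: free_test_def fourier_coeff_fc \<alpha>_def slice_fc_def)
  have bd: "cmod (\<alpha> n) \<le> (B / (2 * pi)) / bracket n ^ 2" for n
    using divide_right_mono[OF B[of "- n"], of "2 * pi"]
    by (simp add: \<alpha>_def norm_mult norm_divide bracket_def field_simps)
  show "continuous_on S (\<lambda>x. free_test \<phi> (t, x))"
    unfolding ft by (rule absolutely_convergent_trig_series(1)[OF bd])
  have "slice_fc (free_test \<phi>) t k = 2 * pi * \<alpha> (- k)"
    unfolding slice_fc_def[of "free_test \<phi>"] ft by (rule absolutely_convergent_trig_series(2)[OF bd])
  thus "slice_fc (free_test \<phi>) t k = cis ((of_int k)\<^sup>2 * t) * slice_fc \<phi> t k"
    by (simp add: \<alpha>_def)
qed

section \<open>Primitives in time\<close>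

lemma primitive_Cm1_trig_dist:
  assumes "controlled s D g" "\<And>n. g 0 n = 0"
    and F: "\<And>\<phi>. \<phi> \<in> test_ST \<Longrightarrow> F \<phi> = - pairing g (slice_fc (dt \<phi>))"
  shows "primitive_Cm1 s F (\<lambda>t. trig_dist (g t))"
  unfolding primitive_Cm1_def
proof (intro conjI ballI)
  show "(\<lambda>t. trig_dist (g t)) \<in> C0_sobolev s"
    by (rule controlled_C0_sobolev) fact
  show "trig_dist (g 0) \<psi> = 0" for \<psi>
    by (simp add: trig_dist_def assms(2))
  show "F \<phi> = dist_dt (st_dist (\<lambda>t. trig_dist (g t))) \<phi>" if "\<phi> \<in> test_ST" for \<phi>
    by (simp add: F[OF that] dist_dt_def st_dist_def pairing_def trig_dist_def slice_fc_def)
qed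

lemma Cm1_sobolevI:
  assumes "controlled s D g" "\<And>n. g 0 n = 0"
    and F: "\<And>\<phi>. \<phi> \<in> test_ST \<Longrightarrow> F \<phi> = - pairing g (slice_fc (dt \<phi>))"
  shows "F \<in> Cm1_sobolev s"
proof -
  obtain K where K: "\<forall>t\<in>{0..1}. \<forall>n. cmod (g t n) \<le> K * bracket n"
    using controlled_bound[OF assms(1)] by blast
  have "distribution_ST (\<lambda>\<phi>. pairing g (slice_fc (dt \<phi>)))"
    by (rule pairing_distribution[OF _ _ tame_dt]) (use assms(1) K in \<open>auto simp: controlled_def\<close>)
  hence "distribution_ST (\<lambda>\<phi>. - pairing g (slice_fc (dt \<phi>)))"
    by (auto simp: distribution_ST_def intro: tendsto_minus)
  hence "distribution_ST F" by (rule distribution_ST_cong) (rule F)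
  thus ?thesis using primitive_Cm1_trig_dist[OF assms] by (auto simp: Cm1_sobolev_def)
qed

lemma cmod_fourier_coeff_le_sobolev_norm:
  assumes "sobolev_term s f summable_on UNIV"
  shows "weight s n * cmod (fourier_coeff f n) \<le> sobolev_norm s f"
proof -
  have "(weight s n * cmod (fourier_coeff f n))\<^sup>2 = sum (sobolev_term s f) {n}"
    by (simp add: sobolev_term_eq)
  also have "\<dots> \<le> (\<Sum>\<^sub>\<infinity>n. sobolev_term s f n)"
    by (rule finite_sum_le_infsum) (use assms in \<open>auto simp: sobolev_term_eq\<close>)
  finally show ?thesis
    unfolding sobolev_norm_def by (rule real_le_rsqrt)
qed

lemma fourier_coeff_diff:
  "fourier_coeff (\<lambda>\<phi>. f \<phi> - g \<phi>) n = fourier_coeff f n - fourier_coeff g n"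
  by (simp add: fourier_coeff_def diff_divide_distrib)

lemma sobolev_term_diff_summable:
  assumes "sobolev_term s f summable_on UNIV" "sobolev_term s g summable_on UNIV"
  shows "sobolev_term s (\<lambda>\<phi>. f \<phi> - g \<phi>) summable_on UNIV"
proof (rule summable_on_comparison_test)
  show "(\<lambda>n. 2 * sobolev_term s f n + 2 * sobolev_term s g n) summable_on UNIV"
    by (intro summable_on_add summable_on_cmult_right assms)
  show "sobolev_term s (\<lambda>\<phi>. f \<phi> - g \<phi>) n \<le> 2 * sobolev_term s f n + 2 * sobolev_term s g n" for n
  proof -
    define x y where "x = cmod (fourier_coeff f n)" and "y = cmod (fourier_coeff g n)"
    have "(cmod (fourier_coeff f n - fourier_coeff g n))\<^sup>2 \<le> (x + y)\<^sup>2"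
      unfolding x_def y_def by (intro power_mono norm_triangle_ineq4) auto
    also have "\<dots> \<le> 2 * x\<^sup>2 + 2 * y\<^sup>2"
      using sum_squares_bound[of x y] by (simp add: power2_sum)
    finally have "(weight s n)\<^sup>2 * (cmod (fourier_coeff f n - fourier_coeff g n))\<^sup>2 \<le> (weight s n)\<^sup>2 * (2 * x\<^sup>2 + 2 * y\<^sup>2)"
      by (intro mult_left_mono) auto
    thus ?thesis
      by (simp add: sobolev_term_eq fourier_coeff_diff power_mult_distrib x_def y_def algebra_simps)
  qed
qed (simp add: sobolev_term_eq)

lemma C0_sobolev_coeff_continuous:
  assumes "U \<in> C0_sobolev s"
  shows "continuous_on {0..1} (\<lambda>t. fourier_coeff (U t) n)"
  unfolding continuous_on_def
proof
  fix t :: real assume t: "t \<in> {0..1}"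
  have lim: "((\<lambda>\<tau>. sobolev_norm s (\<lambda>\<phi>. U \<tau> \<phi> - U t \<phi>) / weight s n) \<longlongrightarrow> 0 / weight s n) (at t within {0..1})"
    using assms t weight_pos[of s n] by (intro tendsto_divide tendsto_const) (auto simp: C0_sobolev_def)
  have "((\<lambda>\<tau>. fourier_coeff (U \<tau>) n - fourier_coeff (U t) n) \<longlongrightarrow> 0) (at t within {0..1})"
  proof (rule Lim_null_comparison)
    have "cmod (fourier_coeff (U \<tau>) n - fourier_coeff (U t) n) \<le> sobolev_norm s (\<lambda>\<phi>. U \<tau> \<phi> - U t \<phi>) / weight s n"
      if "\<tau> \<in> {0..1}" for \<tau>
    proof -
      have "sobolev_term s (U \<tau>) summable_on UNIV" "sobolev_term s (U t) summable_on UNIV"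
        using assms t that by (auto simp: C0_sobolev_def sobolev_def)
      from cmod_fourier_coeff_le_sobolev_norm[OF sobolev_term_diff_summable[OF this], of n]
      show ?thesis using weight_pos[of s n] by (simp add: fourier_coeff_diff field_simps)
    qed
    thus "\<forall>\<^sub>F \<tau> in at t within {0..1}. cmod (fourier_coeff (U \<tau>) n - fourier_coeff (U t) n)
        \<le> sobolev_norm s (\<lambda>\<phi>. U \<tau> \<phi> - U t \<phi>) / weight s n"
      by (auto simp: eventually_at_filter)
  qed (use lim in simp)
  thus "((\<lambda>t. fourier_coeff (U t) n) \<longlongrightarrow> fourier_coeff (U t) n) (at t within {0..1})"
    by (rule LIM_zero_cancel)
qed

lemma distribution_T_linear:
  "distribution_T f \<Longrightarrow> \<phi> \<in> test_T \<Longrightarrow> \<psi> \<in> test_T \<Longrightarrow>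
    f (\<lambda>x. a * \<phi> x + b * \<psi> x) = a * f \<phi> + b * f \<psi>"
  by (simp add: distribution_T_def)

text \<open>These test functions isolate the Fourier coefficient with index $n$.\<close>

lemma bump_test_ST:
  fixes n :: int
  assumes "\<psi> \<in> bump_primitives" "\<And>t. (\<psi> has_vector_derivative \<psi>' t) (at t)"
    and "0 < a" "b < 1" "\<And>t. \<psi> t \<noteq> 0 \<Longrightarrow> a \<le> t \<and> t \<le> b"
  defines "\<phi> \<equiv> \<lambda>(t, x). \<psi> t * cis (- (of_int n * x))"
  shows "\<phi> \<in> test_ST" "dt \<phi> (t, x) = \<psi>' t * cis (- (of_int n * x))"
proof -
  have sm: "smooth \<phi>"
    using bump_primitives_smooth_tensor[OF assms(1), of "- of_int n"] by (simp add: \<phi>_def)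
  have "cis (- (of_int n * (x + 2 * pi))) = cis (- (of_int n * x))" for x :: real
    using cis_in_test_T[of n] by (simp add: test_T_def)
  hence "\<phi> (t, x + 2 * pi) = \<phi> (t, x)" for t x by (simp add: \<phi>_def)
  moreover have "supp_in a b \<phi>" using assms(5) by (auto simp: supp_in_def \<phi>_def)
  ultimately show "\<phi> \<in> test_ST" using sm assms(3,4) unfolding test_ST_def by blast
  have "((\<lambda>t. \<phi> (t, x)) has_vector_derivative \<psi>' t * cis (- (of_int n * x))) (at t)"
    unfolding \<phi>_def prod.case by (rule has_vector_derivative_mult_left[OF assms(2)])
  from vector_derivative_unique_at[OF smooth_partial_dt[OF sm] this]
  show "dt \<phi> (t, x) = \<psi>' t * cis (- (of_int n * x))" .
qed

lemma bump_primitives_derivative_continuous: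
  assumes "\<psi> \<in> bump_primitives" "\<And>t. (\<psi> has_vector_derivative \<psi>' t) (at t)"
  shows "continuous_on S \<psi>'"
proof -
  obtain f where f: "f \<in> bumps" "\<And>t. (\<psi> has_vector_derivative f t) (at t)"
    using assms(1) unfolding bump_primitives_def by blast
  have "\<psi>' = f"
    using vector_derivative_unique_at[OF assms(2) f(2)] by (simp add: fun_eq_iff)
  moreover obtain f' where "\<forall>t. (f has_vector_derivative f' t) (at t)"
    using bumps_has_derivative[OF f(1)] by blast
  ultimately show ?thesis
    by (intro continuous_on_vector_derivative[of S _ f']) (auto intro: has_vector_derivative_at_within)
qed

text \<open>For each $n$ the difference of the two coefficients is continuous, has vanishing weak derivative
  on $(0,1)$ and vanishes at $t=0$.\<close>

lemma primitive_Cm1_unique: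
  assumes g: "controlled s D g" "\<And>n. g 0 n = 0"
    and F: "\<And>\<phi>. \<phi> \<in> test_ST \<Longrightarrow> F \<phi> = - pairing g (slice_fc (dt \<phi>))"
    and G: "primitive_Cm1 s F G" and t: "t \<in> {0..1}"
  shows "fourier_coeff (G t) n = g t n"
proof -
  have GC: "G \<in> C0_sobolev s" and G0: "\<And>\<psi>. \<psi> \<in> test_T \<Longrightarrow> G 0 \<psi> = 0"
    and GF: "\<And>\<phi>. \<phi> \<in> test_ST \<Longrightarrow> F \<phi> = dist_dt (st_dist G) \<phi>"
    using G by (auto simp: primitive_Cm1_def)
  define h where "h = (\<lambda>t. fourier_coeff (G t) n - g t n)"
  have cG: "continuous_on {0..1} (\<lambda>t. fourier_coeff (G t) n)"
    by (rule C0_sobolev_coeff_continuous[OF GC])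
  have cg: "continuous_on {0..1} (\<lambda>t. g t n)"
    using g by (simp add: controlled_def)
  have "h t = h 0"
  proof (rule weakly_constant[OF _ _ t])
    show "continuous_on {0..1} h" unfolding h_def by (intro continuous_intros cG cg)
    fix \<psi> \<psi>' a b
    assume \<psi>: "\<psi> \<in> bump_primitives" "\<And>t. (\<psi> has_vector_derivative \<psi>' t) (at t)"
      "0 < a" "b < (1::real)" "\<And>t. \<psi> t \<noteq> 0 \<Longrightarrow> a \<le> t \<and> t \<le> b"
    define \<phi> where "\<phi> = (\<lambda>(t, x). \<psi> t * cis (- (of_int n * x)))"
    have \<phi>: "\<phi> \<in> test_ST" "dt \<phi> (t, x) = \<psi>' t * cis (- (of_int n * x))" for t x
      unfolding \<phi>_def using bump_test_ST[OF \<psi>, where n = n] by blast+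
    have c\<psi>': "continuous_on {0..1} \<psi>'"
      by (rule bump_primitives_derivative_continuous[OF \<psi>(1,2)])
    have "pairing g (slice_fc (dt \<phi>)) = integral {0..1} (\<lambda>t. g t n * (2 * of_real pi * \<psi>' t))"
      unfolding pairing_def
    proof (rule integral_cong)
      fix t :: real
      have c: "slice_fc (dt \<phi>) t k = (if k = n then 2 * of_real pi * \<psi>' t else 0)" for k
        unfolding slice_fc_def \<phi>(2) by (rule fc_cis)
      have "(\<Sum>\<^sub>\<infinity>k. g t k * slice_fc (dt \<phi>) t k) = (\<Sum>\<^sub>\<infinity>k\<in>{n}. g t k * slice_fc (dt \<phi>) t k)"
        by (rule infsum_cong_neutral) (auto simp: c)
      thus "(\<Sum>\<^sub>\<infinity>k. g t k * slice_fc (dt \<phi>) t k) = g t n * (2 * of_real pi * \<psi>' t)"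
        by (simp add: c)
    qed
    moreover have "st_dist G (dt \<phi>) = integral {0..1} (\<lambda>t. fourier_coeff (G t) n * (2 * of_real pi * \<psi>' t))"
      unfolding st_dist_def
    proof (rule integral_cong)
      fix t :: real assume "t \<in> {0..1}"
      hence "distribution_T (G t)" using GC by (auto simp: C0_sobolev_def sobolev_def)
      hence "G t (\<lambda>x. \<psi>' t * cis (- (of_int n * x)) + 0 * cis (- (of_int n * x)))
          = \<psi>' t * G t (\<lambda>x. cis (- (of_int n * x))) + 0 * G t (\<lambda>x. cis (- (of_int n * x)))"
        by (rule distribution_T_linear) (rule cis_in_test_T)+
      thus "G t (\<lambda>x. dt \<phi> (t, x)) = fourier_coeff (G t) n * (2 * of_real pi * \<psi>' t)"
        unfolding \<phi>(2) by (simp add: fourier_coeff_def)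
    qed
    moreover have "pairing g (slice_fc (dt \<phi>)) = st_dist G (dt \<phi>)"
      using F[OF \<phi>(1)] GF[OF \<phi>(1)] by (simp add: dist_dt_def)
    ultimately have eq: "integral {0..1} (\<lambda>t. fourier_coeff (G t) n * (2 * of_real pi * \<psi>' t))
        = integral {0..1} (\<lambda>t. g t n * (2 * of_real pi * \<psi>' t))" by simp
    have "integral {0..1} (\<lambda>t. h t * (2 * of_real pi * \<psi>' t)) = 0"
      unfolding h_def left_diff_distrib
      by (subst Henstock_Kurzweil_Integration.integral_diff)
         (auto intro!: integrable_continuous_real continuous_intros cG cg c\<psi>' simp: eq)
    moreover have "integral {0..1} (\<lambda>t. h t * (2 * of_real pi * \<psi>' t)) = 2 * of_real pi * integral {0..1} (\<lambda>t. h t * \<psi>' t)"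
      by (subst Henstock_Kurzweil_Integration.integral_mult_right[symmetric]) (simp add: mult_ac)
    ultimately show "integral {0..1} (\<lambda>t. h t * \<psi>' t) = 0" by simp
  qed
  also have "h 0 = 0"
    using G0[OF cis_in_test_T[of n]] by (simp add: h_def fourier_coeff_def g(2))
  finally show ?thesis by (simp add: h_def)
qed

text \<open>The norm evaluates a primitive that is merely chosen; by uniqueness it has the coefficients $g$.\<close>

lemma Cm1_norm_bounds:
  assumes g: "controlled s D g" "\<And>n. g 0 n = 0"
    and F: "\<And>\<phi>. \<phi> \<in> test_ST \<Longrightarrow> F \<phi> = - pairing g (slice_fc (dt \<phi>))"
    and E: "\<And>t n. t \<in> {0..1} \<Longrightarrow> cmod (g t n) \<le> E n" "\<And>n. E n \<le> D n"
  shows "0 \<le> Cm1_norm s F" "Cm1_norm s F \<le> sqrt (\<Sum>\<^sub>\<infinity>n. (weight s n * E n)\<^sup>2)"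
proof -
  define G where "G = (SOME G. primitive_Cm1 s F G)"
  have G: "primitive_Cm1 s F G"
    unfolding G_def by (rule someI[of "primitive_Cm1 s F"], rule primitive_Cm1_trig_dist[OF g F])
  have co: "fourier_coeff (G t) n = g t n" if "t \<in> {0..1}" for t n
    by (rule primitive_Cm1_unique[OF g F G that])
  have E0: "0 \<le> E n" for n using order_trans[OF norm_ge_zero E(1)[of 0 n]] by simp
  have "(\<lambda>n. weight s n * D n) summable_on UNIV" using g by (simp add: controlled_def)
  hence "(\<lambda>n. weight s n * E n) summable_on UNIV"
    by (rule summable_on_comparison_test) (use E0 E(2) weight_pos in \<open>auto simp: less_imp_le intro!: mult_left_mono\<close>)
  hence sE: "(\<lambda>n. (weight s n * E n)\<^sup>2) summable_on UNIV"
    using E0 weight_pos by (intro summable_on_square) (auto simp: less_imp_le)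
  have le: "sobolev_norm s (G t) \<le> sqrt (\<Sum>\<^sub>\<infinity>n. (weight s n * E n)\<^sup>2)" if t: "t \<in> {0..1}" for t
  proof -
    have "sobolev_term s (G t) summable_on UNIV"
      using G t by (auto simp: primitive_Cm1_def C0_sobolev_def sobolev_def)
    hence "(\<Sum>\<^sub>\<infinity>n. sobolev_term s (G t) n) \<le> (\<Sum>\<^sub>\<infinity>n. (weight s n * E n)\<^sup>2)"
    proof (rule infsum_mono[OF _ sE])
      show "sobolev_term s (G t) n \<le> (weight s n * E n)\<^sup>2" for n
        using E(1)[OF t, of n] weight_pos[of s n]
        by (auto simp: sobolev_term_eq co[OF t] intro!: power_mono mult_left_mono)
    qed
    thus ?thesis by (simp add: sobolev_norm_def)
  qed
  have norm: "Cm1_norm s F = (SUP t\<in>{0..1}. sobolev_norm s (G t))"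
    by (simp add: Cm1_norm_def G_def)
  show "Cm1_norm s F \<le> sqrt (\<Sum>\<^sub>\<infinity>n. (weight s n * E n)\<^sup>2)"
    unfolding norm by (rule cSUP_least) (use le in auto)
  have "bdd_above ((\<lambda>t. sobolev_norm s (G t)) ` {0..1})"
    using le by (intro bdd_aboveI[of _ "sqrt (\<Sum>\<^sub>\<infinity>n. (weight s n * E n)\<^sup>2)"]) auto
  hence "sobolev_norm s (G 0) \<le> Cm1_norm s F"
    unfolding norm by (intro cSUP_upper) auto
  moreover have "0 \<le> sobolev_norm s (G 0)"
    unfolding sobolev_norm_def by (intro real_sqrt_ge_zero infsum_nonneg) (simp add: sobolev_term_eq)
  ultimately show "0 \<le> Cm1_norm s F" by linarith
qed

section \<open>Truncated nonlinearities along a cascade\<close>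

lemma pairing_diff_left:
  assumes "\<And>n. continuous_on {0..1} (\<lambda>t. g t n)" "\<And>t n. t \<in> {0..1} \<Longrightarrow> cmod (g t n) \<le> K * bracket n"
    "\<And>n. continuous_on {0..1} (\<lambda>t. h t n)" "\<And>t n. t \<in> {0..1} \<Longrightarrow> cmod (h t n) \<le> K' * bracket n"
    "\<And>n. continuous_on {0..1} (\<lambda>t. c t n)" "\<And>t n. t \<in> {0..1} \<Longrightarrow> cmod (c t n) \<le> B / bracket n ^ 2"
  shows "pairing (\<lambda>t n. g t n - h t n) c = pairing g c - pairing h c"
proof -
  have "pairing (\<lambda>t n. g t n - h t n) c
      = integral {0..1} (\<lambda>t. (\<Sum>\<^sub>\<infinity>n. g t n * c t n) - (\<Sum>\<^sub>\<infinity>n. h t n * c t n))"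
    unfolding pairing_def
  proof (rule integral_cong)
    fix t :: real assume t: "t \<in> {0..1}"
    have "(\<Sum>\<^sub>\<infinity>n. (g t n - h t n) * c t n) = (\<Sum>\<^sub>\<infinity>n. 1 * (g t n * c t n) + (-1) * (h t n * c t n))"
      by (simp add: left_diff_distrib)
    also have "\<dots> = 1 * (\<Sum>\<^sub>\<infinity>n. g t n * c t n) + (-1) * (\<Sum>\<^sub>\<infinity>n. h t n * c t n)"
      using t by (intro infsum_lincomb trig_summable(2)[of _ K _ B] trig_summable(2)[of _ K' _ B] assms)
    finally show "(\<Sum>\<^sub>\<infinity>n. (g t n - h t n) * c t n) = (\<Sum>\<^sub>\<infinity>n. g t n * c t n) - (\<Sum>\<^sub>\<infinity>n. h t n * c t n)"
      by simp
  qed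
  also have "\<dots> = pairing g c - pairing h c"
    unfolding pairing_def
    using pairing_integrand_continuous[OF assms(1,2,5,6)] pairing_integrand_continuous[OF assms(3,4,5,6)]
    by (intro Henstock_Kurzweil_Integration.integral_diff integrable_continuous_real)
  finally show ?thesis .
qed

lemma controlled_scale:
  assumes "controlled s D g" "0 \<le> C" "\<And>n. continuous_on {0..1} (\<lambda>t. h t n)"
    "\<And>t n. t \<in> {0..1} \<Longrightarrow> cmod (h t n) \<le> C * D n"
  shows "controlled s (\<lambda>n. C * D n) h"
proof -
  obtain K where "\<And>n. D n \<le> K * bracket n" using assms(1) by (auto simp: controlled_def)
  hence "C * D n \<le> (C * K) * bracket n" for n
    using mult_left_mono[OF _ assms(2), of "D n" "K * bracket n"] by (simp add: mult.assoc)
  moreover have "(\<lambda>n. weight s n * (C * D n)) summable_on UNIV"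
    using assms(1) summable_on_cmult_right[of "\<lambda>n. weight s n * D n" UNIV C]
    by (simp add: controlled_def mult_ac)
  ultimately show ?thesis using assms(3,4) unfolding controlled_def by blast
qed

text \<open>The factor by which a cutoff with symbol $m$ changes an interaction.\<close>

definition triple_mult :: "(int \<Rightarrow> complex) \<Rightarrow> int \<times> int \<times> int \<Rightarrow> complex" where
  "triple_mult m = (\<lambda>(p, q, r). m p * cnj (m q) * m r)"

lemma norm_triple_mult_le:
  assumes "\<And>n. cmod (m n) \<le> C"
  shows "cmod (triple_mult m \<tau>) \<le> C ^ 3"
proof -
  obtain p q r where \<tau>: "\<tau> = (p, q, r)" by (cases \<tau>)
  have C: "0 \<le> C" using order_trans[OF norm_ge_zero assms] .
  have "cmod (triple_mult m \<tau>) = cmod (m p) * cmod (m q) * cmod (m r)"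
    by (simp add: \<tau> triple_mult_def norm_mult)
  also have "\<dots> \<le> C * C * C"
    by (intro mult_mono mult_nonneg_nonneg assms C) auto
  finally show ?thesis by (simp add: power3_eq_cube)
qed

definition out_freq :: "int \<times> int \<times> int \<Rightarrow> int" where
  "out_freq = (\<lambda>(p, q, r). p - q + r)"

text \<open>The Fourier coefficients of a test function in the variables in which the solution has the
  coefficients $a_n$.\<close>

definition profile :: "(real \<times> real \<Rightarrow> complex) \<Rightarrow> int \<Rightarrow> real \<Rightarrow> complex" where
  "profile \<Phi> n t = cis (- (of_int n)\<^sup>2 * t) * slice_fc \<Phi> t n"

text \<open>Test functions and their images under the free group enter all pairings only through the time
  derivative $d$ of their profiles; this predicate treats both alike.\<close>

definition admissible :: "(real \<times> real \<Rightarrow> complex) \<Rightarrow> (real \<Rightarrow> int \<Rightarrow> complex) \<Rightarrow> bool" where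
  "admissible \<Phi> d \<longleftrightarrow> (\<forall>t\<in>{0..1}. continuous_on {0..2 * pi} (\<lambda>x. \<Phi> (t, x))) \<and>
     (\<forall>n. \<forall>t\<in>{0..1}. (profile \<Phi> n has_vector_derivative d t n) (at t)) \<and>
     (\<forall>n. profile \<Phi> n 1 = 0) \<and> (\<forall>n. continuous_on {0..1} (\<lambda>t. d t n)) \<and>
     (\<exists>B. \<forall>t\<in>{0..1}. \<forall>n. cmod (d t n) \<le> B / bracket n ^ 2)"

lemma tame_decay:
  "tame c \<Longrightarrow> \<phi> \<in> test_ST \<Longrightarrow> \<exists>B. \<forall>t\<in>{0..1}. \<forall>n. cmod (c \<phi> t n) \<le> B / bracket n ^ 2"
  by (simp add: tame_def)

lemma admissible_test:
  assumes \<phi>: "\<phi> \<in> test_ST"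
  shows "admissible \<phi> (\<lambda>t n. cis (- (of_int n)\<^sup>2 * t) * (\<i> * slice_fc (dx (dx \<phi>)) t n + 1 * slice_fc (dt \<phi>) t n))"
  unfolding admissible_def
proof (intro conjI ballI allI)
  show "continuous_on {0..2 * pi} (\<lambda>x. \<phi> (t, x))" for t
    by (rule slice_continuous[OF test_ST_smooth[OF \<phi>]])
  show "(profile \<phi> n has_vector_derivative
      cis (- (of_int n)\<^sup>2 * t) * (\<i> * slice_fc (dx (dx \<phi>)) t n + 1 * slice_fc (dt \<phi>) t n)) (at t)" for n t
    unfolding profile_def
    by (rule has_vector_derivative_eq_rhs[OF has_vector_derivative_mult[OF has_vector_derivative_cis slice_fc_derivative[OF \<phi>]]])
       (simp add: slice_fc_dx_dx[OF \<phi>] algebra_simps)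
  have "\<phi> (1, x) = 0" for x
    using \<phi> unfolding test_ST_def supp_in_def by force
  thus "profile \<phi> n 1 = 0" for n
    by (simp add: profile_def slice_fc_def fc_def)
  show "continuous_on {0..1} (\<lambda>t. cis (- (of_int n)\<^sup>2 * t) * (\<i> * slice_fc (dx (dx \<phi>)) t n + 1 * slice_fc (dt \<phi>) t n))" for n
    by (intro continuous_intros slice_fc_continuous test_ST_dx test_ST_dt \<phi>)
  obtain B1 B2 where B: "\<forall>t\<in>{0..1}. \<forall>n. cmod (slice_fc (dx (dx \<phi>)) t n) \<le> B1 / bracket n ^ 2"
      "\<forall>t\<in>{0..1}. \<forall>n. cmod (slice_fc (dt \<phi>) t n) \<le> B2 / bracket n ^ 2"
    using tame_decay[OF tame_dx_dx \<phi>] tame_decay[OF tame_dt \<phi>] by blast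
  have "cmod (cis (- (of_int n)\<^sup>2 * t) * (\<i> * slice_fc (dx (dx \<phi>)) t n + 1 * slice_fc (dt \<phi>) t n)) \<le> (B1 + B2) / bracket n ^ 2"
    if "t \<in> {0..1}" for t n
  proof -
    have "cmod (\<i> * slice_fc (dx (dx \<phi>)) t n + 1 * slice_fc (dt \<phi>) t n)
        \<le> cmod (slice_fc (dx (dx \<phi>)) t n) + cmod (slice_fc (dt \<phi>) t n)"
      by (rule norm_triangle_le) (simp add: norm_mult)
    also have "\<dots> \<le> B1 / bracket n ^ 2 + B2 / bracket n ^ 2"
      using B that by (intro add_mono) auto
    finally show ?thesis by (simp add: norm_mult add_divide_distrib)
  qed
  thus "\<exists>B. \<forall>t\<in>{0..1}. \<forall>n. cmod (cis (- (of_int n)\<^sup>2 * t) * (\<i> * slice_fc (dx (dx \<phi>)) t n + 1 * slice_fc (dt \<phi>) t n)) \<le> B / bracket n ^ 2"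
    by blast
qed

lemma admissible_free_test:
  assumes \<phi>: "\<phi> \<in> test_ST"
  shows "admissible (free_test \<phi>) (slice_fc (dt \<phi>))"
proof -
  have prof: "profile (free_test \<phi>) n t = slice_fc \<phi> t n" for n t
  proof -
    have "cis (- (of_int n)\<^sup>2 * t) * cis ((of_int n)\<^sup>2 * t) = 1" by (simp add: cis_mult)
    thus ?thesis by (simp add: profile_def free_test_slice(2)[OF \<phi>] flip: mult.assoc)
  qed
  have "\<phi> (1, x) = 0" for x
    using \<phi> unfolding test_ST_def supp_in_def by force
  hence "slice_fc \<phi> 1 n = 0" for n by (simp add: slice_fc_def fc_def)
  moreover have "profile (free_test \<phi>) n = (\<lambda>t. slice_fc \<phi> t n)" for n
    by (simp add: prof fun_eq_iff)
  moreover have "\<exists>B. \<forall>t\<in>{0..1}. \<forall>n. cmod (slice_fc (dt \<phi>) t n) \<le> B / bracket n ^ 2"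
    by (rule tame_decay[OF tame_dt \<phi>])
  ultimately show ?thesis
    unfolding admissible_def
    using free_test_slice(1)[OF \<phi>] slice_fc_derivative[OF \<phi>] slice_fc_continuous[OF test_ST_dt[OF \<phi>]]
    by simp
qed

text \<open>Polynomial growth is what allows the solution to be paired with test functions.\<close>

locale slow_cascade = cascade +
  assumes bound_growth: "\<exists>K. \<forall>n. D n \<le> K * bracket n"
begin

definition U :: "real \<Rightarrow> int \<Rightarrow> complex" where
  "U t n = cis (- (of_int n)\<^sup>2 * t) * a n t"

definition solution :: "real \<Rightarrow> dist_T" where
  "solution t = trig_dist (U t)"

text \<open>The Fourier coefficients of the primitive in time of $e^{-it\Delta}\mathbf{N}(\mathcal{P}u)$, where
  $\mathcal{P}$ has the symbol $m$.\<close>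

definition response :: "(int \<Rightarrow> complex) \<Rightarrow> real \<Rightarrow> int \<Rightarrow> complex" where
  "response m t n = (\<Sum>\<tau>\<in>triads A n. triple_mult m \<tau> * duhamel a \<tau> t)"

text \<open>The equation, solved for the nonlinearity and tested: integrating by parts moves the time
  derivative from $a_n$ to the profile. In contrast to $-(iu_t+u_{xx})/\omega$, this formula can be evaluated on
  \<open>free_test \<phi>\<close> without knowing that this is a test function.\<close>

definition limit_nonlin :: dist_ST where
  "limit_nonlin \<Phi> = (\<i> / of_real \<omega>) * pairing (\<lambda>t n. a n t) (\<lambda>t n. vector_derivative (profile \<Phi> n) (at t))"

text \<open>A bound, uniform in time, for the effect of the cutoff at frequency $n$.\<close>

definition defect :: "(int \<Rightarrow> complex) \<Rightarrow> int \<Rightarrow> real" where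
  "defect m n = (\<Sum>\<tau>\<in>triads A n. cmod (triple_mult m \<tau> - 1) * supnorm (duhamel a \<tau>))"

lemma supnorm_duhamel_nonneg: "0 \<le> supnorm (duhamel a \<tau>)"
  by (intro supnorm_nonneg duhamel_continuous flat_modes)

lemma norm_duhamel_le: "t \<in> {0..1} \<Longrightarrow> cmod (duhamel a \<tau> t) \<le> supnorm (duhamel a \<tau>)"
  by (intro supnorm_upper duhamel_continuous flat_modes)

lemma mode_0: "a n 0 = 0"
  by (rule flat_nonpos[OF flat_modes]) simp

lemma U_controlled: "controlled s D U"
  unfolding controlled_def
proof (intro conjI allI ballI)
  show "continuous_on {0..1} (\<lambda>t. U t n)" for n
    unfolding U_def by (intro continuous_intros flat_continuous flat_modes)
  show "cmod (U t n) \<le> D n" if "t \<in> {0..1}" for t n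
    using supnorm_upper[OF flat_continuous[OF flat_modes] that, of n] supnorm_mode_le[of n]
    by (simp add: U_def norm_mult)
qed (use bound_growth summable_bound in auto)

lemma response_controlled:
  assumes "\<And>n. cmod (m n) \<le> C"
  shows "controlled s (\<lambda>n. C ^ 3 * D n) (response m)"
proof (rule controlled_scale[OF U_controlled])
  have C: "0 \<le> C" using order_trans[OF norm_ge_zero assms] .
  thus "0 \<le> C ^ 3" by simp
  show "continuous_on {0..1} (\<lambda>t. response m t n)" for n
    unfolding response_def by (intro continuous_intros duhamel_continuous flat_modes)
  show "cmod (response m t n) \<le> C ^ 3 * D n" if t: "t \<in> {0..1}" for t n
  proof -
    have "cmod (response m t n) \<le> (\<Sum>\<tau>\<in>triads A n. C ^ 3 * supnorm (duhamel a \<tau>))"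
      unfolding response_def
    proof (rule sum_norm_le)
      show "cmod (triple_mult m \<tau> * duhamel a \<tau> t) \<le> C ^ 3 * supnorm (duhamel a \<tau>)" for \<tau>
        unfolding norm_mult using C
        by (intro mult_mono norm_triple_mult_le norm_duhamel_le t assms) auto
    qed
    also have "\<dots> \<le> C ^ 3 * D n"
      unfolding sum_distrib_left[symmetric] using C by (intro mult_left_mono sum_supnorm_duhamel_le) auto
    finally show ?thesis .
  qed
qed

lemma response_0: "response m 0 n = 0"
  by (simp add: response_def duhamel_def)

lemma mode_eq_response:
  assumes t: "t \<in> {0..1}"
  shows "a n t = \<i> * of_real \<omega> * response (\<lambda>_. 1) t n"
proof -
  have "((\<lambda>t. \<i> * of_real \<omega> * (\<Sum>\<tau>\<in>triads A n. cubic a \<tau> t)) has_integral a n t - a n 0) {0..t}"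
    using t mode_equation
    by (intro fundamental_theorem_of_calculus) (auto intro: has_vector_derivative_at_within)
  moreover have "((\<lambda>t. \<i> * of_real \<omega> * (\<Sum>\<tau>\<in>triads A n. cubic a \<tau> t)) has_integral
      \<i> * of_real \<omega> * (\<Sum>\<tau>\<in>triads A n. duhamel a \<tau> t)) {0..t}"
    unfolding duhamel_def
    by (intro has_integral_mult_right has_integral_sum finite_interactions integrable_integral
        integrable_continuous_real flat_continuous cubic_flat flat_modes)
  ultimately have "a n t - a n 0 = \<i> * of_real \<omega> * (\<Sum>\<tau>\<in>triads A n. duhamel a \<tau> t)"
    by (rule has_integral_unique)
  thus ?thesis by (simp add: mode_0 response_def triple_mult_def case_prod_unfold)
qed

lemma duhamel_eq_0:
  assumes "\<tau> \<notin> triads A (out_freq \<tau>)"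
  shows "duhamel a \<tau> t = 0"
proof -
  obtain p q r where \<tau>: "\<tau> = (p, q, r)" by (cases \<tau>)
  have "p \<notin> A \<or> q \<notin> A \<or> r \<notin> A \<or> res_sign p q r = 0"
    using assms by (auto simp: \<tau> triads_def out_freq_def)
  hence "cubic a \<tau> = (\<lambda>_. 0)"
    using modes_zero[of p] modes_zero[of q] modes_zero[of r] by (auto simp: \<tau> cubic_def)
  thus ?thesis by (simp add: duhamel_def)
qed

lemma sum_triples_eq_response:
  assumes fin: "finite {n. m n \<noteq> 0}"
  defines "S \<equiv> {n. m n \<noteq> 0}"
  shows "(\<Sum>\<tau>\<in>S \<times> S \<times> S. triple_mult m \<tau> * (duhamel a \<tau> t * c (out_freq \<tau>)))
    = (\<Sum>\<^sub>\<infinity>n. response m t n * c n)"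
proof -
  define f where "f = (\<lambda>\<tau>. triple_mult m \<tau> * (duhamel a \<tau> t * c (out_freq \<tau>)))"
  define N where "N = out_freq ` (S \<times> S \<times> S)"
  have finS: "finite (S \<times> S \<times> S)" using fin by (simp add: S_def)
  have mult0: "triple_mult m \<tau> = 0" if "\<tau> \<notin> S \<times> S \<times> S" for \<tau>
    using that by (cases \<tau>) (auto simp: triple_mult_def S_def)
  have triads_out: "out_freq \<tau> = n" if "\<tau> \<in> triads A n" for \<tau> n
    using that by (cases \<tau>) (auto simp: triads_def out_freq_def)
  have resp: "response m t n * c n = (\<Sum>\<tau>\<in>triads A n. f \<tau>)" for n
    unfolding response_def f_def sum_distrib_right
    by (intro sum.cong refl) (simp add: triads_out mult.assoc)
  have "(\<Sum>\<^sub>\<infinity>n. response m t n * c n) = (\<Sum>\<^sub>\<infinity>n\<in>N. response m t n * c n)"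
  proof (rule infsum_cong_neutral)
    fix n assume "n \<in> UNIV - N"
    hence "\<tau> \<notin> S \<times> S \<times> S" if "\<tau> \<in> triads A n" for \<tau>
      using triads_out[OF that] by (auto simp: N_def)
    thus "response m t n * c n = 0"
      unfolding resp f_def by (intro sum.neutral) (simp add: mult0)
  qed auto
  also have "\<dots> = (\<Sum>n\<in>N. \<Sum>\<tau>\<in>triads A n. f \<tau>)"
    using finS by (simp add: N_def resp)
  also have "\<dots> = (\<Sum>n\<in>N. \<Sum>\<tau>\<in>{\<tau> \<in> S \<times> S \<times> S. out_freq \<tau> = n}. f \<tau>)"
  proof (rule sum.cong[OF refl], rule sum.mono_neutral_cong)
    fix n
    show "f \<tau> = 0" if "\<tau> \<in> {\<tau> \<in> S \<times> S \<times> S. out_freq \<tau> = n} - triads A n" for \<tau>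
      using that duhamel_eq_0[of \<tau>] by (auto simp: f_def)
    show "f \<tau> = 0" if "\<tau> \<in> triads A n - {\<tau> \<in> S \<times> S \<times> S. out_freq \<tau> = n}" for \<tau>
      using that mult0[of \<tau>] triads_out[of \<tau> n] by (auto simp: f_def)
  qed (use finS finite_interactions in auto)
  also have "\<dots> = (\<Sum>\<tau>\<in>S \<times> S \<times> S. f \<tau>)"
    by (rule sum.group) (use finS in \<open>auto simp: N_def\<close>)
  finally show ?thesis by (simp add: f_def)
qed

text \<open>Integration by parts in time replaces every interaction by its time integral. Only
  the time integrals are controlled by $D$: the interactions that repair the equation contain time
  derivatives of amplitudes and need not be small in $H^s$.\<close>

lemma nonlin_cutoff_eq:
  assumes fin: "finite {n. m n \<noteq> 0}" and adm: "admissible \<Phi> d"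
  shows "nonlin_cutoff (fourier_multiplier m) solution \<Phi> = - pairing (response m) d"
proof -
  define S where "S = {n. m n \<noteq> 0}"
  have finS: "finite S" "finite (S \<times> S \<times> S)" using fin by (auto simp: S_def)
  have d: "\<And>n t. t \<in> {0..1} \<Longrightarrow> (profile \<Phi> n has_vector_derivative d t n) (at t)"
      "\<And>n. profile \<Phi> n 1 = 0" "\<And>n. continuous_on {0..1} (\<lambda>t. d t n)"
    using adm by (auto simp: admissible_def)
  have pcont: "continuous_on {0..1} (profile \<Phi> n)" for n
    by (rule continuous_on_vector_derivative[OF has_vector_derivative_at_within[OF d(1)]])
  have slice: "fun_dist (nonlin (fourier_multiplier m (solution t))) (\<lambda>x. \<Phi> (t, x))
      = (\<Sum>\<tau>\<in>S \<times> S \<times> S. triple_mult m \<tau> * (cubic a \<tau> t * profile \<Phi> (out_freq \<tau>) t))"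
    if t: "t \<in> {0..1}" for t
  proof -
    have "fourier_multiplier m (solution t) = (\<lambda>x. \<Sum>n\<in>S. (m n * U t n) * cis (of_int n * x))"
      by (simp add: fourier_multiplier_def solution_def fourier_coeff_trig_dist S_def fun_eq_iff)
    hence "fun_dist (nonlin (fourier_multiplier m (solution t))) (\<lambda>x. \<Phi> (t, x))
        = (\<Sum>(p, q, r)\<in>S \<times> S \<times> S. res_sign p q r * (m p * U t p) * cnj (m q * U t q) * (m r * U t r) * slice_fc \<Phi> t (p - q + r))"
      using fun_dist_nonlin_trig[OF finS(1), of "\<lambda>x. \<Phi> (t, x)" "\<lambda>n. m n * U t n"] adm t
      by (simp add: admissible_def slice_fc_def)
    also have "\<dots> = (\<Sum>\<tau>\<in>S \<times> S \<times> S. triple_mult m \<tau> * (cubic a \<tau> t * profile \<Phi> (out_freq \<tau>) t))"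
    proof (intro sum.cong refl, clarify)
      fix p q r
      have "cis (- (of_int p)\<^sup>2 * t) * cis ((of_int q)\<^sup>2 * t) * cis (- (of_int r)\<^sup>2 * t)
          = cis (of_int ((p - q + r)\<^sup>2 - p\<^sup>2 + q\<^sup>2 - r\<^sup>2) * t) * cis (- (of_int (p - q + r))\<^sup>2 * t)"
        by (simp add: cis_mult algebra_simps)
      moreover have "res_sign p q r * (m p * U t p) * cnj (m q * U t q) * (m r * U t r) * slice_fc \<Phi> t (p - q + r)
         = (cis (- (of_int p)\<^sup>2 * t) * cis ((of_int q)\<^sup>2 * t) * cis (- (of_int r)\<^sup>2 * t)) *
           (res_sign p q r * (m p * a p t) * (cnj (m q) * cnj (a q t)) * (m r * a r t) * slice_fc \<Phi> t (p - q + r))"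
        by (simp add: U_def cis_cnj mult_ac)
      ultimately show "res_sign p q r * (m p * U t p) * cnj (m q * U t q) * (m r * U t r) * slice_fc \<Phi> t (p - q + r)
         = triple_mult m (p, q, r) * (cubic a (p, q, r) t * profile \<Phi> (out_freq (p, q, r)) t)"
        by (simp only:) (simp add: triple_mult_def cubic_def profile_def out_freq_def mult_ac)
    qed
    finally show ?thesis .
  qed
  have parts: "((\<lambda>t. cubic a \<tau> t * profile \<Phi> n t) has_integral - integral {0..1} (\<lambda>t. duhamel a \<tau> t * d t n)) {0..1}" for \<tau> n
  proof -
    have "((\<lambda>t. duhamel a \<tau> t * d t n + cubic a \<tau> t * profile \<Phi> n t) has_integral
        duhamel a \<tau> 1 * profile \<Phi> n 1 - duhamel a \<tau> 0 * profile \<Phi> n 0) {0..1}"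
      by (intro fundamental_theorem_of_calculus has_vector_derivative_mult duhamel_has_derivative flat_modes
          has_vector_derivative_at_within[OF d(1)]) auto
    moreover have "((\<lambda>t. duhamel a \<tau> t * d t n) has_integral integral {0..1} (\<lambda>t. duhamel a \<tau> t * d t n)) {0..1}"
      by (intro integrable_integral integrable_continuous_real continuous_intros duhamel_continuous flat_modes d)
    ultimately have "((\<lambda>t. (duhamel a \<tau> t * d t n + cubic a \<tau> t * profile \<Phi> n t) - duhamel a \<tau> t * d t n)
        has_integral (duhamel a \<tau> 1 * profile \<Phi> n 1 - duhamel a \<tau> 0 * profile \<Phi> n 0)
          - integral {0..1} (\<lambda>t. duhamel a \<tau> t * d t n)) {0..1}"
      by (rule has_integral_diff)
    moreover have "duhamel a \<tau> 0 = 0" by (simp add: duhamel_def)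
    ultimately show ?thesis by (simp add: d(2))
  qed
  have "nonlin_cutoff (fourier_multiplier m) solution \<Phi>
      = integral {0..1} (\<lambda>t. \<Sum>\<tau>\<in>S \<times> S \<times> S. triple_mult m \<tau> * (cubic a \<tau> t * profile \<Phi> (out_freq \<tau>) t))"
    unfolding nonlin_cutoff_def st_dist_def by (rule integral_cong) (rule slice)
  also have "\<dots> = (\<Sum>\<tau>\<in>S \<times> S \<times> S. triple_mult m \<tau> * - integral {0..1} (\<lambda>t. duhamel a \<tau> t * d t (out_freq \<tau>)))"
    by (intro integral_unique has_integral_sum finS has_integral_mult_right parts)
  also have "\<dots> = - integral {0..1} (\<lambda>t. \<Sum>\<tau>\<in>S \<times> S \<times> S. triple_mult m \<tau> * (duhamel a \<tau> t * d t (out_freq \<tau>)))"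
  proof -
    have "((\<lambda>t. \<Sum>\<tau>\<in>S \<times> S \<times> S. triple_mult m \<tau> * (duhamel a \<tau> t * d t (out_freq \<tau>))) has_integral
        (\<Sum>\<tau>\<in>S \<times> S \<times> S. triple_mult m \<tau> * integral {0..1} (\<lambda>t. duhamel a \<tau> t * d t (out_freq \<tau>)))) {0..1}"
      by (intro has_integral_sum finS has_integral_mult_right integrable_integral integrable_continuous_real
          continuous_intros duhamel_continuous flat_modes d)
    thus ?thesis by (simp add: integral_unique sum_negf)
  qed
  also have "\<dots> = - pairing (response m) d"
    unfolding pairing_def S_def sum_triples_eq_response[OF fin] ..
  finally show ?thesis .
qed

lemma limit_nonlin_eq:
  assumes adm: "admissible \<Phi> d"
  shows "limit_nonlin \<Phi> = - pairing (response (\<lambda>_. 1)) d"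
proof -
  have "pairing (\<lambda>t n. a n t) (\<lambda>t n. vector_derivative (profile \<Phi> n) (at t))
      = integral {0..1} (\<lambda>t. \<i> * of_real \<omega> * (\<Sum>\<^sub>\<infinity>n. response (\<lambda>_. 1) t n * d t n))"
    unfolding pairing_def
  proof (rule integral_cong)
    fix t :: real assume t: "t \<in> {0..1}"
    have "vector_derivative (profile \<Phi> n) (at t) = d t n" for n
      using adm t by (intro vector_derivative_at) (auto simp: admissible_def)
    hence "(\<Sum>\<^sub>\<infinity>n. a n t * vector_derivative (profile \<Phi> n) (at t))
        = (\<Sum>\<^sub>\<infinity>n. \<i> * of_real \<omega> * (response (\<lambda>_. 1) t n * d t n))"
      by (simp add: mode_eq_response[OF t] mult.assoc)
    thus "(\<Sum>\<^sub>\<infinity>n. a n t * vector_derivative (profile \<Phi> n) (at t))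
        = \<i> * of_real \<omega> * (\<Sum>\<^sub>\<infinity>n. response (\<lambda>_. 1) t n * d t n)"
      by (simp only: infsum_cmult_right')
  qed
  also have "\<dots> = \<i> * of_real \<omega> * pairing (response (\<lambda>_. 1)) d"
    unfolding pairing_def by (rule Henstock_Kurzweil_Integration.integral_mult_right)
  finally show ?thesis
    using omega_nonzero by (simp add: limit_nonlin_def)
qed

lemma response_diff_le:
  assumes "t \<in> {0..1}"
  shows "cmod (response m t n - response (\<lambda>_. 1) t n) \<le> defect m n"
proof -
  have "response m t n - response (\<lambda>_. 1) t n = (\<Sum>\<tau>\<in>triads A n. (triple_mult m \<tau> - 1) * duhamel a \<tau> t)"
    by (simp add: response_def triple_mult_def case_prod_unfold left_diff_distrib sum_subtractf)
  also have "cmod \<dots> \<le> defect m n"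
    unfolding defect_def by (intro sum_norm_le) (auto simp: norm_mult intro!: mult_left_mono norm_duhamel_le assms)
  finally show ?thesis .
qed

lemma defect_nonneg: "0 \<le> defect m n"
  unfolding defect_def by (intro sum_nonneg mult_nonneg_nonneg supnorm_duhamel_nonneg) auto

lemma defect_le:
  assumes "\<And>n. cmod (m n) \<le> C"
  shows "defect m n \<le> (C ^ 3 + 1) * D n"
proof -
  have C: "0 \<le> C" using order_trans[OF norm_ge_zero assms] .
  have "cmod (triple_mult m \<tau> - 1) \<le> C ^ 3 + 1" for \<tau>
    using norm_triangle_ineq4[of "triple_mult m \<tau>" 1] norm_triple_mult_le[of m C \<tau>] assms by simp
  hence "defect m n \<le> (\<Sum>\<tau>\<in>triads A n. (C ^ 3 + 1) * supnorm (duhamel a \<tau>))"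
    unfolding defect_def by (intro sum_mono mult_right_mono supnorm_duhamel_nonneg)
  also have "\<dots> \<le> (C ^ 3 + 1) * D n"
    unfolding sum_distrib_left[symmetric] using C by (intro mult_left_mono sum_supnorm_duhamel_le) auto
  finally show ?thesis .
qed

lemma defect_tendsto_0:
  assumes "\<And>k. (\<lambda>N. m N k) \<longlonglongrightarrow> 1"
  shows "(\<lambda>N. defect (m N) n) \<longlonglongrightarrow> 0"
proof -
  have "(\<lambda>N. triple_mult (m N) \<tau>) \<longlonglongrightarrow> 1" for \<tau>
  proof -
    obtain p q r where \<tau>: "\<tau> = (p, q, r)" by (cases \<tau>)
    have "(\<lambda>N. m N p * cnj (m N q) * m N r) \<longlonglongrightarrow> 1 * cnj 1 * 1"
      by (intro tendsto_intros assms)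
    thus ?thesis by (simp add: \<tau> triple_mult_def)
  qed
  hence "(\<lambda>N. \<Sum>\<tau>\<in>triads A n. cmod (triple_mult (m N) \<tau> - 1) * supnorm (duhamel a \<tau>)) \<longlonglongrightarrow>
      (\<Sum>\<tau>\<in>triads A n. cmod (1 - 1) * supnorm (duhamel a \<tau>))"
    by (intro tendsto_intros)
  thus ?thesis by (simp add: defect_def)
qed

lemma nonlin_cutoff_tendsto:
  assumes fin: "\<And>N. finite {n. m N n \<noteq> 0}" and C: "\<And>N n. cmod (m N n) \<le> C"
    and lim: "\<And>k. (\<lambda>N. m N k) \<longlonglongrightarrow> 1" and adm: "admissible \<Phi> d"
  shows "(\<lambda>N. nonlin_cutoff (fourier_multiplier (m N)) solution \<Phi>) \<longlonglongrightarrow> limit_nonlin \<Phi>"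
proof -
  obtain B where B: "\<And>t n. t \<in> {0..1} \<Longrightarrow> cmod (d t n) \<le> B / bracket n ^ 2"
    and dc: "\<And>n. continuous_on {0..1} (\<lambda>t. d t n)"
    using adm unfolding admissible_def by blast
  obtain K where K: "\<And>n. D n \<le> K * bracket n" using bound_growth by blast
  have B0: "0 \<le> B" using order_trans[OF norm_ge_zero B[of 0 0]] by (simp add: bracket_def)
  have C0: "0 \<le> C" using order_trans[OF norm_ge_zero C] .
  have one: "cmod ((\<lambda>_. 1) n) \<le> 1" for n :: int by simp
  have dom: "defect (m N) n * (B / bracket n ^ 2) \<le> (C ^ 3 + 1) * K * B * (1 / bracket n)" for N n
  proof -
    have "defect (m N) n \<le> (C ^ 3 + 1) * (K * bracket n)"
      using defect_le[of "m N" C n] C mult_left_mono[OF K[of n], of "C ^ 3 + 1"] C0 by force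
    hence "defect (m N) n * (B / bracket n ^ 2) \<le> ((C ^ 3 + 1) * (K * bracket n)) * (B / bracket n ^ 2)"
      using B0 by (intro mult_right_mono) auto
    also have "\<dots> = (C ^ 3 + 1) * K * B * (1 / bracket n)"
      using bracket_pos[of n] by (simp add: power2_eq_square)
    finally show ?thesis .
  qed
  have sdom: "(\<lambda>n. (C ^ 3 + 1) * K * B * (1 / bracket n)) summable_on UNIV"
    by (intro summable_on_cmult_right summable_inverse_bracket)
  have term0: "0 \<le> defect (m N) n * (B / bracket n ^ 2)" for N n
    using defect_nonneg B0 by (intro mult_nonneg_nonneg) auto
  have sd: "(\<lambda>n. defect (m N) n * (B / bracket n ^ 2)) summable_on UNIV" for N
    by (rule summable_on_comparison_test[OF sdom dom term0])
  have le: "cmod (nonlin_cutoff (fourier_multiplier (m N)) solution \<Phi> - limit_nonlin \<Phi>)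
      \<le> (\<Sum>\<^sub>\<infinity>n. defect (m N) n * (B / bracket n ^ 2))" for N
  proof -
    note cm = response_controlled[where m = "m N", OF C] response_controlled[where m = "\<lambda>_. 1", OF one]
    obtain K1 K2 where K12: "\<forall>t\<in>{0..1}. \<forall>n. cmod (response (m N) t n) \<le> K1 * bracket n"
        "\<forall>t\<in>{0..1}. \<forall>n. cmod (response (\<lambda>_. 1) t n) \<le> K2 * bracket n"
      using controlled_bound[OF cm(1)] controlled_bound[OF cm(2)] by blast
    have cont: "continuous_on {0..1} (\<lambda>t. response (m N) t n)" "continuous_on {0..1} (\<lambda>t. response (\<lambda>_. 1) t n)" for n
      using cm by (auto simp: controlled_def)
    have "nonlin_cutoff (fourier_multiplier (m N)) solution \<Phi> - limit_nonlin \<Phi>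
        = - (pairing (response (m N)) d - pairing (response (\<lambda>_. 1)) d)"
      by (simp add: nonlin_cutoff_eq[OF fin adm] limit_nonlin_eq[OF adm])
    also have "\<dots> = - pairing (\<lambda>t n. response (m N) t n - response (\<lambda>_. 1) t n) d"
      using K12 by (subst pairing_diff_left[OF cont(1) _ cont(2) _ dc B]) auto
    finally have eq: "cmod (nonlin_cutoff (fourier_multiplier (m N)) solution \<Phi> - limit_nonlin \<Phi>)
        = cmod (pairing (\<lambda>t n. response (m N) t n - response (\<lambda>_. 1) t n) d)" by simp
    have tm: "cmod ((response (m N) t n - response (\<lambda>_. 1) t n) * d t n) \<le> defect (m N) n * (B / bracket n ^ 2)"
      if "t \<in> {0..1}" for t n
      unfolding norm_mult using response_diff_le[OF that] B[OF that] defect_nonneg by (intro mult_mono) auto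
    have "cmod (pairing (\<lambda>t n. response (m N) t n - response (\<lambda>_. 1) t n) d)
        \<le> (\<Sum>\<^sub>\<infinity>n. defect (m N) n * (B / bracket n ^ 2)) * (1 - 0)"
      unfolding pairing_def
    proof (rule integral_bound)
      show "continuous_on {0..1} (\<lambda>t. \<Sum>\<^sub>\<infinity>n. (response (m N) t n - response (\<lambda>_. 1) t n) * d t n)"
        by (rule continuous_on_infsum[OF _ tm sd]) (intro continuous_intros cont dc)
      fix t :: real assume t: "t \<in> {0..1}"
      have s: "(\<lambda>n. cmod ((response (m N) t n - response (\<lambda>_. 1) t n) * d t n)) summable_on UNIV"
        by (rule summable_on_comparison_test[OF sd tm[OF t]]) simp
      have "cmod (\<Sum>\<^sub>\<infinity>n. (response (m N) t n - response (\<lambda>_. 1) t n) * d t n)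
          \<le> (\<Sum>\<^sub>\<infinity>n. cmod ((response (m N) t n - response (\<lambda>_. 1) t n) * d t n))"
        by (rule norm_infsum_bound[OF s])
      also have "\<dots> \<le> (\<Sum>\<^sub>\<infinity>n. defect (m N) n * (B / bracket n ^ 2))"
        by (intro infsum_mono s sd tm t)
      finally show "cmod (\<Sum>\<^sub>\<infinity>n. (response (m N) t n - response (\<lambda>_. 1) t n) * d t n)
          \<le> (\<Sum>\<^sub>\<infinity>n. defect (m N) n * (B / bracket n ^ 2))" .
    qed simp
    thus ?thesis unfolding eq by simp
  qed
  have "(\<lambda>N. \<Sum>\<^sub>\<infinity>n. defect (m N) n * (B / bracket n ^ 2)) \<longlonglongrightarrow> 0"
  proof (rule tendsto_infsum_dominated[OF _ _ sdom])
    show "(\<lambda>N. defect (m N) n * (B / bracket n ^ 2)) \<longlonglongrightarrow> 0" for n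
      using tendsto_mult[OF defect_tendsto_0[where m = m and n = n, OF lim] tendsto_const, of "B / bracket n ^ 2"] by simp
    show "\<forall>\<^sub>F N in sequentially. \<forall>n. \<bar>defect (m N) n * (B / bracket n ^ 2)\<bar> \<le> (C ^ 3 + 1) * K * B * (1 / bracket n)"
      using dom term0 by (intro always_eventually allI) (simp only: abs_of_nonneg)
  qed
  hence "(\<lambda>N. nonlin_cutoff (fourier_multiplier (m N)) solution \<Phi> - limit_nonlin \<Phi>) \<longlonglongrightarrow> 0"
    by (rule Lim_null_comparison[rotated]) (use le in auto)
  thus ?thesis by (rule LIM_zero_cancel)
qed

end

section \<open>The weak solution\<close>

lemma distribution_ST_lincomb:
  assumes "distribution_ST F" "distribution_ST G"
  shows "distribution_ST (\<lambda>\<phi>. z * F \<phi> + w * G \<phi>)"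
  using assms unfolding distribution_ST_def
  by (auto simp: algebra_simps intro!: tendsto_intros)

context slow_cascade
begin

lemma U_bounds:
  obtains K where "\<And>n. continuous_on {0..1} (\<lambda>t. U t n)"
    "\<And>t n. t \<in> {0..1} \<Longrightarrow> cmod (U t n) \<le> K * bracket n"
  using U_controlled controlled_bound[OF U_controlled] unfolding controlled_def by blast

lemma limit_nonlin_test:
  assumes \<phi>: "\<phi> \<in> test_ST"
  shows "limit_nonlin \<phi> = (\<i> / of_real \<omega>) *
    (\<i> * pairing U (slice_fc (dx (dx \<phi>))) + 1 * pairing U (slice_fc (dt \<phi>)))"
proof -
  obtain K where K: "\<And>n. continuous_on {0..1} (\<lambda>t. U t n)"
    "\<And>t n. t \<in> {0..1} \<Longrightarrow> cmod (U t n) \<le> K * bracket n" by (rule U_bounds) blast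
  obtain B1 B2 where B: "\<forall>t\<in>{0..1}. \<forall>n. cmod (slice_fc (dx (dx \<phi>)) t n) \<le> B1 / bracket n ^ 2"
      "\<forall>t\<in>{0..1}. \<forall>n. cmod (slice_fc (dt \<phi>) t n) \<le> B2 / bracket n ^ 2"
    using tame_decay[OF tame_dx_dx \<phi>] tame_decay[OF tame_dt \<phi>] by blast
  have "pairing (\<lambda>t n. a n t) (\<lambda>t n. vector_derivative (profile \<phi> n) (at t))
      = pairing U (\<lambda>t n. \<i> * slice_fc (dx (dx \<phi>)) t n + 1 * slice_fc (dt \<phi>) t n)"
    unfolding pairing_def
  proof (rule integral_cong)
    fix t :: real assume t: "t \<in> {0..1}"
    have "vector_derivative (profile \<phi> n) (at t)
        = cis (- (of_int n)\<^sup>2 * t) * (\<i> * slice_fc (dx (dx \<phi>)) t n + 1 * slice_fc (dt \<phi>) t n)" for n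
      using admissible_test[OF \<phi>] t by (intro vector_derivative_at) (simp add: admissible_def)
    thus "(\<Sum>\<^sub>\<infinity>n. a n t * vector_derivative (profile \<phi> n) (at t))
        = (\<Sum>\<^sub>\<infinity>n. U t n * (\<i> * slice_fc (dx (dx \<phi>)) t n + 1 * slice_fc (dt \<phi>) t n))"
      by (simp only: U_def mult_ac)
  qed
  also have "\<dots> = \<i> * pairing U (slice_fc (dx (dx \<phi>))) + 1 * pairing U (slice_fc (dt \<phi>))"
    using B by (intro pairing_lincomb[OF K, of _ B1 _ B2] slice_fc_continuous test_ST_dx test_ST_dt \<phi>) auto
  finally show ?thesis by (simp only: limit_nonlin_def)
qed

lemma limit_nonlin_distribution: "distribution_ST limit_nonlin"
proof -
  obtain K where K: "\<And>n. continuous_on {0..1} (\<lambda>t. U t n)"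
    "\<And>t n. t \<in> {0..1} \<Longrightarrow> cmod (U t n) \<le> K * bracket n" by (rule U_bounds) blast
  have "distribution_ST (\<lambda>\<phi>. (\<i> / of_real \<omega>) * \<i> * pairing U (slice_fc (dx (dx \<phi>)))
      + (\<i> / of_real \<omega>) * pairing U (slice_fc (dt \<phi>)))"
    by (intro distribution_ST_lincomb pairing_distribution[OF K] tame_dx_dx tame_dt)
  thus ?thesis
    by (rule distribution_ST_cong) (simp add: limit_nonlin_test ring_distribs)
qed

lemma nonlin_exists: "nonlin_exists_eq solution limit_nonlin"
  unfolding nonlin_exists_eq_def dist_ST_tendsto_def fourier_cutoffs_def
proof (intro conjI allI impI ballI limit_nonlin_distribution, elim exE conjE)
  fix P \<phi> m C
  assume "\<phi> \<in> test_ST" and m: "\<forall>N. finite {n. m N n \<noteq> 0}" "\<forall>N n. cmod (m N n) \<le> C"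
    "\<forall>k. (\<lambda>N. m N k) \<longlonglongrightarrow> 1" "\<forall>N. P N = fourier_multiplier (m N)"
  thus "(\<lambda>N. nonlin_cutoff (P N) solution \<phi>) \<longlonglongrightarrow> limit_nonlin \<phi>"
    using nonlin_cutoff_tendsto[of m C \<phi>, OF _ _ _ admissible_test] by simp
qed

lemma st_dist_solution: "st_dist solution \<Phi> = pairing U (slice_fc \<Phi>)"
  by (simp add: st_dist_def pairing_def solution_def trig_dist_def slice_fc_def)

lemma solution_weak: "weak_solution_ext s \<omega> (\<lambda>\<psi>. 0) solution"
  unfolding weak_solution_ext_def
proof (intro conjI ballI exI)
  show "solution \<in> C0_sobolev s"
    using controlled_C0_sobolev[OF U_controlled] unfolding solution_def[abs_def] .
  show "solution 0 \<psi> = 0" for \<psi>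
    by (simp add: solution_def trig_dist_def U_def mode_0)
  show "nonlin_exists_eq solution limit_nonlin" by (rule nonlin_exists)
  show "\<i> * dist_dt (st_dist solution) \<phi> + dist_dx (dist_dx (st_dist solution)) \<phi>
      + of_real \<omega> * limit_nonlin \<phi> = 0" if "\<phi> \<in> test_ST" for \<phi>
    using omega_nonzero
    by (simp add: dist_dt_def dist_dx_def st_dist_solution limit_nonlin_test[OF that] algebra_simps)
qed

text \<open>On \<open>free_test \<phi>\<close> the phases cancel and the profile is the Fourier coefficient of \<open>\<phi>\<close>, so the
  response is the primitive in time.\<close>

lemma free_evol_nonlin_cutoff:
  assumes "finite {n. m n \<noteq> 0}" "\<phi> \<in> test_ST"
  shows "free_evol (nonlin_cutoff (fourier_multiplier m) solution) \<phi> = - pairing (response m) (slice_fc (dt \<phi>))"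
  unfolding free_evol_def by (rule nonlin_cutoff_eq[OF assms(1) admissible_free_test[OF assms(2)]])

lemma free_evol_limit_nonlin:
  assumes "\<phi> \<in> test_ST"
  shows "free_evol limit_nonlin \<phi> = - pairing (response (\<lambda>_. 1)) (slice_fc (dt \<phi>))"
  unfolding free_evol_def by (rule limit_nonlin_eq[OF admissible_free_test[OF assms]])

lemma free_evol_Cm1_tendsto:
  assumes "fourier_cutoffs P"
  shows "Cm1_tendsto s (\<lambda>N. free_evol (nonlin_cutoff (P N) solution)) (free_evol limit_nonlin)"
proof -
  obtain m C where fin: "\<And>N. finite {n. m N n \<noteq> 0}" and C: "\<And>N n. cmod (m N n) \<le> C"
    and lim: "\<And>k. (\<lambda>N. m N k) \<longlonglongrightarrow> 1" and P: "\<And>N. P N = fourier_multiplier (m N)"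
    using assms unfolding fourier_cutoffs_def by blast
  have C0: "0 \<le> C" using order_trans[OF norm_ge_zero C] .
  have one: "cmod ((\<lambda>_. 1) n) \<le> 1" for n :: int by simp
  have cm: "controlled s (\<lambda>n. C ^ 3 * D n) (response (m N))" for N
    by (rule response_controlled[where m = "m N", OF C])
  note c1 = response_controlled[where m = "\<lambda>_. 1", OF one]
  define g where "g = (\<lambda>N t n. response (m N) t n - response (\<lambda>_. 1) t n)"
  have cont: "continuous_on {0..1} (\<lambda>t. response (m N) t n)" "continuous_on {0..1} (\<lambda>t. response (\<lambda>_. 1) t n)" for N n
    using cm[of N] c1 by (auto simp: controlled_def)
  have gE: "cmod (g N t n) \<le> defect (m N) n" if "t \<in> {0..1}" for N t n
    unfolding g_def by (rule response_diff_le[OF that])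
  have ED: "defect (m N) n \<le> (C ^ 3 + 1) * D n" for N n
    by (rule defect_le[where m = "m N", OF C])
  have cg: "controlled s (\<lambda>n. (C ^ 3 + 1) * D n) (g N)" for N
  proof (rule controlled_scale[OF U_controlled])
    show "continuous_on {0..1} (\<lambda>t. g N t n)" for n
      unfolding g_def by (intro continuous_intros cont)
    show "cmod (g N t n) \<le> (C ^ 3 + 1) * D n" if "t \<in> {0..1}" for t n
      using gE[OF that] ED order_trans by blast
  qed (use C0 in simp)
  have g0: "g N 0 n = 0" for N n by (simp add: g_def response_0)
  have F: "free_evol (nonlin_cutoff (P N) solution) \<phi> - free_evol limit_nonlin \<phi> = - pairing (g N) (slice_fc (dt \<phi>))"
    if \<phi>: "\<phi> \<in> test_ST" for N \<phi>
  proof -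
    obtain K1 K2 where K12: "\<forall>t\<in>{0..1}. \<forall>n. cmod (response (m N) t n) \<le> K1 * bracket n"
        "\<forall>t\<in>{0..1}. \<forall>n. cmod (response (\<lambda>_. 1) t n) \<le> K2 * bracket n"
      using controlled_bound[OF cm[of N]] controlled_bound[OF c1] by blast
    obtain B where B: "\<forall>t\<in>{0..1}. \<forall>n. cmod (slice_fc (dt \<phi>) t n) \<le> B / bracket n ^ 2"
      using tame_decay[OF tame_dt \<phi>] by blast
    have "pairing (g N) (slice_fc (dt \<phi>)) = pairing (response (m N)) (slice_fc (dt \<phi>)) - pairing (response (\<lambda>_. 1)) (slice_fc (dt \<phi>))"
      unfolding g_def using K12 B
      by (intro pairing_diff_left[where K = K1 and K' = K2 and B = B] cont slice_fc_continuous test_ST_dt \<phi>) auto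
    thus ?thesis
      by (simp add: P free_evol_nonlin_cutoff[OF fin \<phi>] free_evol_limit_nonlin[OF \<phi>])
  qed
  have norms: "0 \<le> Cm1_norm s (\<lambda>\<phi>. free_evol (nonlin_cutoff (P N) solution) \<phi> - free_evol limit_nonlin \<phi>)"
    "Cm1_norm s (\<lambda>\<phi>. free_evol (nonlin_cutoff (P N) solution) \<phi> - free_evol limit_nonlin \<phi>)
      \<le> sqrt (\<Sum>\<^sub>\<infinity>n. (weight s n * defect (m N) n)\<^sup>2)" for N
    by (rule Cm1_norm_bounds[OF cg g0 F gE ED]; assumption)+
  have "(\<lambda>N. sqrt (\<Sum>\<^sub>\<infinity>n. (weight s n * defect (m N) n)\<^sup>2)) \<longlonglongrightarrow> 0"
  proof (rule sobolev_norm_le_tends)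
    show "(\<lambda>N. defect (m N) n) \<longlonglongrightarrow> 0" for n by (rule defect_tendsto_0[where m = m, OF lim])
    show "\<forall>\<^sub>F N in sequentially. \<forall>n. \<bar>defect (m N) n\<bar> \<le> (C ^ 3 + 1) * D n"
      using ED defect_nonneg by (intro always_eventually allI) (simp only: abs_of_nonneg)
    show "(\<lambda>n. weight s n * ((C ^ 3 + 1) * D n)) summable_on UNIV"
      using cg by (simp add: controlled_def)
    show "0 \<le> (C ^ 3 + 1) * D n" for n
      by (rule order_trans[OF defect_nonneg ED])
  qed
  hence "(\<lambda>N. Cm1_norm s (\<lambda>\<phi>. free_evol (nonlin_cutoff (P N) solution) \<phi> - free_evol limit_nonlin \<phi>)) \<longlonglongrightarrow> 0"
    by (rule tendsto_sandwich[OF always_eventually always_eventually tendsto_const, rotated 2]) (use norms in auto)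
  moreover have "free_evol (nonlin_cutoff (P N) solution) \<in> Cm1_sobolev s" for N
    by (rule Cm1_sobolevI[OF cm response_0]) (simp add: P free_evol_nonlin_cutoff[OF fin])
  moreover have "free_evol limit_nonlin \<in> Cm1_sobolev s"
    by (rule Cm1_sobolevI[OF c1 response_0]) (rule free_evol_limit_nonlin)
  ultimately show ?thesis by (simp add: Cm1_tendsto_def)
qed

lemma solution_nonzero:
  assumes "a 0 1 \<noteq> 0"
  shows "\<exists>t\<in>{0..1}. \<exists>\<psi>\<in>test_T. solution t \<psi> \<noteq> 0"
proof (intro bexI)
  have "fourier_coeff (solution 1) 0 = a 0 1"
    unfolding solution_def fourier_coeff_trig_dist by (simp add: U_def)
  thus "solution 1 (\<lambda>x. cis (- (of_int 0 * x))) \<noteq> 0"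
    using assms unfolding fourier_coeff_def by (metis div_0)
  show "(\<lambda>x. cis (- (of_int 0 * x))) \<in> test_T" by (rule cis_in_test_T)
qed simp

end

text \<open>For $s<-2$ a cascade for the exponent $-2$ is taken. Its weights are
  larger, and the weights for an exponent of at least $-2$ imply growth of at most $n^2$.\<close>

lemma slow_cascade_exists:
  assumes "s < 0" "\<omega> \<noteq> 0"
  shows "\<exists>A a D. slow_cascade s \<omega> A a D \<and> a 0 1 \<noteq> 0"
proof -
  define s' where "s' = max s (- 2)"
  have s': "s' < 0" "s \<le> s'" "- 2 \<le> s'" using assms by (auto simp: s'_def)
  obtain A a D where c: "cascade s' \<omega> A a D" and a: "a 0 1 \<noteq> 0"
    using cascade_exists[OF s'(1) assms(2)] by blast
  interpret cascade s' \<omega> A a D by (rule c)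
  have D0: "0 \<le> D n" for n
    using order_trans[OF supnorm_nonneg[OF flat_continuous[OF flat_modes]] supnorm_mode_le] .
  have "weight s n * D n \<le> weight s' n * D n" for n
    unfolding weight_def using s' by (intro mult_right_mono D0 powr_mono) auto
  hence sum: "(\<lambda>n. weight s n * D n) summable_on UNIV"
    using D0 weight_pos by (intro summable_on_comparison_test[OF summable_bound]) (auto simp: less_imp_le)
  have "D n \<le> infsum (\<lambda>n. weight s' n * D n) UNIV * bracket n" for n
  proof -
    let ?I = "infsum (\<lambda>n. weight s' n * D n) UNIV"
    have "inverse (bracket n) \<le> weight s' n"
      using powr_mono[of "- 1" "s' / 2" "bracket n"] s' bracket_ge_1[of n]
      by (simp add: weight_def bracket_def powr_minus)
    hence "inverse (bracket n) * D n \<le> weight s' n * D n"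
      by (rule mult_right_mono[OF _ D0])
    also have "\<dots> = sum (\<lambda>n. weight s' n * D n) {n}" by simp
    also have "\<dots> \<le> ?I"
      by (rule finite_sum_le_infsum) (use summable_bound D0 weight_pos in \<open>auto simp: less_imp_le\<close>)
    finally show ?thesis
      using bracket_pos[of n] by (simp add: field_simps)
  qed
  hence "slow_cascade s \<omega> A a D"
    using omega_nonzero flat_modes modes_zero finite_interactions mode_equation supnorm_mode_le
      sum_supnorm_duhamel_le sum
    by unfold_locales blast+
  thus ?thesis using a by blast
qed

theorem theorem2p1:
  fixes s \<omega> :: real
  assumes "s < 0" and "\<omega> \<noteq> 0"
  shows "\<exists>u v. weak_solution_ext s \<omega> (\<lambda>\<psi>. 0) u \<and>
           (\<exists>t\<in>{0..1}. \<exists>\<psi>\<in>test_T. u t \<psi> \<noteq> 0) \<and>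
           nonlin_exists_eq u v \<and>
           (\<forall>P. fourier_cutoffs P \<longrightarrow>
              Cm1_tendsto s (\<lambda>N. free_evol (nonlin_cutoff (P N) u)) (free_evol v))"
proof -
  obtain A a D where "slow_cascade s \<omega> A a D" and nz: "a 0 1 \<noteq> 0"
    using slow_cascade_exists[OF assms] by blast
  then interpret slow_cascade s \<omega> A a D by simp
  show ?thesis
    using solution_weak solution_nonzero[OF nz] nonlin_exists free_evol_Cm1_tendsto by blast
qed

end
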